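(* For any $B,C,D<\infty$ and $\varepsilon>0$, there exist $M(\varepsilon)$ and $N(\varepsilon)$ such that for any signed graphex $\mathcal W$ over a $\sigma$-finite measure space $(\Omega,\mathcal F,\mu)$ that is $(B,C,D)$-bounded there exists a finite subspace partition $\mathscr P=(\Omega_{\mathscr P},\mathcal P)$ of $\Omega$ with $\mathcal P=\{P_1,\dots,P_m\}$, $m\le M(\varepsilon)$, and $\mu(\Omega_{\mathscr P})\le N(\varepsilon)$ such that $$d_\boxtimes(\mathcal W,\mathcal W_{\mathscr P})\le\varepsilon.$$ We can take $$M(\varepsilon)=2^{(2BC+CD)/\varepsilon^2}\qquad\text{and}\qquad N(\varepsilon)=\frac{4C^3D+8BC^2D}{\varepsilon^4}.$$ Given any finite subspace partition $\mathscr Q=(\Omega_{\mathscr Q},\mathcal Q)$ of $\Omega$, we can require the subspace partition $\mathscr P=(\Omega_{\mathscr P},\mathcal P)$ to be a refinement of $\mathscr Q$. In this case, the bound on the number of parts is $|\mathcal Q|M(\varepsilon)$ and the bound on $\mu(\Omega_{\mathscr P})$ is $\mu(\Omega_{\mathscr Q})+N(\varepsilon)$.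
   Context: A signed graphex $\mathcal W=(W,S,I,\mathbf\Omega)$ consists of a $\sigma$-finite measure space $\mathbf\Omega=(\Omega,\mathcal F,\mu)$, a symmetric measurable $W\colon\Omega\times\Omega\to\mathbb R$, a measurable $S\colon\Omega\to\mathbb R$ and $I\in\mathbb R$, such that $W(\cdot,x)$ is integrable for almost all $x$ and there is a measurable $\Omega'\subseteq\Omega$ with $\mu(\Omega\setminus\Omega')<\infty$ and $\int_{\Omega'\times\Omega'}|W|+2\int_{\Omega'}|S|+2|I|<\infty$. Write $\|\mathcal W\|_1=\int|W|+2\int|S|+2|I|$, $\rho(\mathcal W)=\int W+2\int S+2I$, $D_{\mathcal W}(x)=\int_\Omega W(x,y)\,d\mu(y)+S(x)$ and $|\mathcal W|=(|W|,|S|,|I|,\mathbf\Omega)$. $\mathcal W$ is $(B,C,D)$-bounded if $\|W\|_\infty\le B$, $\|\mathcal W\|_1\le C$ and $\|D_{|\mathcal W|}\|_\infty\le D$. For functions $U$ on $\Omega\times\Omega$ and $F$ on $\Omega$ the jumble norms are $$\|U\|_\boxtimes=\sup_{S,T\subseteq\Omega}\frac1{\sqrt{\mu(S)\mu(T)}}\Big|\int_{S\times T}U\,d\mu\,d\mu\Big|,\qquad \|F\|_\boxtimes=\sup_{S\subseteq\Omega}\frac1{\sqrt{\mu(S)}}\Big|\int_SF\,d\mu\Big|,$$ suprema over measurable sets of finite nonzero measure. For signed graphexes on the same space, $$d_\boxtimes(\mathcal W_1,\mathcal W_2)=\max\{\|W_1-W_2\|_\boxtimes,\ \|D_{\mathcal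 W_1}-D_{\mathcal W_2}\|_\boxtimes,\ |\rho(\mathcal W_1)-\rho(\mathcal W_2)|\}.$$ A finite subspace partition $\mathscr P=(\Omega_{\mathscr P},\mathcal P)$ of $\Omega$ is a measurable subset $\Omega_{\mathscr P}\subseteq\Omega$ with a partition $\mathcal P$ of it into finitely many measurable sets of finite measure. $\mathscr P$ refines (is a refinement of) $\mathscr Q=(\Omega_{\mathscr Q},\mathcal Q)$ if $\Omega_{\mathscr Q}\subseteq\Omega_{\mathscr P}$ and $\mathcal P$ is a refinement of the partition $\mathcal Q\cup\{\Omega_{\mathscr P}\setminus\Omega_{\mathscr Q}\}$ of $\Omega_{\mathscr P}$. $|\mathcal Q|$ denotes the number of parts of $\mathcal Q$. Given $\mathcal W$ and $\mathscr P$ with parts $P_1,\dots,P_m$, $\mathcal W_{\mathscr P}=(W_{\mathscr P},S_{\mathscr P},I_{\mathscr P},\mathbf\Omega)$ is defined by $$I_{\mathscr P}=\tfrac12\int_{(\Omega\setminus\Omega_{\mathscr P})^2}W\,d\mu\,d\mu+\int_{\Omega\setminus\Omega_{\mathscr P}}S\,d\mu+I,$$ $$S_{\mathscr P}(x)=\frac1{\mu(P_i)}\int_{P_i}\Big(S(x')+\int_{\Omega\setminus\Omega_{\mathscr P}}W(x',y)\,d\mu(y)\Big)d\mu(x')\ \text{ if }x\in P_i,$$ $$W_{\mathscr P}(x,y)=\frac1{\mu(P_i)\mu(P_j)}\int_{P_i\times P_j}W\,d\mu\,d\mu\ \text{ if }(x,y)\in P_i\times P_j,$$ and $S_{\mathscr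 P}$, $W_{\mathscr P}$ equal to $0$ elsewhere (averages over parts of measure zero are taken to be $0$).
   Formalization: The refinement claim is stated for partitions 𝒬 with at least one part: for the empty partition the bound |𝒬|M(ε) is 0, which fails in general (one atom of mass 1, W=1, ε=1/2); that case is covered by the first claim with bound M(ε). *)

theory Defs
  imports "HOL-Probability.Essential_Supremum" "HOL-Library.Disjoint_Sets"
begin

text \<open>The triple \<open>(W, S, I)\<close>; the underlying measure space is carried as a separate
  argument \<open>M\<close>, so that several graphexes can live on the same space.\<close>

record 'a graphex =
  kernel :: "'a \<Rightarrow> 'a \<Rightarrow> real"
  star :: "'a \<Rightarrow> real"
  isolated :: real

definition signed_graphex :: "'a measure \<Rightarrow> 'a graphex \<Rightarrow> bool" where
  "signed_graphex M G \<longleftrightarrow>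
     sigma_finite_measure M \<and>
     (\<lambda>(x, y). kernel G x y) \<in> borel_measurable (M \<Otimes>\<^sub>M M) \<and>
     (\<forall>x\<in>space M. \<forall>y\<in>space M. kernel G x y = kernel G y x) \<and>
     star G \<in> borel_measurable M \<and>
     (AE x in M. integrable M (\<lambda>y. kernel G y x)) \<and>
     (\<exists>A\<in>sets M. emeasure M (space M - A) < \<infinity> \<and>
        (\<integral>\<^sup>+p\<in>A \<times> A. ennreal \<bar>kernel G (fst p) (snd p)\<bar> \<partial>(M \<Otimes>\<^sub>M M))
          + 2 * (\<integral>\<^sup>+x\<in>A. ennreal \<bar>star G x\<bar> \<partial>M) + 2 * ennreal \<bar>isolated G\<bar> < \<infinity>)"

definition graphex_norm1 :: "'a measure \<Rightarrow> 'a graphex \<Rightarrow> ennreal" where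
  "graphex_norm1 M G =
     (\<integral>\<^sup>+p. ennreal \<bar>kernel G (fst p) (snd p)\<bar> \<partial>(M \<Otimes>\<^sub>M M))
       + 2 * (\<integral>\<^sup>+x. ennreal \<bar>star G x\<bar> \<partial>M) + 2 * ennreal \<bar>isolated G\<bar>"

definition graphex_rho :: "'a measure \<Rightarrow> 'a graphex \<Rightarrow> real" where
  "graphex_rho M G =
     (\<integral>p. kernel G (fst p) (snd p) \<partial>(M \<Otimes>\<^sub>M M)) + 2 * (\<integral>x. star G x \<partial>M) + 2 * isolated G"

definition graphex_degree :: "'a measure \<Rightarrow> 'a graphex \<Rightarrow> 'a \<Rightarrow> real" where
  "graphex_degree M G x = (\<integral>y. kernel G x y \<partial>M) + star G x"

definition graphex_abs :: "'a graphex \<Rightarrow> 'a graphex" where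
  "graphex_abs G =
     \<lparr>kernel = (\<lambda>x y. \<bar>kernel G x y\<bar>), star = (\<lambda>x. \<bar>star G x\<bar>), isolated = \<bar>isolated G\<bar>\<rparr>"

text \<open>Taking the essential supremum in \<^typ>\<open>ennreal\<close> makes the norm \<open>0\<close> (not \<open>-\<infinity>\<close>)
  on a space of measure zero.\<close>

definition linf_norm :: "'a measure \<Rightarrow> ('a \<Rightarrow> real) \<Rightarrow> ennreal" where
  "linf_norm M f = esssup M (\<lambda>x. ennreal \<bar>f x\<bar>)"

text \<open>The nonnegativity conditions are needed because \<^const>\<open>ennreal\<close> sends negative numbers
  to \<open>0\<close>: a norm is never bounded by a negative number.\<close>

definition graphex_bounded :: "'a measure \<Rightarrow> real \<Rightarrow> real \<Rightarrow> real \<Rightarrow> 'a graphex \<Rightarrow> bool" where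
  "graphex_bounded M B C D G \<longleftrightarrow>
     0 \<le> B \<and> 0 \<le> C \<and> 0 \<le> D \<and>
     linf_norm (M \<Otimes>\<^sub>M M) (\<lambda>p. kernel G (fst p) (snd p)) \<le> ennreal B \<and>
     graphex_norm1 M G \<le> ennreal C \<and>
     linf_norm M (graphex_degree M (graphex_abs G)) \<le> ennreal D"

definition test_sets :: "'a measure \<Rightarrow> 'a set set" where
  "test_sets M = {A \<in> sets M. 0 < emeasure M A \<and> emeasure M A < \<infinity>}"

definition jumble_norm2 :: "'a measure \<Rightarrow> ('a \<Rightarrow> 'a \<Rightarrow> real) \<Rightarrow> ennreal" where
  "jumble_norm2 M U =
     (SUP (A, B) \<in> test_sets M \<times> test_sets M.
        ennreal (1 / sqrt (measure M A * measure M B) *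
          \<bar>LINT p : A \<times> B | (M \<Otimes>\<^sub>M M). U (fst p) (snd p)\<bar>))"

definition jumble_norm1 :: "'a measure \<Rightarrow> ('a \<Rightarrow> real) \<Rightarrow> ennreal" where
  "jumble_norm1 M F =
     (SUP A \<in> test_sets M. ennreal (1 / sqrt (measure M A) * \<bar>LINT x : A | M. F x\<bar>))"

definition jumble_dist :: "'a measure \<Rightarrow> 'a graphex \<Rightarrow> 'a graphex \<Rightarrow> ennreal" where
  "jumble_dist M G H =
     max (jumble_norm2 M (\<lambda>x y. kernel G x y - kernel H x y))
       (max (jumble_norm1 M (\<lambda>x. graphex_degree M G x - graphex_degree M H x))
          (ennreal \<bar>graphex_rho M G - graphex_rho M H\<bar>))"

definition finite_subspace_partition :: "'a measure \<Rightarrow> 'a set \<Rightarrow> 'a set set \<Rightarrow> bool" where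
  "finite_subspace_partition M A P \<longleftrightarrow>
     A \<in> sets M \<and> finite P \<and> partition_on A P \<and>
     (\<forall>X\<in>P. X \<in> sets M \<and> emeasure M X < \<infinity>)"

text \<open>The complement \<open>A - B\<close> is dropped when empty, since \<^const>\<open>partition_on\<close> does not
  admit empty parts.\<close>

definition subspace_refines :: "'a set \<Rightarrow> 'a set set \<Rightarrow> 'a set \<Rightarrow> 'a set set \<Rightarrow> bool" where
  "subspace_refines A P B Q \<longleftrightarrow> B \<subseteq> A \<and> refines A P (Q \<union> ({A - B} - {{}}))"

text \<open>The parts are disjoint, so at most one summand is nonzero and the sums below are the
  step functions that take the given value on each \<open>X\<close> (or \<open>X \<times> Y\<close>) and vanish off \<open>A\<close>.
  Since \<open>a / 0 = 0\<close>, averages over parts of measure zero are \<open>0\<close>.\<close>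

definition graphex_average :: "'a measure \<Rightarrow> 'a set \<Rightarrow> 'a set set \<Rightarrow> 'a graphex \<Rightarrow> 'a graphex" where
  "graphex_average M A P G =
     \<lparr>kernel = (\<lambda>x y. \<Sum>X\<in>P. \<Sum>Y\<in>P. indicator X x * indicator Y y *
          ((LINT p : X \<times> Y | (M \<Otimes>\<^sub>M M). kernel G (fst p) (snd p)) / (measure M X * measure M Y))),
      star = (\<lambda>x. \<Sum>X\<in>P. indicator X x *
          ((LINT x' : X | M. star G x' + (LINT y : space M - A | M. kernel G x' y)) / measure M X)),
      isolated =
          1 / 2 * (LINT p : (space M - A) \<times> (space M - A) | (M \<Otimes>\<^sub>M M). kernel G (fst p) (snd p))
          + (LINT x : space M - A | M. star G x) + isolated G\<rparr>"

end

theory Submission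
  imports Defs
begin

text \<open>Block averaging is the orthogonal projection onto step functions, it preserves \<open>\<rho>\<close>, and it sends
  the degree function \<open>F = D\<^sub>W\<close> to its block average. As \<open>\<parallel>W\<parallel>\<^sub>2\<^sup>2 \<le> BC\<close> and \<open>\<parallel>F\<parallel>\<^sub>2\<^sup>2 \<le> CD\<close>, energy increments
  give the theorem up to one unit: every new set also cuts the complement of the old partition, so
  starting from \<open>\<Q>\<close> one only controls the number of parts plus one, by \<open>(|\<Q>| + 1) 2\<^sup>K\<close> with
  \<open>K = (2BC + CD)/\<epsilon>\<^sup>2\<close>, and the stated constant requires saving a factor of two.

  The degree is treated first and at once: quantizing \<open>\<surd>|F|\<close> uniformly makes the \<open>L\<^sup>2\<close> error at most \<open>\<epsilon>\<close>
  with at most \<open>2\<^bsup>CD/\<epsilon>\<^sup>2\<^esup>\<close> classes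
  (for \<open>CD/\<epsilon>\<^sup>2 \<le> 8/5\<close> only one sign of \<open>F\<close> is quantized), and this persists under refinement. For the kernel, a violating pair
  \<open>S, T\<close> is used as follows: if \<open>S \<times> S\<close> alone carries half of the increment \<open>\<epsilon>\<^sup>2\<close>, cut along \<open>S\<close> only
  (factor 2 for half an increment); otherwise symmetry of \<open>W\<close> makes the increment of the full cut at least
  \<open>3\<epsilon>\<^sup>2/2\<close>. In both cases the last cut leaves the missing factor of two unspent. If \<open>BC < \<epsilon>\<^sup>2/2\<close>, no cut is
  ever needed and only \<open>F\<close> matters; then classes are created separately inside and outside \<open>\<Omega>\<^sub>\<Q>\<close>, an
  outside class costing a single part, and for \<open>CD/\<epsilon>\<^sup>2 \<le> 7/3\<close> one estimates the jumble norm itself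
  instead of the \<open>L\<^sup>2\<close> norm.\<close>

section \<open>Block averages\<close>

text \<open>The jumble norm of a deviation can grow when the partition is refined, while the
  \<open>L^2\<close> error of a block average cannot. This fixes the order of the argument: the
  degree has to be controlled in \<open>L^2\<close> before the kernel is cut, and estimating its
  jumble norm directly is open only when no cut follows. The number of quantization classes grows
  like the square root of \<open>CD/e^2\<close>, but 2 to the power \<open>CD/e^2\<close> classes
  are allowed, so only small values are tight; all case distinctions and numerical constants for the
  degree serve that range.

  The size bound has one summand per phase. Points outside the old carrier with label 0 stay
  outside, so quantization adds only points where \<open>|F|\<close> exceeds a multiple of
  \<open>D\<close>, and Markov's inequality leads to \<open>4C^3D/e^4\<close>. For a violating pair
  \<open>S\<close>, \<open>T\<close> the deviation is at most \<open>2C\<close> and at most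
  \<open>2D\<close> times the measure of either set; so its square, which exceeds \<open>e^2\<close>
  times the product of the measures, forces each measure below \<open>4CD/e^2\<close>. Each set used
  pays at least \<open>e^2/2\<close> out of an energy of at most \<open>BC\<close>, which adds up to
  \<open>8BC^2D/e^4\<close>.\<close>

definition block_family :: "'a measure \<Rightarrow> 'a set set \<Rightarrow> bool" where
  "block_family M P \<longleftrightarrow>
     finite P \<and> disjoint P \<and> (\<forall>X\<in>P. X \<in> sets M \<and> emeasure M X < \<infinity>)"

text \<open>Conditional expectation onto the blocks, extended by zero off their union. On the
  product space with rectangles as blocks it yields the averaged kernel.\<close>

definition block_avg :: "'a measure \<Rightarrow> 'a set set \<Rightarrow> ('a \<Rightarrow> real) \<Rightarrow> 'a \<Rightarrow> real" where
  "block_avg M P f x = (\<Sum>X\<in>P. indicator X x * ((LINT x:X|M. f x) / measure M X))"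

lemma finite_subspace_partition_block_family:
  "finite_subspace_partition M A P \<Longrightarrow> block_family M P"
  by (auto simp: finite_subspace_partition_def block_family_def partition_on_def)

lemma block_sum_eq:
  fixes d :: "'a set \<Rightarrow> real"
  assumes "block_family M P" "X \<in> P" "x \<in> X"
  shows "(\<Sum>Y\<in>P. indicator Y x * d Y) = d X"
proof -
  have "(\<Sum>Y\<in>P. indicator Y x * d Y) = (\<Sum>Y\<in>P. if Y = X then d X else 0)"
    using assms by (intro sum.cong) (auto simp: block_family_def disjoint_def indicator_def)
  then show ?thesis
    using assms by (simp add: block_family_def)
qed

lemma block_sum_outside:
  fixes d :: "'a set \<Rightarrow> real"
  assumes "x \<notin> \<Union>P"
  shows "(\<Sum>Y\<in>P. indicator Y x * d Y) = 0"
  using assms by (intro sum.neutral) auto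

lemma block_avg_eq:
  "block_family M P \<Longrightarrow> X \<in> P \<Longrightarrow> x \<in> X \<Longrightarrow>
    block_avg M P f x = (LINT x:X|M. f x) / measure M X"
  unfolding block_avg_def by (rule block_sum_eq)

lemma block_avg_outside: "x \<notin> \<Union>P \<Longrightarrow> block_avg M P f x = 0"
  unfolding block_avg_def by (rule block_sum_outside)

lemma block_sum_integrable:
  fixes d :: "'a set \<Rightarrow> real"
  assumes "block_family M P"
  shows "integrable M (\<lambda>x. \<Sum>Y\<in>P. indicator Y x * d Y)"
  using assms
  by (intro Bochner_Integration.integrable_sum integrable_mult_left integrable_real_indicator)
     (auto simp: block_family_def)

lemma block_sum_square_integrable:
  fixes d :: "'a set \<Rightarrow> real"
  assumes P: "block_family M P"
  shows "integrable M (\<lambda>x. (\<Sum>Y\<in>P. indicator Y x * d Y)\<^sup>2)"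
proof -
  have "(\<Sum>Y\<in>P. indicator Y x * d Y)\<^sup>2 = (\<Sum>Y\<in>P. indicator Y x * (d Y)\<^sup>2)" for x
  proof (cases "x \<in> \<Union>P")
    case True
    then obtain X where "X \<in> P" "x \<in> X" by auto
    then show ?thesis by (simp add: block_sum_eq[OF P])
  qed (simp add: block_sum_outside)
  then show ?thesis by (simp add: block_sum_integrable[OF P])
qed

lemma block_avg_integrable: "block_family M P \<Longrightarrow> integrable M (block_avg M P f)"
  unfolding block_avg_def[abs_def] by (rule block_sum_integrable)

lemma block_avg_measurable: "block_family M P \<Longrightarrow> block_avg M P f \<in> borel_measurable M"
  using block_avg_integrable borel_measurable_integrable by blast

text \<open>Makes division by zero harmless: on a null block the integral vanishes as well, so
  average times measure is still the integral.\<close>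

lemma set_lebesgue_integral_null:
  fixes f :: "'a \<Rightarrow> real"
  assumes "X \<in> sets M" "emeasure M X < \<infinity>" "measure M X = 0"
  shows "(LINT x:X|M. f x) = 0"
proof -
  have "X \<in> null_sets M"
    using assms by (auto simp: null_sets_def measure_def enn2real_eq_0_iff)
  then have "AE x in M. x \<notin> X" by (rule AE_not_in)
  then show ?thesis
    unfolding set_lebesgue_integral_def
    by (intro integral_eq_zero_AE) (auto elim!: eventually_mono)
qed

lemma set_integral_block_avg:
  fixes f :: "'a \<Rightarrow> real"
  assumes P: "block_family M P" and X: "X \<in> P"
  shows "(LINT x:X|M. block_avg M P f x) = (LINT x:X|M. f x)"
proof -
  have Xs: "X \<in> sets M" "emeasure M X < \<infinity>" using P X by (auto simp: block_family_def)
  have "(LINT x:X|M. block_avg M P f x) = (LINT x:X|M. (LINT x:X|M. f x) / measure M X)"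
    by (intro set_lebesgue_integral_cong) (use Xs block_avg_eq[OF P X] in auto)
  also have "\<dots> = (LINT x:X|M. f x)"
    using Xs set_lebesgue_integral_null[OF Xs]
    by (cases "measure M X = 0") (auto simp: set_lebesgue_integral_def)
  finally show ?thesis .
qed

lemma set_integrable_block:
  fixes f :: "'a \<Rightarrow> real"
  assumes "block_family M P" "X \<in> P" "integrable M f"
  shows "set_integrable M X f"
  using assms unfolding set_integrable_def block_family_def by (intro integrable_mult_indicator) auto

lemma integral_mult_block_sum:
  fixes f :: "'a \<Rightarrow> real" and d :: "'a set \<Rightarrow> real"
  assumes P: "block_family M P" and f: "integrable M f"
  shows "integrable M (\<lambda>x. f x * (\<Sum>X\<in>P. indicator X x * d X))"
    and "(\<integral>x. f x * (\<Sum>X\<in>P. indicator X x * d X) \<partial>M) = (\<Sum>X\<in>P. d X * (LINT x:X|M. f x))"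
proof -
  have *: "f x * (\<Sum>X\<in>P. indicator X x * d X) = (\<Sum>X\<in>P. d X * (indicator X x *\<^sub>R f x))" for x
    unfolding sum_distrib_left by (intro sum.cong) auto
  have i: "integrable M (\<lambda>x. d X * (indicator X x *\<^sub>R f x))" if "X \<in> P" for X
    using P that f by (intro integrable_mult_right integrable_mult_indicator) (auto simp: block_family_def)
  show "integrable M (\<lambda>x. f x * (\<Sum>X\<in>P. indicator X x * d X))"
    unfolding * by (intro Bochner_Integration.integrable_sum i)
  show "(\<integral>x. f x * (\<Sum>X\<in>P. indicator X x * d X) \<partial>M) = (\<Sum>X\<in>P. d X * (LINT x:X|M. f x))"
    unfolding * set_lebesgue_integral_def
    by (subst Bochner_Integration.integral_sum[OF i]) auto
qed

lemma square_integrable_mult: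
  fixes f g :: "'a \<Rightarrow> real"
  assumes [measurable]: "f \<in> borel_measurable M" "g \<in> borel_measurable M"
    and "integrable M (\<lambda>x. (f x)\<^sup>2)" "integrable M (\<lambda>x. (g x)\<^sup>2)"
  shows "integrable M (\<lambda>x. f x * g x)"
proof (rule Bochner_Integration.integrable_bound[where f="\<lambda>x. (f x)\<^sup>2 + (g x)\<^sup>2"])
  have "\<bar>f x * g x\<bar> \<le> \<bar>(f x)\<^sup>2 + (g x)\<^sup>2\<bar>" for x
  proof -
    have "0 \<le> (\<bar>f x\<bar> - \<bar>g x\<bar>)\<^sup>2" by simp
    then have "2 * (\<bar>f x\<bar> * \<bar>g x\<bar>) \<le> (f x)\<^sup>2 + (g x)\<^sup>2"
      by (simp add: power2_diff)
    moreover have "0 \<le> \<bar>f x\<bar> * \<bar>g x\<bar>" by simp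
    ultimately have "\<bar>f x\<bar> * \<bar>g x\<bar> \<le> (f x)\<^sup>2 + (g x)\<^sup>2" by linarith
    then show ?thesis by (simp add: abs_mult)
  qed
  then show "AE x in M. norm (f x * g x) \<le> norm ((f x)\<^sup>2 + (g x)\<^sup>2)" by simp
qed (use assms in auto)

lemma square_integrable_add:
  fixes f g :: "'a \<Rightarrow> real"
  assumes [measurable]: "f \<in> borel_measurable M" "g \<in> borel_measurable M"
    and "integrable M (\<lambda>x. (f x)\<^sup>2)" "integrable M (\<lambda>x. (g x)\<^sup>2)"
  shows "integrable M (\<lambda>x. (f x + g x)\<^sup>2)"
proof -
  have "integrable M (\<lambda>x. (f x)\<^sup>2 + 2 * (f x * g x) + (g x)\<^sup>2)"
    using assms square_integrable_mult[OF assms] by auto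
  then show ?thesis by (simp add: power2_sum algebra_simps)
qed

lemma square_integrable_diff:
  fixes f g :: "'a \<Rightarrow> real"
  assumes "f \<in> borel_measurable M" "g \<in> borel_measurable M"
    and "integrable M (\<lambda>x. (f x)\<^sup>2)" "integrable M (\<lambda>x. (g x)\<^sup>2)"
  shows "integrable M (\<lambda>x. (f x - g x)\<^sup>2)"
  using square_integrable_add[of f M "\<lambda>x. - g x"] assms by simp

lemma block_avg_square_integrable: "block_family M P \<Longrightarrow> integrable M (\<lambda>x. (block_avg M P f x)\<^sup>2)"
  unfolding block_avg_def by (rule block_sum_square_integrable)

section \<open>Step functions and refinements of block families\<close>

definition step_on :: "'a set \<Rightarrow> 'a set set \<Rightarrow> ('a \<Rightarrow> real) \<Rightarrow> bool" where
  "step_on \<Omega> P g \<longleftrightarrow> (\<forall>X\<in>P. \<exists>c. \<forall>x\<in>X. g x = c) \<and> (\<forall>x\<in>\<Omega> - \<Union>P. g x = 0)"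

text \<open>New parts may lie off all old ones, and no part is named for the complement of the old
  carrier. In this form the relation is transitive and passes to rectangles;
  \<open>subspace_refinesI\<close> translates it back.\<close>

definition block_refines :: "'a set set \<Rightarrow> 'a set set \<Rightarrow> bool" where
  "block_refines P' P \<longleftrightarrow>
     \<Union>P \<subseteq> \<Union>P' \<and> (\<forall>X'\<in>P'. (\<exists>X\<in>P. X' \<subseteq> X) \<or> X' \<inter> \<Union>P = {})"

lemma block_refines_refl: "block_refines P P"
  by (auto simp: block_refines_def)

lemma block_refines_trans:
  assumes PR: "block_refines P R" and QP: "block_refines Q P"
  shows "block_refines Q R"
  unfolding block_refines_def
proof (intro conjI ballI)
  show "\<Union>R \<subseteq> \<Union>Q" using assms unfolding block_refines_def by (meson order_trans)
next
  fix X assume X: "X \<in> Q"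
  consider Y where "Y \<in> P" "X \<subseteq> Y" | "X \<inter> \<Union>P = {}"
    using QP X unfolding block_refines_def by auto
  then show "(\<exists>Z\<in>R. X \<subseteq> Z) \<or> X \<inter> \<Union>R = {}"
  proof cases
    case 1
    then have "(\<exists>Z\<in>R. Y \<subseteq> Z) \<or> Y \<inter> \<Union>R = {}"
      using PR unfolding block_refines_def by auto
    then show ?thesis using 1(2) by blast
  next
    case 2
    have "\<Union>R \<subseteq> \<Union>P" using PR unfolding block_refines_def by simp
    then show ?thesis using 2 by blast
  qed
qed

lemma step_on_refine:
  assumes "step_on \<Omega> P g" "block_refines P' P" "\<And>X. X \<in> P' \<Longrightarrow> X \<subseteq> \<Omega>"
  shows "step_on \<Omega> P' g"
  unfolding step_on_def
proof (intro conjI ballI)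
  fix X assume X: "X \<in> P'"
  then consider Y where "Y \<in> P" "X \<subseteq> Y" | "X \<inter> \<Union>P = {}"
    using assms(2) by (auto simp: block_refines_def)
  then show "\<exists>c. \<forall>x\<in>X. g x = c"
  proof cases
    case 1 then show ?thesis using assms(1) unfolding step_on_def by (meson subsetD)
  next
    case 2
    have "g x = 0" if "x \<in> X" for x
    proof -
      have "x \<in> \<Omega> - \<Union>P" using 2 that assms(3)[OF X] by blast
      then show ?thesis using assms(1) unfolding step_on_def by simp
    qed
    then show ?thesis by blast
  qed
next
  fix x assume "x \<in> \<Omega> - \<Union>P'"
  moreover have "\<Union>P \<subseteq> \<Union>P'" using assms(2) unfolding block_refines_def by simp
  ultimately have "x \<in> \<Omega> - \<Union>P" by blast
  then show "g x = 0" using assms(1) unfolding step_on_def by simp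
qed

lemma step_on_add: "step_on \<Omega> P f \<Longrightarrow> step_on \<Omega> P g \<Longrightarrow> step_on \<Omega> P (\<lambda>x. f x + g x)"
  unfolding step_on_def by fastforce

lemma step_on_block_avg: "block_family M P \<Longrightarrow> step_on \<Omega> P (block_avg M P f)"
  unfolding step_on_def using block_avg_eq[of M P _ _ f] block_avg_outside[of _ P M f] by auto

lemma subspace_refinesI:
  assumes P: "finite_subspace_partition M A P" and Q: "finite_subspace_partition M B Q"
    and r: "block_refines P Q"
  shows "subspace_refines A P B Q"
proof -
  have PA: "partition_on A P" "\<Union>P = A" and QB: "partition_on B Q" "\<Union>Q = B"
    using P Q by (auto simp: finite_subspace_partition_def partition_on_def)
  have BA: "B \<subseteq> A" using r PA QB by (auto simp: block_refines_def)
  have "partition_on A (Q \<union> ({A - B} - {{}}))"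
    using QB BA unfolding partition_on_def disjoint_def by auto
  moreover have "\<exists>Y\<in>Q \<union> ({A - B} - {{}}). X \<subseteq> Y" if "X \<in> P" for X
  proof (cases "X \<inter> B = {}")
    case True
    moreover have "X \<noteq> {}" "X \<subseteq> A" using PA that unfolding partition_on_def by auto
    ultimately show ?thesis by auto
  next
    case False
    then show ?thesis using r that QB unfolding block_refines_def by auto
  qed
  ultimately show ?thesis
    using PA BA unfolding subspace_refines_def refines_def by auto
qed

text \<open>Inside \<open>A\<close> every part is split by all labels in \<open>I\<close>. Outside
  \<open>A\<close> each nonzero label creates one part regardless of the size of \<open>P\<close>,
  and label 0 creates none, since the points carrying it are left out of \<open>A'\<close>. This
  asymmetry is behind both the count of parts plus one and the cheap outside classes.\<close>

lemma label_refinement: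
  fixes l :: "'a \<Rightarrow> nat"
  assumes P: "finite_subspace_partition M A P"
    and l: "l \<in> measurable M (count_space UNIV)"
    and I: "finite I" "l ` A \<subseteq> I" and J: "finite J" "l ` (space M - A) \<subseteq> insert 0 J"
    and fin: "emeasure M {x\<in>space M - A. l x \<noteq> 0} < \<infinity>"
  obtains A' P' where "finite_subspace_partition M A' P'" "block_refines P' P"
    "card P' \<le> card P * card I + card J"
    "A' = A \<union> {x\<in>space M - A. l x \<noteq> 0}"
    "\<And>X. X \<in> P' \<Longrightarrow> \<exists>i. \<forall>x\<in>X. l x = i"
proof -
  define P\<^sub>1 where "P\<^sub>1 = (\<lambda>(X, i). X \<inter> {x\<in>space M. l x = i}) ` (P \<times> I)"
  define P\<^sub>2 where "P\<^sub>2 = (\<lambda>i. {x\<in>space M - A. l x = i}) ` (J - {0})"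
  define P' where "P' = P\<^sub>1 \<union> P\<^sub>2 - {{}}"
  define A' where "A' = A \<union> {x\<in>space M - A. l x \<noteq> 0}"
  have A: "A \<in> sets M" "finite P" "\<Union>P = A" "disjoint P" "{} \<notin> P"
    and PX: "\<And>X. X \<in> P \<Longrightarrow> X \<in> sets M" "\<And>X. X \<in> P \<Longrightarrow> emeasure M X < \<infinity>"
    using P by (auto simp: finite_subspace_partition_def partition_on_def)
  have lev: "{x\<in>space M - A. R (l x)} \<in> sets M" for R
  proof -
    have "{x\<in>space M - A. R (l x)} = (l -` {i. R i} \<inter> space M) - A" by auto
    then show ?thesis using measurable_sets[OF l, of "{i. R i}"] A(1) by auto
  qed
  have AM: "A \<subseteq> space M" by (rule sets.sets_into_space[OF A(1)])
  have "\<Union>P' = A'"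
  proof -
    have "\<Union>P\<^sub>1 = A" 
    proof
      show "\<Union>P\<^sub>1 \<subseteq> A" using A(3) unfolding P\<^sub>1_def by blast
      show "A \<subseteq> \<Union>P\<^sub>1"
      proof
        fix x assume x: "x \<in> A"
        then obtain X where "X \<in> P" "x \<in> X" using A(3) by auto
        moreover have "l x \<in> I" "x \<in> space M" using x I(2) AM by auto
        ultimately show "x \<in> \<Union>P\<^sub>1" unfolding P\<^sub>1_def by (intro UnionI[of "X \<inter> {y\<in>space M. l y = l x}"]) auto
      qed
    qed
    moreover have "\<Union>P\<^sub>2 = {x\<in>space M - A. l x \<noteq> 0}"

    proof
      show "\<Union>P\<^sub>2 \<subseteq> {x\<in>space M - A. l x \<noteq> 0}" unfolding P\<^sub>2_def by blast
      show "{x\<in>space M - A. l x \<noteq> 0} \<subseteq> \<Union>P\<^sub>2"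
      proof
        fix x assume x: "x \<in> {x\<in>space M - A. l x \<noteq> 0}"
        then have "l x \<in> J" using J(2) by auto
        then show "x \<in> \<Union>P\<^sub>2"
          unfolding P\<^sub>2_def using x by (intro UnionI[of "{y\<in>space M - A. l y = l x}"]) auto
      qed
    qed
    ultimately have "\<Union>(P\<^sub>1 \<union> P\<^sub>2) = A'" unfolding A'_def Union_Un_distrib by simp
    then show ?thesis unfolding P'_def by blast
  qed
  moreover have "disjoint P'"
    unfolding disjoint_def
  proof (intro ballI impI)
    fix X Y assume XY: "X \<in> P'" "Y \<in> P'" "X \<noteq> Y"
    show "X \<inter> Y = {}"
    proof (rule ccontr)
      assume "X \<inter> Y \<noteq> {}"
      then obtain x where x: "x \<in> X" "x \<in> Y" by auto
      \<comment> \<open>A part is determined by any one of its points, which gives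
        disjointness.\<close>
      have *: "Z = (if x \<in> A then (THE W. W \<in> P \<and> x \<in> W) \<inter> {y\<in>space M. l y = l x} else {y\<in>space M - A. l y = l x})"
        if Z: "Z \<in> P'" "x \<in> Z" for Z
      proof (cases "x \<in> A")
        case True
        then obtain W i where W: "W \<in> P" "Z = W \<inter> {y\<in>space M. l y = i}"
          using Z True unfolding P'_def P\<^sub>1_def P\<^sub>2_def by auto
        moreover have "(THE W. W \<in> P \<and> x \<in> W) = W"
        proof (rule the_equality)
          show xW: "W \<in> P \<and> x \<in> W" using W Z(2) by auto
          fix V assume "V \<in> P \<and> x \<in> V"
          then show "V = W" using A(4) xW unfolding disjoint_def by blast
        qed
        moreover have "l x = i" using W(2) Z(2) by simp
        ultimately show ?thesis using True by simp
      next
        case False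
        moreover have "Z \<subseteq> A" if "Z \<in> P\<^sub>1" using that A(3) unfolding P\<^sub>1_def by auto
        ultimately have "Z \<in> P\<^sub>2" using Z unfolding P'_def by auto
        then obtain i where "Z = {y\<in>space M - A. l y = i}" unfolding P\<^sub>2_def by blast
        then show ?thesis using False Z(2) by simp
      qed
      have "X = Y" by (rule trans[OF *[OF XY(1) x(1)] *[OF XY(2) x(2), symmetric]])
      then show False using XY(3) by contradiction
    qed
  qed
  moreover have "{} \<notin> P'" by (simp add: P'_def)
  ultimately have "partition_on A' P'" by (simp add: partition_on_def)
  moreover have "finite P'" using A(2) I(1) J(1) by (simp add: P'_def P\<^sub>1_def P\<^sub>2_def)
  moreover have "A' \<in> sets M" unfolding A'_def using A(1) lev[of "\<lambda>i. i \<noteq> 0"] by (rule sets.Un)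
  moreover have "X \<in> sets M \<and> emeasure M X < \<infinity>" if X: "X \<in> P'" for X
  proof -
    consider W i where "W \<in> P" "X = W \<inter> {y\<in>space M. l y = i}"
      | i where "i \<noteq> 0" "X = {y\<in>space M - A. l y = i}"
    proof -
      have "X \<in> P\<^sub>1 \<or> X \<in> P\<^sub>2" using X unfolding P'_def by simp
      then show thesis
      proof
        assume "X \<in> P\<^sub>1" then show ?thesis using that(1) unfolding P\<^sub>1_def by auto
      next
        assume "X \<in> P\<^sub>2" then show ?thesis using that(2) unfolding P\<^sub>2_def by auto
      qed
    qed
    then show ?thesis
    proof cases
      case 1
      have "X = W \<inter> (l -` {i} \<inter> space M)" unfolding 1 by auto
      then have "X \<in> sets M"
        using PX(1)[OF 1(1)] measurable_sets[OF l, of "{i}"] by auto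
      moreover have "emeasure M X \<le> emeasure M W" by (rule emeasure_mono) (use 1 PX(1) in auto)
      ultimately show ?thesis using le_less_trans[OF _ PX(2)[OF 1(1)]] by blast
    next
      case 2
      have "X \<in> sets M" unfolding 2 using lev[of "\<lambda>j. j = i"] by simp
      moreover have "emeasure M X \<le> emeasure M {x\<in>space M - A. l x \<noteq> 0}"
        by (rule emeasure_mono) (use 2 lev[of "\<lambda>i. i \<noteq> 0"] in auto)
      ultimately show ?thesis using le_less_trans[OF _ fin] by blast
    qed
  qed
  ultimately have 1: "finite_subspace_partition M A' P'"
    by (auto simp: finite_subspace_partition_def)
  have 2: "block_refines P' P"
    unfolding block_refines_def \<open>\<Union>P' = A'\<close> A(3)
  proof (intro conjI ballI)
    show "A \<subseteq> A'" by (auto simp: A'_def)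
    fix X assume "X \<in> P'"
    then have "X \<in> P\<^sub>1 \<or> X \<in> P\<^sub>2" unfolding P'_def by simp
    then show "(\<exists>Y\<in>P. X \<subseteq> Y) \<or> X \<inter> A = {}"
    proof
      assume "X \<in> P\<^sub>1" then show ?thesis unfolding P\<^sub>1_def by auto
    next
      assume "X \<in> P\<^sub>2" then show ?thesis unfolding P\<^sub>2_def by auto
    qed
  qed
  have "card P' \<le> card (P\<^sub>1 \<union> P\<^sub>2)"
    unfolding P'_def using A(2) I(1) J(1) by (intro card_mono) (auto simp: P\<^sub>1_def P\<^sub>2_def)
  also have "\<dots> \<le> card P\<^sub>1 + card P\<^sub>2" by (rule card_Un_le)
  also have "card P\<^sub>1 \<le> card (P \<times> I)"
    unfolding P\<^sub>1_def by (rule card_image_le) (use A(2) I(1) in auto)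
  also have "card P\<^sub>2 \<le> card (J - {0})"
    unfolding P\<^sub>2_def by (rule card_image_le) (use J(1) in auto)
  also have "card (J - {0}) \<le> card J" by (rule card_Diff1_le)
  finally have 3: "card P' \<le> card P * card I + card J" by (simp add: card_cartesian_product)
  have 4: "\<exists>i. \<forall>x\<in>X. l x = i" if "X \<in> P'" for X
  proof -
    have "X \<in> P\<^sub>1 \<or> X \<in> P\<^sub>2" using that unfolding P'_def by simp
    then show ?thesis
    proof
      assume "X \<in> P\<^sub>1" then show ?thesis unfolding P\<^sub>1_def by auto
    next
      assume "X \<in> P\<^sub>2" then show ?thesis unfolding P\<^sub>2_def by auto
    qed
  qed
  show thesis by (rule that[OF 1 2 3 A'_def 4])
qed

section \<open>Block averaging as an orthogonal projection\<close>

lemma step_on_rep: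
  assumes P: "block_family M P" and g: "step_on (space M) P g"
  obtains c where "\<And>x. x \<in> space M \<Longrightarrow> g x = (\<Sum>X\<in>P. indicator X x * c X)"
proof -
  obtain c where c: "\<And>X x. X \<in> P \<Longrightarrow> x \<in> X \<Longrightarrow> g x = c X"
    using g unfolding step_on_def by metis
  have "g x = (\<Sum>X\<in>P. indicator X x * c X)" if "x \<in> space M" for x
  proof (cases "x \<in> \<Union>P")
    case True
    then obtain X where "X \<in> P" "x \<in> X" by auto
    then show ?thesis using c by (simp add: block_sum_eq[OF P])
  next
    case False
    then have "x \<in> space M - \<Union>P" using that by simp
    then have "g x = 0" using g unfolding step_on_def by blast
    then show ?thesis using False by (simp add: block_sum_outside)
  qed
  then show thesis by (rule that)
qed

lemma step_on_comp: "step_on \<Omega> P g \<Longrightarrow> k 0 = 0 \<Longrightarrow> step_on \<Omega> P (\<lambda>x. k (g x))"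
  unfolding step_on_def by metis

lemma step_on_integrable:
  assumes P: "block_family M P" and g: "step_on (space M) P g"
  shows "integrable M g" "integrable M (\<lambda>x. (g x)\<^sup>2)"
proof -
  obtain c where c: "\<And>x. x \<in> space M \<Longrightarrow> g x = (\<Sum>X\<in>P. indicator X x * c X)"
    using step_on_rep[OF P g] by blast
  have "integrable M g \<longleftrightarrow> integrable M (\<lambda>x. \<Sum>X\<in>P. indicator X x * c X)"
    by (intro Bochner_Integration.integrable_cong) (auto simp: c)
  then show "integrable M g" using block_sum_integrable[OF P] by simp
  have "integrable M (\<lambda>x. (g x)\<^sup>2) \<longleftrightarrow> integrable M (\<lambda>x. (\<Sum>X\<in>P. indicator X x * c X)\<^sup>2)"
    by (intro Bochner_Integration.integrable_cong) (auto simp: c)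
  then show "integrable M (\<lambda>x. (g x)\<^sup>2)" using block_sum_square_integrable[OF P] by simp
qed

lemma step_on_orthogonal:
  fixes f w :: "'a \<Rightarrow> real"
  assumes P: "block_family M P" and f: "integrable M f" and w: "step_on (space M) P w"
  shows "integrable M (\<lambda>x. f x * w x)"
    and "(\<integral>x. (f x - block_avg M P f x) * w x \<partial>M) = 0"
proof -
  obtain c where c: "\<And>x. x \<in> space M \<Longrightarrow> w x = (\<Sum>X\<in>P. indicator X x * c X)"
    using step_on_rep[OF P w] by blast
  have "integrable M (\<lambda>x. f x * w x) \<longleftrightarrow> integrable M (\<lambda>x. f x * (\<Sum>X\<in>P. indicator X x * c X))"
    by (intro Bochner_Integration.integrable_cong) (auto simp: c)
  then show "integrable M (\<lambda>x. f x * w x)"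
    using integral_mult_block_sum(1)[OF P f] by simp
  note fa = block_avg_integrable[OF P, of f]
  have "(\<integral>x. (f x - block_avg M P f x) * w x \<partial>M) =
      (\<integral>x. (f x - block_avg M P f x) * (\<Sum>X\<in>P. indicator X x * c X) \<partial>M)"
    by (intro Bochner_Integration.integral_cong) (auto simp: c)
  also have "\<dots> = (\<Sum>X\<in>P. c X * (LINT x:X|M. f x - block_avg M P f x))"
    by (rule integral_mult_block_sum(2)[OF P Bochner_Integration.integrable_diff[OF f fa]])
  also have "\<dots> = 0"
    using set_integrable_block[OF P _ f] set_integrable_block[OF P _ fa] set_integral_block_avg[OF P]
    by (intro sum.neutral) (auto simp: set_integral_diff)
  finally show "(\<integral>x. (f x - block_avg M P f x) * w x \<partial>M) = 0" .
qed

text \<open>Pythagoras: \<open>block_avg M P f - g\<close> is a step function, hence orthogonal to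
  \<open>f - block_avg M P f\<close>.\<close>

lemma block_avg_best_approx:
  fixes f g :: "'a \<Rightarrow> real"
  assumes P: "block_family M P"
    and f: "integrable M f" "integrable M (\<lambda>x. (f x)\<^sup>2)" and g: "step_on (space M) P g"
  shows "integrable M (\<lambda>x. (f x - g x)\<^sup>2)"
    and "(\<integral>x. (f x - block_avg M P f x)\<^sup>2 \<partial>M) \<le> (\<integral>x. (f x - g x)\<^sup>2 \<partial>M)"
proof -
  let ?a = "block_avg M P f"
  note gi = step_on_integrable[OF P g]
  have fm: "f \<in> borel_measurable M" and gm: "g \<in> borel_measurable M" using f gi by auto
  note am = block_avg_measurable[OF P, of f]
  show "integrable M (\<lambda>x. (f x - g x)\<^sup>2)"
    by (rule square_integrable_diff[OF fm gm f(2) gi(2)])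
  have i2: "integrable M (\<lambda>x. (f x - ?a x)\<^sup>2)"
    by (rule square_integrable_diff[OF fm am f(2) block_avg_square_integrable[OF P]])
  have i3: "integrable M (\<lambda>x. (?a x - g x)\<^sup>2)"
    by (rule square_integrable_diff[OF am gm block_avg_square_integrable[OF P] gi(2)])
  have s: "step_on (space M) P (\<lambda>x. ?a x - g x)"
    using step_on_add[OF step_on_block_avg[OF P] step_on_comp[OF g, of uminus]] by simp
  have fa: "integrable M (\<lambda>x. f x - ?a x)" using f block_avg_integrable[OF P] by auto
  have i4: "integrable M (\<lambda>x. (f x - ?a x) * (?a x - g x))"
    by (rule step_on_orthogonal(1)[OF P fa s])
  have z: "(\<integral>x. (f x - ?a x) * (?a x - g x) \<partial>M) = 0"
    by (rule step_on_orthogonal(2)[OF P f(1) s])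
  have "(\<integral>x. (f x - g x)\<^sup>2 \<partial>M) = (\<integral>x. (f x - ?a x)\<^sup>2 + (2 * ((f x - ?a x) * (?a x - g x)) + (?a x - g x)\<^sup>2) \<partial>M)"
    by (intro Bochner_Integration.integral_cong) (auto simp: power2_eq_square algebra_simps)
  also have "\<dots> = (\<integral>x. (f x - ?a x)\<^sup>2 \<partial>M) + (\<integral>x. (?a x - g x)\<^sup>2 \<partial>M)"
    using i2 i3 i4 z by simp
  finally show "(\<integral>x. (f x - ?a x)\<^sup>2 \<partial>M) \<le> (\<integral>x. (f x - g x)\<^sup>2 \<partial>M)" by simp
qed

lemma block_avg_l2_contraction:
  assumes "block_family M P" "integrable M f" "integrable M (\<lambda>x. (f x)\<^sup>2)"
  shows "(\<integral>x. (f x - block_avg M P f x)\<^sup>2 \<partial>M) \<le> (\<integral>x. (f x)\<^sup>2 \<partial>M)"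
  using block_avg_best_approx(2)[OF assms, of "\<lambda>_. 0"] by (simp add: step_on_def)

text \<open>Both sides are the sum over the blocks of the product of the two block integrals divided
  by the measure of the block. Used to move the averaging from \<open>F\<close> or \<open>W\<close>
  onto the indicator of a test set.\<close>

lemma block_avg_self_adjoint:
  fixes f k :: "'a \<Rightarrow> real"
  assumes P: "block_family M P" and f: "integrable M f" and k: "integrable M k"
  shows "(\<integral>x. f x * block_avg M P k x \<partial>M) = (\<integral>x. k x * block_avg M P f x \<partial>M)"
  unfolding block_avg_def integral_mult_block_sum(2)[OF P f] integral_mult_block_sum(2)[OF P k]
  by (intro sum.cong) auto

lemma block_avg_minus: "block_avg M P (\<lambda>x. - f x) x = - block_avg M P f x"
  by (simp add: block_avg_def set_lebesgue_integral_def sum_negf)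

lemma block_avg_indicator_bounds:
  assumes P: "block_family M P" and S: "S \<in> sets M"
  shows "0 \<le> block_avg M P (indicator S) x" "block_avg M P (indicator S) x \<le> 1"
proof -
  have *: "(LINT x:X|M. indicator S x) = measure M (X \<inter> S)" "measure M (X \<inter> S) \<le> measure M X"
    if "X \<in> P" for X
  proof -
    have X: "X \<in> sets M" "emeasure M X < \<infinity>" using P that by (auto simp: block_family_def)
    have "emeasure M (X \<inter> S) \<le> emeasure M X" by (rule emeasure_mono) (use X in auto)
    then show "measure M (X \<inter> S) \<le> measure M X"
      unfolding measure_def by (rule enn2real_mono) (use X in simp)
    show "(LINT x:X|M. indicator S x) = measure M (X \<inter> S)"
      using X S by (simp add: set_lebesgue_integral_def indicator_inter_arith[symmetric] Int_absorb2 sets.sets_into_space)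
  qed
  have "0 \<le> block_avg M P (indicator S) x \<and> block_avg M P (indicator S) x \<le> 1"
  proof (cases "x \<in> \<Union>P")
    case True
    then obtain X where X: "X \<in> P" "x \<in> X" by auto
    show ?thesis
      unfolding block_avg_eq[OF P X] using *[OF X(1)] by (auto simp: divide_le_eq_1 less_le)
  qed (simp add: block_avg_outside)
  then show "0 \<le> block_avg M P (indicator S) x" "block_avg M P (indicator S) x \<le> 1" by auto
qed

section \<open>Testing deviations against sets of finite measure\<close>

lemma le_mult_sqrt:
  fixes x m e :: real
  assumes "0 < m" "0 < e" "\<And>t. 0 < t \<Longrightarrow> 2 * (t * x) \<le> m + t\<^sup>2 * e\<^sup>2"
  shows "x \<le> e * sqrt m"
proof -
  \<comment> \<open>The minimizing \<open>t\<close>. This optimized AM-GM replaces Cauchy-Schwarz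
    also where the positive and negative parts carry different weights.\<close>
  have "2 * (sqrt m / e * x) \<le> m + (sqrt m / e)\<^sup>2 * e\<^sup>2" using assms by (intro assms(3)) simp
  also have "\<dots> = 2 * (sqrt m * sqrt m)" using assms by (simp add: power_divide)
  finally have "sqrt m * x \<le> sqrt m * (e * sqrt m)" using assms(2) by (simp add: field_simps)
  then show ?thesis using assms(1) by simp
qed

lemma set_integral_le_sqrt:
  fixes f :: "'a \<Rightarrow> real"
  assumes f: "integrable M f" "integrable M (\<lambda>x. (f x)\<^sup>2)" "(\<integral>x. (f x)\<^sup>2 \<partial>M) \<le> e\<^sup>2"
    and S: "S \<in> sets M" "emeasure M S < \<infinity>" "0 < measure M S" and e: "0 < e"
  shows "\<bar>LINT x:S|M. f x\<bar> \<le> e * sqrt (measure M S)"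
proof -
  have *: "2 * (t * (s * (LINT x:S|M. f x))) \<le> measure M S + t\<^sup>2 * e\<^sup>2" if "s\<^sup>2 = 1" for s t :: real
  proof -
    have i: "integrable M (\<lambda>x. indicator S x *\<^sub>R f x)" by (rule integrable_mult_indicator[OF S(1) f(1)])
    have "2 * (t * (s * (LINT x:S|M. f x))) = (\<integral>x. 2 * (t * s) * (indicator S x *\<^sub>R f x) \<partial>M)"
      by (simp add: set_lebesgue_integral_def)
    also have "\<dots> \<le> (\<integral>x. indicator S x + t\<^sup>2 * (f x)\<^sup>2 \<partial>M)"
    proof (intro integral_mono)
      show "integrable M (\<lambda>x. 2 * (t * s) * (indicator S x *\<^sub>R f x))" using i by (intro integrable_mult_right)
      show "integrable M (\<lambda>x. indicator S x + t\<^sup>2 * (f x)\<^sup>2)" using S f by auto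
      have "0 \<le> (1 - t * s * f x)\<^sup>2" for x by simp
      then have "2 * (t * s * f x) \<le> 1 + t\<^sup>2 * (f x)\<^sup>2" for x
        using that by (simp add: power2_diff power_mult_distrib)
      then show "2 * (t * s) * (indicator S x *\<^sub>R f x) \<le> indicator S x + t\<^sup>2 * (f x)\<^sup>2" for x
        by (cases "x \<in> S") (auto simp: algebra_simps)
    qed
    also have "\<dots> = measure M S + t\<^sup>2 * (\<integral>x. (f x)\<^sup>2 \<partial>M)"
      using S f by (simp add: Int_absorb2 sets.sets_into_space)
    also have "\<dots> \<le> measure M S + t\<^sup>2 * e\<^sup>2" using f(3) by (simp add: mult_left_mono)
    finally show ?thesis .
  qed
  have "s * (LINT x:S|M. f x) \<le> e * sqrt (measure M S)" if "s\<^sup>2 = 1" for s :: real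
    by (rule le_mult_sqrt[OF S(3) e]) (rule *[OF that])
  from this[of 1] this[of "-1"] show ?thesis by simp
qed

text \<open>Only half of the negative part of \<open>h\<close> counts towards the upper bound: testing against
  \<open>S\<close> amounts to integrating \<open>h\<close> against the centred function \<open>\<phi> = 1\<^sub>S - a\<close> with \<open>a\<close> the block
  average of \<open>1\<^sub>S\<close>, and \<open>\<integral> \<phi>\<^sub>+\<^sup>2 + 2 \<phi>\<^sub>-\<^sup>2 = \<mu>(S) - \<integral> a\<^sup>3\<close>.\<close>

lemma set_integral_block_deviation_upper:
  fixes F g :: "'a \<Rightarrow> real"
  assumes P: "block_family M P" and F: "integrable M F" and g: "step_on (space M) P g"
    and h2: "integrable M (\<lambda>x. (F x - g x)\<^sup>2)"
    and E: "(\<integral>x. (max 0 (F x - g x))\<^sup>2 + indicator (\<Union>P) x * (max 0 (g x - F x))\<^sup>2 / 2 \<partial>M) \<le> e\<^sup>2"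
    and S: "S \<in> sets M" "emeasure M S < \<infinity>" "0 < measure M S" and e: "0 < e"
  shows "(LINT x:S|M. F x - block_avg M P F x) \<le> e * sqrt (measure M S)"
proof -
  define h where "h x = F x - g x" for x
  define a where "a = block_avg M P (indicator S)"
  let ?s = "indicator S :: 'a \<Rightarrow> real"
  have Um: "\<Union>P \<in> sets M" using P by (auto simp: block_family_def)
  have h: "integrable M h"
    using F step_on_integrable(1)[OF P g] unfolding h_def by auto
  have 1: "integrable M ?s" using S by simp
  have sa: "step_on (space M) P a" unfolding a_def by (rule step_on_block_avg[OF P])
  have sw: "step_on (space M) P (\<lambda>x. - 2 * a x - (a x)\<^sup>2)"
    using step_on_comp[OF sa, of "\<lambda>y. - 2 * y - y\<^sup>2"] by simp
  have ia: "integrable M a" using step_on_integrable(1)[OF P sa] .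
  have ia2: "integrable M (\<lambda>x. (a x)\<^sup>2)" using step_on_integrable(2)[OF P sa] .
  have ia3: "integrable M (\<lambda>x. (a x)^3)"
    using step_on_integrable(1)[OF P step_on_comp[OF sa, of "\<lambda>y. y^3"]] by simp
  have iFa: "integrable M (\<lambda>x. F x * a x)" "integrable M (\<lambda>x. h x * a x)" "integrable M (\<lambda>x. g x * a x)"
    using step_on_orthogonal(1)[OF P _ sa] F h step_on_integrable(1)[OF P g] by auto
  have i1: "integrable M (\<lambda>x. ?s x *\<^sub>R k x)" if "integrable M k" for k :: "'a \<Rightarrow> real"
    by (rule integrable_mult_indicator[OF S(1) that])
  have igS: "integrable M (\<lambda>x. (?s x - a x) * g x)"
    by (rule step_on_orthogonal(1)[OF P _ g]) (use 1 ia in auto)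
  have igh: "integrable M (\<lambda>x. (?s x - a x) * h x)"
    using i1[OF h] iFa(2) by (simp add: algebra_simps)
  have "(LINT x:S|M. F x - block_avg M P F x) = (LINT x:S|M. F x) - (LINT x:S|M. block_avg M P F x)"
    using i1[OF F] i1[OF block_avg_integrable[OF P, of F]]
    by (intro set_integral_diff) (auto simp: set_integrable_def)
  also have "(LINT x:S|M. block_avg M P F x) = (\<integral>x. F x * a x \<partial>M)"
    unfolding a_def block_avg_self_adjoint[OF P F 1] by (simp add: set_lebesgue_integral_def)
  also have "(LINT x:S|M. F x) - (\<integral>x. F x * a x \<partial>M) = (\<integral>x. ?s x *\<^sub>R F x - F x * a x \<partial>M)"
    unfolding set_lebesgue_integral_def
    by (rule Bochner_Integration.integral_diff[symmetric]) (use i1[OF F] iFa(1) in auto)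
  also have "\<dots> = (\<integral>x. (?s x - a x) * h x + (?s x - a x) * g x \<partial>M)"
    by (intro Bochner_Integration.integral_cong) (auto simp: h_def algebra_simps)
  also have "\<dots> = (\<integral>x. (?s x - a x) * h x \<partial>M) + (\<integral>x. (?s x - a x) * g x \<partial>M)"
    by (rule Bochner_Integration.integral_add[OF igh igS])
  also have "(\<integral>x. (?s x - a x) * g x \<partial>M) = 0"
    unfolding a_def by (rule step_on_orthogonal(2)[OF P 1 g])
  finally have dev: "(LINT x:S|M. F x - block_avg M P F x) = (\<integral>x. (?s x - a x) * h x \<partial>M)" by simp
  \<comment> \<open>The integrand equals \<open>(1 - a)^2\<close> on \<open>S\<close> and
    \<open>2 a^2\<close> off \<open>S\<close>. It is written so that, beyond its first term, the
    indicator of \<open>S\<close> only meets a step function; there it may be replaced by its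
    average \<open>a\<close>, and everything but \<open>measure M S\<close> collapses to minus the
    integral of \<open>a^3\<close>.\<close>
  have mass: "(\<integral>x. ?s x + (?s x * (- 2 * a x - (a x)\<^sup>2) + 2 * (a x)\<^sup>2) \<partial>M) \<le> measure M S"
    and imass: "integrable M (\<lambda>x. ?s x + (?s x * (- 2 * a x - (a x)\<^sup>2) + 2 * (a x)\<^sup>2))"
  proof -
    have iw: "integrable M (\<lambda>x. ?s x * (- 2 * a x - (a x)\<^sup>2))"
      by (rule step_on_orthogonal(1)[OF P 1 sw])
    show "integrable M (\<lambda>x. ?s x + (?s x * (- 2 * a x - (a x)\<^sup>2) + 2 * (a x)\<^sup>2))"
      using 1 iw ia2 by auto
    have iaw: "integrable M (\<lambda>x. a x * (- 2 * a x - (a x)\<^sup>2))"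
      by (rule step_on_orthogonal(1)[OF P ia sw])
    have "(\<integral>x. ?s x * (- 2 * a x - (a x)\<^sup>2) \<partial>M) =
        (\<integral>x. (?s x - a x) * (- 2 * a x - (a x)\<^sup>2) + a x * (- 2 * a x - (a x)\<^sup>2) \<partial>M)"
      by (simp add: algebra_simps)
    also have "\<dots> = (\<integral>x. (?s x - a x) * (- 2 * a x - (a x)\<^sup>2) \<partial>M) + (\<integral>x. a x * (- 2 * a x - (a x)\<^sup>2) \<partial>M)"
      by (rule Bochner_Integration.integral_add[OF step_on_orthogonal(1)[OF P _ sw] iaw]) (use 1 ia in auto)
    also have "(\<integral>x. (?s x - a x) * (- 2 * a x - (a x)\<^sup>2) \<partial>M) = 0"
      unfolding a_def by (rule step_on_orthogonal(2)[OF P 1]) (use sw a_def in simp)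
    finally have "(\<integral>x. ?s x * (- 2 * a x - (a x)\<^sup>2) \<partial>M) + 2 * (\<integral>x. (a x)\<^sup>2 \<partial>M) =
        (\<integral>x. a x * (- 2 * a x - (a x)\<^sup>2) + 2 * (a x)\<^sup>2 \<partial>M)"
      using iaw ia2 by simp
    also have "\<dots> = (\<integral>x. - ((a x)^3) \<partial>M)"
      by (intro Bochner_Integration.integral_cong) (auto simp: power2_eq_square power3_eq_cube algebra_simps)
    also have "\<dots> \<le> 0"
      using block_avg_indicator_bounds(1)[OF P S(1)] by (simp add: a_def)
    finally show "(\<integral>x. ?s x + (?s x * (- 2 * a x - (a x)\<^sup>2) + 2 * (a x)\<^sup>2) \<partial>M) \<le> measure M S"
      using 1 iw ia2 S by (simp add: Int_absorb2 sets.sets_into_space)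
  qed
  let ?E = "\<lambda>x. (max 0 (h x))\<^sup>2 + indicator (\<Union>P) x * (max 0 (- h x))\<^sup>2 / 2"
  have iE: "integrable M ?E"
  proof (rule Bochner_Integration.integrable_bound[OF h2])
    have [measurable]: "h \<in> borel_measurable M" using h by auto
    show "?E \<in> borel_measurable M" using Um by measurable
    have "?E x \<le> (h x)\<^sup>2" "0 \<le> ?E x" for x by (auto simp: indicator_def max_def)
    then show "AE x in M. norm (?E x) \<le> norm ((F x - g x)\<^sup>2)" by (simp add: h_def)
  qed
  \<comment> \<open>Only points where \<open>h\<close> and the centred indicator have the same sign
    contribute. On \<open>S\<close> the positive part of \<open>h\<close> is charged in full; off
    \<open>S\<close> the centred indicator is \<open>- a\<close>, whose square counts twice in
    \<open>mass\<close>, so half of the negative part of \<open>h\<close> is enough. Off the blocks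
    \<open>a = 0\<close>, which explains the indicator of the union.\<close>
  have pw: "2 * (t * ((?s x - a x) * h x)) \<le> (?s x + (?s x * (- 2 * a x - (a x)\<^sup>2) + 2 * (a x)\<^sup>2)) + t\<^sup>2 * ?E x"
    if t: "0 < t" and x: "x \<in> space M" for t x
  proof -
    have a01: "0 \<le> a x" "a x \<le> 1" using block_avg_indicator_bounds[OF P S(1)] by (auto simp: a_def)
    have a0: "a x = 0" if "x \<notin> \<Union>P" using that by (simp add: a_def block_avg_outside)
    have q1: "2 * (t * ((1 - a x) * h x)) \<le> (1 - a x)\<^sup>2 + t\<^sup>2 * (h x)\<^sup>2"
      using zero_le_power2[of "(1 - a x) - t * h x"] by (simp add: power2_eq_square algebra_simps)
    have q2: "2 * (t * (- a x * h x)) \<le> 2 * (a x)\<^sup>2 + t\<^sup>2 * ((h x)\<^sup>2 / 2)"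
      using zero_le_power2[of "2 * a x + t * h x"] by (simp add: power2_eq_square algebra_simps)
    have q3: "t * (a x * h x) \<ge> 0" if "h x \<ge> 0" using that a01 t by simp
    have q4: "t * ((1 - a x) * h x) \<le> 0" if "h x \<le> 0"
      using that a01 t by (simp add: mult_nonneg_nonpos)
    have sq: "(1 - a x)\<^sup>2 = 1 + (- 2 * a x - (a x)\<^sup>2) + 2 * (a x)\<^sup>2"
      by (simp add: power2_eq_square algebra_simps)
    show ?thesis
    proof (cases "x \<in> S")
      case True
      show ?thesis
      proof (cases "h x \<ge> 0")
        case h0: True
        then show ?thesis using True q1 sq zero_le_power2[of "1 - a x"] by (simp add: max_def)
      next
        case False
        have "0 \<le> (1 - a x)\<^sup>2" by simp
        then have 0: "0 \<le> 1 + (- 2 * a x - (a x)\<^sup>2) + 2 * (a x)\<^sup>2" using sq by linarith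
        have "2 * (t * ((?s x - a x) * h x)) \<le> 0" using q4 False True by (simp add: mult.commute)
        moreover have "0 \<le> ?s x + (?s x * (- 2 * a x - (a x)\<^sup>2) + 2 * (a x)\<^sup>2)"
          using 0 True by simp
        moreover have "0 \<le> t\<^sup>2 * ?E x" by simp
        ultimately show ?thesis by linarith
      qed
    next
      case False
      show ?thesis
      proof (cases "h x \<ge> 0")
        case True
        then have "2 * (t * ((?s x - a x) * h x)) \<le> 0" using q3 False by (simp add: mult.commute)
        moreover have "0 \<le> ?s x + (?s x * (- 2 * a x - (a x)\<^sup>2) + 2 * (a x)\<^sup>2)"
          using False by simp
        moreover have "0 \<le> t\<^sup>2 * ?E x" by simp
        ultimately show ?thesis by linarith
      next
        case h0: False
        then show ?thesis using False q2 a0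
          by (cases "x \<in> \<Union>P") (auto simp: max_def)
      qed
    qed
  qed
  have "2 * (t * (\<integral>x. (?s x - a x) * h x \<partial>M)) \<le> measure M S + t\<^sup>2 * e\<^sup>2" if t: "0 < t" for t
  proof -
    have "2 * (t * (\<integral>x. (?s x - a x) * h x \<partial>M)) = (\<integral>x. 2 * (t * ((?s x - a x) * h x)) \<partial>M)" by simp
    also have "\<dots> \<le> (\<integral>x. (?s x + (?s x * (- 2 * a x - (a x)\<^sup>2) + 2 * (a x)\<^sup>2)) + t\<^sup>2 * ?E x \<partial>M)"
      by (intro integral_mono integrable_mult_right igh Bochner_Integration.integrable_add[OF imass] iE pw t)
    also have "\<dots> = (\<integral>x. (?s x + (?s x * (- 2 * a x - (a x)\<^sup>2) + 2 * (a x)\<^sup>2)) \<partial>M) + t\<^sup>2 * (\<integral>x. ?E x \<partial>M)"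
      by (subst Bochner_Integration.integral_add[OF imass]) (auto intro!: integrable_mult_right iE)
    also have "(\<integral>x. ?E x \<partial>M) \<le> e\<^sup>2" using E by (simp add: h_def)
    finally show ?thesis using mass by (simp add: mult_left_mono)
  qed
  then show ?thesis unfolding dev by (rule le_mult_sqrt[OF S(3) e])
qed

lemma set_integral_block_deviation:
  fixes F g :: "'a \<Rightarrow> real"
  assumes P: "block_family M P" and F: "integrable M F" and g: "step_on (space M) P g"
    and h2: "integrable M (\<lambda>x. (F x - g x)\<^sup>2)"
    and E: "(\<integral>x. (max 0 (F x - g x))\<^sup>2 + indicator (\<Union>P) x * (max 0 (g x - F x))\<^sup>2 / 2 \<partial>M) \<le> e\<^sup>2"
      "(\<integral>x. (max 0 (g x - F x))\<^sup>2 + indicator (\<Union>P) x * (max 0 (F x - g x))\<^sup>2 / 2 \<partial>M) \<le> e\<^sup>2"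
    and S: "S \<in> sets M" "emeasure M S < \<infinity>" "0 < measure M S" and e: "0 < e"
  shows "\<bar>LINT x:S|M. F x - block_avg M P F x\<bar> \<le> e * sqrt (measure M S)"
proof -
  have 1: "(LINT x:S|M. F x - block_avg M P F x) \<le> e * sqrt (measure M S)"
    by (rule set_integral_block_deviation_upper[OF P F g h2 E(1) S e])
  have "(LINT x:S|M. - F x - block_avg M P (\<lambda>x. - F x) x) \<le> e * sqrt (measure M S)"
    by (rule set_integral_block_deviation_upper[where g="\<lambda>x. - g x", OF P _ _ _ _ S e])
      (use F step_on_comp[OF g, of uminus] h2 E(2) in \<open>auto simp: power2_commute\<close>)
  moreover have "(LINT x:S|M. - F x - block_avg M P (\<lambda>x. - F x) x) = - (LINT x:S|M. F x - block_avg M P F x)"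
    unfolding set_lebesgue_integral_def block_avg_minus
    by (simp add: Bochner_Integration.integral_minus[symmetric] algebra_simps del: Bochner_Integration.integral_minus)
  ultimately show ?thesis using 1 by simp
qed

section \<open>Quantizing a bounded integrable function\<close>

lemma quantized_refinement:
  fixes l :: "'a \<Rightarrow> nat" and v :: "nat \<Rightarrow> real"
  assumes Q: "finite_subspace_partition M A Q"
    and l: "l \<in> measurable M (count_space UNIV)"
    and I: "finite I" "l ` A \<subseteq> I" and J: "finite J" "l ` (space M - A) \<subseteq> insert 0 J"
    and fin: "emeasure M {x\<in>space M. l x \<noteq> 0} \<le> ennreal c" and v: "v 0 = 0"
  obtains A' P where "finite_subspace_partition M A' P" "block_refines P Q"
    "card P \<le> card Q * card I + card J" "A' = A \<union> {x\<in>space M - A. l x \<noteq> 0}"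
    "emeasure M (A' - A) \<le> ennreal c" "step_on (space M) P (\<lambda>x. v (l x))"
proof -
  have sl: "{x\<in>space M. l x \<noteq> 0} \<in> sets M"
    using measurable_sets[OF l, of "{i. i \<noteq> 0}"] by (simp add: vimage_def Int_def conj_commute)
  have mono: "emeasure M X \<le> ennreal c" if "X \<subseteq> {x\<in>space M. l x \<noteq> 0}" for X
    by (rule order_trans[OF emeasure_mono[OF that sl] fin])
  have "emeasure M {x\<in>space M - A. l x \<noteq> 0} \<le> ennreal c" by (rule mono) auto
  then have fin': "emeasure M {x\<in>space M - A. l x \<noteq> 0} < \<infinity>"
    by (rule le_less_trans) simp
  obtain A' P where P: "finite_subspace_partition M A' P" "block_refines P Q"
    "card P \<le> card Q * card I + card J" "A' = A \<union> {x\<in>space M - A. l x \<noteq> 0}"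
    "\<And>X. X \<in> P \<Longrightarrow> \<exists>i. \<forall>x\<in>X. l x = i"
    using label_refinement[OF Q l I J fin'] by blast
  have "emeasure M (A' - A) \<le> ennreal c" by (rule mono) (use P(4) in auto)
  moreover have "step_on (space M) P (\<lambda>x. v (l x))"
    unfolding step_on_def
  proof (intro conjI ballI)
    fix X assume "X \<in> P" then show "\<exists>c. \<forall>x\<in>X. v (l x) = c" using P(5) by metis
  next
    fix x assume x: "x \<in> space M - \<Union>P"
    moreover have "\<Union>P = A'" using P(1) by (simp add: finite_subspace_partition_def partition_on_def)
    ultimately have "l x = 0" using P(4) by auto
    then show "v (l x) = 0" using v by simp
  qed
  ultimately show thesis using P that by blast
qed

text \<open>Cells of equal length for \<open>sqrt y\<close>; the minimum puts \<open>y = 1\<close>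
  into the last cell instead of opening a new one.\<close>

definition level :: "nat \<Rightarrow> real \<Rightarrow> nat" where
  "level N y = min (N - 1) (nat \<lfloor>real N * sqrt y\<rfloor>)"

text \<open>Both signs share cell 0, hence \<open>2 * N - 1\<close> labels in all. Label 0 carries
  the value 0, as it must outside the carrier of a partition.\<close>

definition signed_level :: "nat \<Rightarrow> real \<Rightarrow> nat" where
  "signed_level N y =
     (if level N \<bar>y\<bar> = 0 then 0 else if 0 < y then level N \<bar>y\<bar> else level N \<bar>y\<bar> + (N - 1))"

text \<open>In absolute value the representative of cell \<open>j\<close> is the geometric mean of
  its end points \<open>(j/N)^2\<close> and \<open>((j+1)/N)^2\<close>, which is 0 for
  \<open>j = 0\<close>.\<close>

definition signed_value :: "nat \<Rightarrow> nat \<Rightarrow> real" where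
  "signed_value N i =
     (if i < N then real i * (real i + 1) / (real N)\<^sup>2
      else - (real (i - (N - 1)) * (real (i - (N - 1)) + 1) / (real N)\<^sup>2))"

lemma level_bounds:
  assumes "1 \<le> N" "0 \<le> y" "y \<le> 1"
  shows "real (level N y) \<le> real N * sqrt y" "real N * sqrt y \<le> real (level N y) + 1"
proof -
  have 0: "0 \<le> real N * sqrt y" using assms by simp
  have fl: "real (nat \<lfloor>real N * sqrt y\<rfloor>) \<le> real N * sqrt y" "real N * sqrt y \<le> real (nat \<lfloor>real N * sqrt y\<rfloor>) + 1"
    using 0 by linarith+
  show "real (level N y) \<le> real N * sqrt y"
    using fl(1) unfolding level_def by linarith
  have "real N * sqrt y \<le> real N" using assms by (simp add: mult_left_le)
  then show "real N * sqrt y \<le> real (level N y) + 1"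
    using fl(2) assms(1) unfolding level_def by (auto simp: min_def of_nat_diff)
qed

text \<open>With \<open>w = N \<surd>y \<in> [j, j + 1]\<close> the claim is \<open>\<bar>w\<^sup>2 - j(j + 1)\<bar> \<le> w\<close>: quantizing the square root
  uniformly makes the squared error proportional to \<open>y\<close>.\<close>

lemma level_error:
  assumes "1 \<le> N" "0 \<le> y" "y \<le> 1"
  shows "(y - real (level N y) * (real (level N y) + 1) / (real N)\<^sup>2)\<^sup>2 \<le> y / (real N)\<^sup>2"
proof -
  define w where "w = real N * sqrt y"
  define j where "j = real (level N y)"
  have w: "j \<le> w" "w \<le> j + 1" "0 \<le> j" using level_bounds[OF assms] by (auto simp: w_def j_def)
  have N: "0 < (real N)\<^sup>2" using assms by simp
  have y: "y = w\<^sup>2 / (real N)\<^sup>2" using assms by (simp add: w_def power_mult_distrib)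
  have "w\<^sup>2 - j * (j + 1) \<le> w"
  proof -
    have "(w + j) * (w - j - 1) \<le> 0" using w by (intro mult_nonneg_nonpos) auto
    then show ?thesis by (simp add: power2_eq_square algebra_simps)
  qed
  moreover have "- w \<le> w\<^sup>2 - j * (j + 1)"
  proof -
    have "0 \<le> (w + j + 1) * (w - j)" using w by (intro mult_nonneg_nonneg) auto
    then show ?thesis by (simp add: power2_eq_square algebra_simps)
  qed
  ultimately have "\<bar>w\<^sup>2 - j * (j + 1)\<bar> \<le> \<bar>w\<bar>" by linarith
  then have "(w\<^sup>2 - j * (j + 1))\<^sup>2 \<le> w\<^sup>2" by (simp add: abs_le_square_iff)
  then have "(w\<^sup>2 - j * (j + 1))\<^sup>2 / ((real N)\<^sup>2)\<^sup>2 \<le> w\<^sup>2 / ((real N)\<^sup>2)\<^sup>2"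
    by (intro divide_right_mono) auto
  moreover have "y - j * (j + 1) / (real N)\<^sup>2 = (w\<^sup>2 - j * (j + 1)) / (real N)\<^sup>2"
    unfolding y by (simp add: diff_divide_distrib)
  moreover have "y / (real N)\<^sup>2 = w\<^sup>2 / ((real N)\<^sup>2)\<^sup>2"
    unfolding y by (simp add: power2_eq_square)
  ultimately show ?thesis
    unfolding j_def[symmetric] by (simp add: power_divide)
qed

lemma signed_level_error:
  assumes "1 \<le> N" "\<bar>y\<bar> \<le> 1"
  shows "(y - signed_value N (signed_level N y))\<^sup>2 \<le> \<bar>y\<bar> / (real N)\<^sup>2"
proof -
  have L: "level N \<bar>y\<bar> \<le> N - 1" by (simp add: level_def)
  have "signed_value N (signed_level N y) =
      (if 0 < y then 1 else -1) * (real (level N \<bar>y\<bar>) * (real (level N \<bar>y\<bar>) + 1) / (real N)\<^sup>2)"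
    using L assms(1) by (auto simp: signed_value_def signed_level_def)
  moreover have "(y - (if 0 < y then 1 else -1) * a)\<^sup>2 = (\<bar>y\<bar> - a)\<^sup>2" for a
    by (auto simp: power2_eq_square algebra_simps)
  ultimately have "(y - signed_value N (signed_level N y))\<^sup>2 =
      (\<bar>y\<bar> - real (level N \<bar>y\<bar>) * (real (level N \<bar>y\<bar>) + 1) / (real N)\<^sup>2)\<^sup>2"
    by (simp only:)
  then show ?thesis using level_error[OF assms(1), of "\<bar>y\<bar>"] assms(2) by simp
qed

text \<open>Feeds Markov's inequality: a point with a nonzero label is a point where the function is
  large, so such points fill only finite measure.\<close>

lemma signed_level_nonzero:
  assumes "1 \<le> N" "signed_level N y \<noteq> 0"
  shows "1 / (real N)\<^sup>2 \<le> \<bar>y\<bar>"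
proof -
  have "level N \<bar>y\<bar> \<noteq> 0" using assms(2) by (simp add: signed_level_def split: if_splits)
  then have "nat \<lfloor>real N * sqrt \<bar>y\<bar>\<rfloor> \<noteq> 0" by (auto simp: level_def)
  then have "1 \<le> real N * sqrt \<bar>y\<bar>" by linarith
  then have "1\<^sup>2 \<le> (real N * sqrt \<bar>y\<bar>)\<^sup>2" by (intro power_mono) auto
  then show ?thesis using assms(1) by (simp add: power_mult_distrib field_simps)
qed

lemma signed_level_le: "signed_level N y \<le> 2 * N - 2"
  unfolding signed_level_def level_def by auto

lemma signed_value_0 [simp]: "signed_value N 0 = 0"
  by (cases "N = 0") (auto simp: signed_value_def)

lemma measurable_signed_level [measurable]: "signed_level N \<in> measurable borel (count_space UNIV)"
  unfolding signed_level_def[abs_def] level_def[abs_def] by measurable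

text \<open>Used twice: for the degree function on \<open>M\<close> with sup bound \<open>D\<close>,
  and for the kernel on the product space with sup bound \<open>B\<close>.\<close>

locale bounded_integrable = 
  fixes M :: "'a measure" and F :: "'a \<Rightarrow> real" and C D :: real
  assumes F: "integrable M F" and FD: "AE x in M. \<bar>F x\<bar> \<le> D" and FC: "(\<integral>x. \<bar>F x\<bar> \<partial>M) \<le> C"
    and D0: "0 \<le> D"
begin

lemma C0: "0 \<le> C"
  by (rule order_trans[OF _ FC]) simp

lemma F_measurable [measurable]: "F \<in> borel_measurable M"
  using F by auto

lemma F_square: "integrable M (\<lambda>x. (F x)\<^sup>2)" "(\<integral>x. (F x)\<^sup>2 \<partial>M) \<le> C * D"
proof -
  have b: "AE x in M. (F x)\<^sup>2 \<le> D * \<bar>F x\<bar>"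
    using FD
  proof eventually_elim
    case (elim x)
    have "(F x)\<^sup>2 = \<bar>F x\<bar> * \<bar>F x\<bar>" by (simp add: power2_eq_square)
    also have "\<dots> \<le> D * \<bar>F x\<bar>" using elim by (intro mult_right_mono) auto
    finally show ?case .
  qed
  show i: "integrable M (\<lambda>x. (F x)\<^sup>2)"
    by (rule Bochner_Integration.integrable_bound[where f="\<lambda>x. D * \<bar>F x\<bar>"])
       (use F b D0 in auto)
  have "(\<integral>x. (F x)\<^sup>2 \<partial>M) \<le> (\<integral>x. D * \<bar>F x\<bar> \<partial>M)"
    by (rule integral_mono_AE[OF i _ b]) (use F in auto)
  also have "\<dots> \<le> D * C" using FC D0 by (simp add: mult_left_mono)
  finally show "(\<integral>x. (F x)\<^sup>2 \<partial>M) \<le> C * D" by (simp add: mult.commute)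
qed

lemma markov:
  assumes "0 < c" "S \<subseteq> {x\<in>space M. c \<le> \<bar>F x\<bar>}"
  shows "emeasure M S \<le> ennreal (C / c)"
proof -
  have "emeasure M S \<le> emeasure M {x\<in>space M. c \<le> \<bar>F x\<bar>}"
    by (rule emeasure_mono[OF assms(2)]) measurable
  also have "\<dots> \<le> ennreal ((1 / c) * (\<integral>x. \<bar>F x\<bar> \<partial>M))"
    using integral_Markov_inequality[of M "\<lambda>x. \<bar>F x\<bar>" c] F assms(1) by auto
  also have "\<dots> \<le> ennreal (C / c)"
    using FC assms(1) by (intro ennreal_leI) (simp add: divide_right_mono)
  finally show ?thesis .
qed

text \<open>Off \<open>R\<close> nothing is quantized and \<open>F^2 <= D |F|\<close> is the price,
  which allows treating a single sign. The complement of the carrier behaves like one extra part: it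
  yields \<open>card I - 1\<close> new parts and a remainder with label 0, whence the
  \<open>+ 1\<close> on both sides.\<close>

lemma level_refinement:
  assumes Q: "finite_subspace_partition M A Q" and N: "1 \<le> N" and D: "0 < D" and R: "R \<in> sets M"
    and I: "finite I" "0 \<in> I" "\<And>x. x \<in> R \<Longrightarrow> signed_level N (F x / D) \<in> I"
  obtains A' P where "finite_subspace_partition M A' P" "block_refines P Q"
    "card P + 1 \<le> (card Q + 1) * card I" "emeasure M (A' - A) \<le> ennreal (C * (real N)\<^sup>2 / D)"
    "(\<integral>x. (F x - block_avg M P F x)\<^sup>2 \<partial>M) \<le>
      D / (real N)\<^sup>2 * (LINT x:R|M. \<bar>F x\<bar>) + D * (LINT x:space M - R|M. \<bar>F x\<bar>)"
proof -
  note R[measurable]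
  define l where "l x = (if x \<in> R then signed_level N (F x / D) else 0)" for x
  have lm: "l \<in> measurable M (count_space UNIV)" unfolding l_def[abs_def] by measurable
  have nz: "D / (real N)\<^sup>2 \<le> \<bar>F x\<bar>" if "l x \<noteq> 0" for x
  proof -
    have "1 / (real N)\<^sup>2 \<le> \<bar>F x / D\<bar>"
      by (rule signed_level_nonzero[OF N]) (use that in \<open>auto simp: l_def split: if_splits\<close>)
    then show ?thesis using D by (simp add: abs_divide field_simps)
  qed
  have "emeasure M {x\<in>space M. l x \<noteq> 0} \<le> ennreal (C / (D / (real N)\<^sup>2))"
    by (rule markov) (use D N nz in auto)
  then have em: "emeasure M {x\<in>space M. l x \<noteq> 0} \<le> ennreal (C * (real N)\<^sup>2 / D)" by simp
  obtain A' P where P: "finite_subspace_partition M A' P" "block_refines P Q"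
    "card P \<le> card Q * card I + card (I - {0})"
    "emeasure M (A' - A) \<le> ennreal (C * (real N)\<^sup>2 / D)"
    "step_on (space M) P (\<lambda>x. D * signed_value N (l x))"
    by (rule quantized_refinement[OF Q lm I(1) _ _ _ em, of "I - {0}" "\<lambda>i. D * signed_value N i"])
       (use I in \<open>auto simp: l_def\<close>)
  have bf: "block_family M P" by (rule finite_subspace_partition_block_family[OF P(1)])
  have iR: "integrable M (\<lambda>x. indicator R x *\<^sub>R \<bar>F x\<bar>)" "integrable M (\<lambda>x. indicator (space M - R) x *\<^sub>R \<bar>F x\<bar>)"
    using F by (auto intro!: integrable_mult_indicator simp del: real_scaleR_def)
  have 1: "(\<integral>x. (F x - block_avg M P F x)\<^sup>2 \<partial>M) \<le> (\<integral>x. (F x - D * signed_value N (l x))\<^sup>2 \<partial>M)"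
    and 2: "integrable M (\<lambda>x. (F x - D * signed_value N (l x))\<^sup>2)"
    using block_avg_best_approx[OF bf F F_square(1) P(5)] by auto
  note 1
  also have "(\<integral>x. (F x - D * signed_value N (l x))\<^sup>2 \<partial>M) \<le>
      (\<integral>x. D / (real N)\<^sup>2 * (indicator R x *\<^sub>R \<bar>F x\<bar>) + D * (indicator (space M - R) x *\<^sub>R \<bar>F x\<bar>) \<partial>M)"
  proof (rule integral_mono_AE[OF 2])
    show "integrable M (\<lambda>x. D / (real N)\<^sup>2 * (indicator R x *\<^sub>R \<bar>F x\<bar>) + D * (indicator (space M - R) x *\<^sub>R \<bar>F x\<bar>))"
      by (intro Bochner_Integration.integrable_add integrable_mult_right iR)
    show "AE x in M. (F x - D * signed_value N (l x))\<^sup>2 \<le>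
        D / (real N)\<^sup>2 * (indicator R x *\<^sub>R \<bar>F x\<bar>) + D * (indicator (space M - R) x *\<^sub>R \<bar>F x\<bar>)"
      using FD AE_space
    proof eventually_elim
      case (elim x)
      show ?case
      proof (cases "x \<in> R")
        case True
        have "(F x / D - signed_value N (signed_level N (F x / D)))\<^sup>2 \<le> \<bar>F x / D\<bar> / (real N)\<^sup>2"
          by (rule signed_level_error[OF N]) (use elim D in simp)
        then have "D\<^sup>2 * (F x / D - signed_value N (signed_level N (F x / D)))\<^sup>2 \<le> D\<^sup>2 * (\<bar>F x / D\<bar> / (real N)\<^sup>2)"
          by (rule mult_left_mono) simp
        also have "D\<^sup>2 * (F x / D - signed_value N (signed_level N (F x / D)))\<^sup>2 = (F x - D * signed_value N (l x))\<^sup>2"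
          using D True by (simp add: l_def power_mult_distrib[symmetric] right_diff_distrib)
        also have "D\<^sup>2 * (\<bar>F x / D\<bar> / (real N)\<^sup>2) = D / (real N)\<^sup>2 * \<bar>F x\<bar>"
          using D by (simp add: abs_divide power2_eq_square)
        finally show ?thesis using True by simp
      next
        case False
        have "(F x)\<^sup>2 = \<bar>F x\<bar> * \<bar>F x\<bar>" by (simp add: power2_eq_square)
        also have "\<dots> \<le> D * \<bar>F x\<bar>" using elim by (intro mult_right_mono) auto
        finally show ?thesis using False elim by (simp add: l_def)
      qed
    qed
  qed
  also have "\<dots> = D / (real N)\<^sup>2 * (LINT x:R|M. \<bar>F x\<bar>) + D * (LINT x:space M - R|M. \<bar>F x\<bar>)"
    unfolding set_lebesgue_integral_def
    by (subst Bochner_Integration.integral_add)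
       (simp_all only: integrable_mult_right iR integral_mult_right_zero)
  finally have 3: "(\<integral>x. (F x - block_avg M P F x)\<^sup>2 \<partial>M) \<le>
      D / (real N)\<^sup>2 * (LINT x:R|M. \<bar>F x\<bar>) + D * (LINT x:space M - R|M. \<bar>F x\<bar>)" .
  have "card I \<ge> 1" using I by (metis One_nat_def Suc_leI card_gt_0_iff empty_iff)
  then have "card P + 1 \<le> (card Q + 1) * card I"
    using P(3) I by (simp add: card_Diff_singleton)
  then show thesis using that P 3 by blast
qed

end

section \<open>Comparing numbers of classes with powers of two\<close>

lemma powr_rational_le:
  fixes a b x :: real
  assumes "0 < b" "a ^ q \<le> b ^ p" "0 < q" "real p \<le> real q * x" "1 \<le> b" "0 \<le> a"
  shows "a \<le> b powr x"
proof (rule ccontr)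
  assume "\<not> a \<le> b powr x"
  then have "(b powr x) ^ q < a ^ q" using assms by (intro power_strict_mono) auto
  moreover have "(b powr x) ^ q = b powr (real q * x)"
    using assms(1) powr_realpow[of "b powr x" q] by (simp add: powr_powr mult.commute)
  moreover have "b ^ p = b powr real p" using assms(1) by (simp add: powr_realpow)
  moreover have "b powr real p \<le> b powr (real q * x)" using assms by (intro powr_mono) auto
  ultimately show False using assms(2) by linarith
qed

lemma four_mult_le_two_power_square:
  assumes "2 \<le> m"
  shows "4 * m + 1 \<le> 2 ^ (m\<^sup>2 :: nat)"
proof -
  have "4 * m + 1 \<le> 4 ^ m" using assms by (induction m rule: dec_induct) auto
  also have "(4::nat) ^ m = 2 ^ (2 * m)" by (simp add: power_mult)
  also have "\<dots> \<le> 2 ^ (m\<^sup>2)" using assms by (intro power_increasing) (auto simp: power2_eq_square)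
  finally show ?thesis .
qed

text \<open>For \<open>N >= 3\<close> both counts are at most 2 to the power
  \<open>(N - 1)^2\<close>. For \<open>N = 2\<close> they are 3 and 5, and \<open>8/5\<close> and
  \<open>7/3\<close> are rationals just above their binary logarithms. The first count is that of
  the signed labels; the second adds \<open>2 * N - 2\<close> outside classes.\<close>

lemma label_count_le_powr:
  assumes "2 \<le> N" "(real N - 1)\<^sup>2 < K"
  shows "8 / 5 < K \<Longrightarrow> 2 * real N - 1 \<le> 2 powr K" "7 / 3 < K \<Longrightarrow> 4 * real N - 3 \<le> 2 powr K"
proof -
  have *: "4 * real N - 3 \<le> 2 powr K" if "3 \<le> N"
  proof -
    define m where "m = N - 1"
    have m: "2 \<le> m" "real m = real N - 1" using that by (auto simp: m_def)
    have "real (4 * m + 1) \<le> real (2 ^ (m\<^sup>2))"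
      using four_mult_le_two_power_square[OF m(1)] by (intro of_nat_mono)
    also have "\<dots> = 2 powr (real m ^ 2)" by (simp add: powr_realpow[symmetric])
    also have "\<dots> \<le> 2 powr K" using assms(2) m(2) by (intro powr_mono) auto
    finally show ?thesis using m by simp
  qed
  have 2: "N = 2" if "\<not> 3 \<le> N" using that assms(1) by simp
  show "2 * real N - 1 \<le> 2 powr K" if "8 / 5 < K"
  proof (cases "3 \<le> N")
    case True then show ?thesis using *[OF True] by simp
  next
    case False
    \<comment> \<open>The integer comparison behind this is
      \<open>3^5 = 243 <= 256 = 2^8\<close>.\<close>
    have "3 \<le> 2 powr K" by (rule powr_rational_le[where q=5 and p=8]) (use that in auto)
    then show ?thesis using 2[OF False] by simp
  qed
  show "4 * real N - 3 \<le> 2 powr K" if "7 / 3 < K"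
  proof (cases "3 \<le> N")
    case False
    have "5 \<le> 2 powr K" by (rule powr_rational_le[where q=3 and p=7]) (use that in auto)
    then show ?thesis using 2[OF False] by simp
  qed (rule *)
qed

text \<open>\<open>a\<close>, \<open>b\<close> (\<open>p\<close>, \<open>n\<close>) stand for the positive and negative mass of a function inside (outside)
  the old partition, and the flags say which of the four regions receive a new class: there, values of modulus at least
  \<open>13/50 D\<close> are replaced by \<open>\<plusminus> 981/2000 D\<close>. The coefficients bound the resulting squared errors, counted
  as in \<open>set_integral_block_deviation_upper\<close>, by multiples of \<open>D |F|\<close>; the numbers are tuned so that one class
  suffices for \<open>K \<le> 46/29\<close>, just above \<open>log\<^sub>2 3\<close>.\<close>

definition region_cost :: "bool \<Rightarrow> bool \<Rightarrow> bool \<Rightarrow> bool \<Rightarrow> real \<Rightarrow> real \<Rightarrow> real \<Rightarrow> real \<Rightarrow> real" where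
  "region_cost c\<^sub>a c\<^sub>b c\<^sub>p c\<^sub>n a b p n =
     (if c\<^sub>a then 13/50 else 1) * a + (if c\<^sub>b then 41/200 else 1/2) * b +
     (if c\<^sub>p then 13/50 else 1) * p + (if c\<^sub>n then 41/200 else 0) * n"

text \<open>The second inequality of each pair is the condition for \<open>-F\<close>, where
  positive and negative masses trade places. If every alternative failed, one inequality of each
  pair would fail; each such selection is an infeasible linear system in the four masses. The factor
  \<open>63/100\<close> lies just below \<open>29/46\<close>.\<close>

lemma choose_one_region:
  fixes a b p n w :: real
  assumes "0 \<le> a" "0 \<le> b" "0 \<le> p" "0 \<le> n" "a + b + p + n = w"
  shows "(region_cost True False False False a b p n \<le> 63/100 * w \<and>
     region_cost False True False False b a n p \<le> 63/100 * w) \<or>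
    (region_cost False True False False a b p n \<le> 63/100 * w \<and>
     region_cost True False False False b a n p \<le> 63/100 * w) \<or>
    (region_cost False False True False a b p n \<le> 63/100 * w \<and>
     region_cost False False False True b a n p \<le> 63/100 * w) \<or>
    (region_cost False False False True a b p n \<le> 63/100 * w \<and>
     region_cost False False True False b a n p \<le> 63/100 * w)"
  unfolding region_cost_def if_True if_False
proof (rule ccontr, simp only: de_Morgan_disj de_Morgan_conj not_le, elim conjE disjE)
qed (use assms in linarith)+

lemma choose_two_regions:
  fixes a b p n w :: real
  assumes "0 \<le> a" "0 \<le> b" "0 \<le> p" "0 \<le> n" "a + b + p + n = w"
  shows "(region_cost True True False False a b p n \<le> 1/2 * w \<and>
     region_cost True True False False b a n p \<le> 1/2 * w) \<or>
    (region_cost True False True False a b p n \<le> 1/2 * w \<and>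
     region_cost False True False True b a n p \<le> 1/2 * w) \<or>
    (region_cost True False False True a b p n \<le> 1/2 * w \<and>
     region_cost False True True False b a n p \<le> 1/2 * w) \<or>
    (region_cost False True True False a b p n \<le> 1/2 * w \<and>
     region_cost True False False True b a n p \<le> 1/2 * w) \<or>
    (region_cost False True False True a b p n \<le> 1/2 * w \<and>
     region_cost True False True False b a n p \<le> 1/2 * w) \<or>
    (region_cost False False True True a b p n \<le> 1/2 * w \<and>
     region_cost False False True True b a n p \<le> 1/2 * w)"
  unfolding region_cost_def if_True if_False
proof (rule ccontr, simp only: de_Morgan_disj de_Morgan_conj not_le, elim conjE disjE)
qed (use assms in linarith)+

lemma choose_three_regions:
  fixes a b p n w :: real
  assumes "0 \<le> a" "0 \<le> b" "0 \<le> p" "0 \<le> n" "a + b + p + n = w"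
  shows "(region_cost True True True False a b p n \<le> 3/7 * w \<and>
     region_cost True True False True b a n p \<le> 3/7 * w) \<or>
    (region_cost True True False True a b p n \<le> 3/7 * w \<and>
     region_cost True True True False b a n p \<le> 3/7 * w) \<or>
    (region_cost True False True True a b p n \<le> 3/7 * w \<and>
     region_cost False True True True b a n p \<le> 3/7 * w) \<or>
    (region_cost False True True True a b p n \<le> 3/7 * w \<and>
     region_cost True False True True b a n p \<le> 3/7 * w)"
  unfolding region_cost_def if_True if_False
proof (rule ccontr, simp only: de_Morgan_disj de_Morgan_conj not_le, elim conjE disjE)
qed (use assms in linarith)+

lemma choose_regions:
  fixes a b p n K :: real
  assumes nn: "0 \<le> a" "0 \<le> b" "0 \<le> p" "0 \<le> n" and K: "1 < K" "K \<le> 7/3"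
  obtains c\<^sub>a c\<^sub>b c\<^sub>p c\<^sub>n where
    "1 + (of_bool c\<^sub>a + of_bool c\<^sub>b + of_bool c\<^sub>p + of_bool c\<^sub>n) \<le> 2 powr K"
    "K * region_cost c\<^sub>a c\<^sub>b c\<^sub>p c\<^sub>n a b p n \<le> a + b + p + n"
    "K * region_cost c\<^sub>b c\<^sub>a c\<^sub>n c\<^sub>p b a n p \<le> a + b + p + n"
proof -
  note main = that
  define w where "w = a + b + p + n"
  have w: "a + b + p + n = w" "0 \<le> w" using nn by (auto simp: w_def)
  have scale: "K * x \<le> w" if "x \<le> r * w" "r * K \<le> 1" for x r
  proof -
    have "K * x \<le> K * (r * w)" using that K by (intro mult_left_mono) auto
    also have "\<dots> = (r * K) * w" by simp
    also have "\<dots> \<le> 1 * w" using that w by (intro mult_right_mono) auto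
    finally show ?thesis by simp
  qed
  have finish: thesis
    if "region_cost c\<^sub>a c\<^sub>b c\<^sub>p c\<^sub>n a b p n \<le> r * w \<and> region_cost c\<^sub>b c\<^sub>a c\<^sub>n c\<^sub>p b a n p \<le> r * w"
      "1 + (of_bool c\<^sub>a + of_bool c\<^sub>b + of_bool c\<^sub>p + of_bool c\<^sub>n) \<le> 2 powr K" "r * K \<le> 1"
    for c\<^sub>a c\<^sub>b c\<^sub>p c\<^sub>n r
    using main[OF that(2)] scale[OF _ that(3)] that(1) w(1) by simp
  \<comment> \<open>Beyond \<open>46/29\<close> one class no longer suffices, but
    \<open>3^29 <= 2^46\<close> already pays for two. Up to 2 these cost at most half of the mass,
    and beyond 2 there is room for three, costing at most \<open>3/7\<close>.\<close>
  consider "K \<le> 46/29" | "46/29 < K" "K \<le> 2" | "2 < K" using K by linarith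
  then show thesis
  proof cases
    case 1
    have "2 powr 1 \<le> 2 powr K" using K by (intro powr_mono) auto
    then show thesis
      using choose_one_region[OF nn w(1)] 1 by (elim disjE) (erule finish; simp)+
  next
    case 2
    have "3 \<le> 2 powr K" by (rule powr_rational_le[where q=29 and p=46]) (use 2 in auto)
    then show thesis
      using choose_two_regions[OF nn w(1)] 2 by (elim disjE) (erule finish; simp)+
  next
    case 3
    have "2 powr 2 \<le> 2 powr K" using 3 by (intro powr_mono) auto
    then show thesis
      using choose_three_regions[OF nn w(1)] K by (elim disjE) (erule finish; simp)+
  qed
qed

lemma signed_level_2:
  "0 < y \<Longrightarrow> signed_level 2 y \<in> {0, 1}" "\<not> 0 < y \<Longrightarrow> signed_level 2 y \<in> {0, 2}"
proof -
  have "level 2 \<bar>y\<bar> \<le> 1" by (simp add: level_def)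
  then have "level 2 \<bar>y\<bar> = 0 \<or> level 2 \<bar>y\<bar> = 1" by linarith
  then show "0 < y \<Longrightarrow> signed_level 2 y \<in> {0, 1}" "\<not> 0 < y \<Longrightarrow> signed_level 2 y \<in> {0, 2}"
    by (auto simp: signed_level_def)
qed

text \<open>Below the threshold, \<open>v * v <= 13/50 * v\<close>. Above it, the representative
  \<open>r = 981/2000\<close> is squeezed between two demands: \<open>(1 - r)^2 <= 13/50\<close> at
  the far end \<open>v = 1\<close>, and \<open>(r - 13/50)^2 <= 41/200 * 13/50\<close> at the
  threshold. The full \<open>41/200\<close> is spent only when \<open>v\<close> lies below
  \<open>r\<close>; otherwise the error counts half.\<close>

lemma one_level_error:
  fixes v :: real
  assumes v: "0 \<le> v" "v \<le> 1"
    and d: "d = (if c \<and> 13/50 \<le> v then v - 981/2000 else v)"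
  shows "(max 0 d)\<^sup>2 + (max 0 (- d))\<^sup>2 / 2 \<le> (if c then 13/50 else 1) * v"
    and "(max 0 (- d))\<^sup>2 + (max 0 d)\<^sup>2 / 2 \<le> (if c then 41/200 else 1/2) * v"
proof -
  have vv: "v * v \<le> 1 * v" using v by (intro mult_right_mono) auto
  have sq: "(v - 981/2000)\<^sup>2 = v * v - 981/1000 * v + 962361/4000000"
    by (simp add: power2_eq_square algebra_simps)
  have small: "v * v \<le> 13/50 * v" if "v \<le> 13/50" using v that by (intro mult_right_mono) auto
  have far: "(v - 981/2000)\<^sup>2 \<le> 13/50 * v" if "13/50 \<le> v"
  proof -
    have "(v - 13/50) * (v - 1) \<le> 0" using that v by (intro mult_nonneg_nonpos) auto
    moreover have "(v - 13/50) * (v - 1) = v * v - 63/50 * v + 13/50" by (simp add: field_simps)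
    ultimately show ?thesis using that v unfolding sq by linarith
  qed
  have near: "(v - 981/2000)\<^sup>2 \<le> 41/200 * v" if "13/50 \<le> v" "v \<le> 981/2000"
  proof -
    have "(v - 13/50) * (v - 981/2000) \<le> 0" using that v by (intro mult_nonneg_nonpos) auto
    moreover have "(v - 13/50) * (v - 981/2000) = v * v - 1501/2000 * v + 12753/100000" by (simp add: field_simps)
    ultimately show ?thesis using that v unfolding sq by linarith
  qed
  have half: "(v - 981/2000)\<^sup>2 / 2 \<le> 41/200 * v" if "13/50 \<le> v" using far[OF that] v by simp
  have le: "(max 0 d)\<^sup>2 + (max 0 (- d))\<^sup>2 / 2 \<le> d\<^sup>2" by (auto simp: max_def)
  show "(max 0 d)\<^sup>2 + (max 0 (- d))\<^sup>2 / 2 \<le> (if c then 13/50 else 1) * v"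
  proof (cases "c \<and> 13/50 \<le> v")
    case True then show ?thesis using le d far by simp
  next
    case False
    then show ?thesis using le d vv small by (auto simp: power2_eq_square)
  qed
  show "(max 0 (- d))\<^sup>2 + (max 0 d)\<^sup>2 / 2 \<le> (if c then 41/200 else 1/2) * v"
  proof (cases "c \<and> 13/50 \<le> v")
    case True
    then have d: "d = v - 981/2000" using d by simp
    show ?thesis
    proof (cases "v < 981/2000")
      case less: True
      then have "max 0 d = 0" "max 0 (- d) = 981/2000 - v" using d by auto
      then show ?thesis using True less near by (simp add: power2_commute)
    next
      case False
      then have "max 0 d = v - 981/2000" "max 0 (- d) = 0" using d by auto
      then show ?thesis using True half by simp
    qed
  next
    case False
    then have "d = v" using d by auto
    then have "(max 0 (- d))\<^sup>2 + (max 0 d)\<^sup>2 / 2 = v * v / 2" using v by (simp add: max_def power2_eq_square)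
    then show ?thesis using False vv small v by (auto simp: not_le)
  qed
qed

section \<open>Refinements that make the degree function close to its average\<close>

context bounded_integrable
begin

lemma block_avg_l2_le:
  assumes "finite_subspace_partition M A Q"
  shows "(\<integral>x. (F x - block_avg M Q F x)\<^sup>2 \<partial>M) \<le> C * D"
  using block_avg_l2_contraction[OF finite_subspace_partition_block_family[OF assms] F F_square(1)]
    F_square(2) by simp

lemma l2_deviation:
  assumes P: "finite_subspace_partition M A P" and e: "0 < e"
    and l2: "(\<integral>x. (F x - block_avg M P F x)\<^sup>2 \<partial>M) \<le> e\<^sup>2"
    and S: "S \<in> sets M" "emeasure M S < \<infinity>" "0 < measure M S"
  shows "\<bar>LINT x:S|M. F x - block_avg M P F x\<bar> \<le> e * sqrt (measure M S)"
proof (rule set_integral_le_sqrt[OF _ _ l2 S e])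
  note bf = finite_subspace_partition_block_family[OF P]
  show "integrable M (\<lambda>x. F x - block_avg M P F x)"
    using F block_avg_integrable[OF bf] by auto
  show "integrable M (\<lambda>x. (F x - block_avg M P F x)\<^sup>2)"
    by (rule square_integrable_diff[OF F_measurable block_avg_measurable[OF bf] F_square(1) block_avg_square_integrable[OF bf]])
qed

lemma uniform_level_refinement:
  assumes Q: "finite_subspace_partition M A Q" and e: "0 < e" and K: "8/5 < C * D / e\<^sup>2"
  obtains A' P N where "finite_subspace_partition M A' P" "block_refines P Q"
    "2 \<le> N" "(real N - 1)\<^sup>2 < C * D / e\<^sup>2"
    "real (card P) + 1 \<le> (real (card Q) + 1) * (2 * real N - 1)"
    "emeasure M (A' - A) \<le> ennreal (4 * C ^ 3 * D / e ^ 4)"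
    "(\<integral>x. (F x - block_avg M P F x)\<^sup>2 \<partial>M) \<le> e\<^sup>2"
proof -
  define K where "K = C * D / e\<^sup>2"
  define N where "N = nat \<lceil>sqrt K\<rceil>"
  have K1: "8/5 < K" using K by (simp add: K_def)
  have CD: "0 < D" "0 < C" using K e C0 D0 by (auto simp: less_le)
  have sK: "1 < sqrt K" "(sqrt K)\<^sup>2 = K" using K1 by auto
  then have sKK: "sqrt K \<le> K"
    using mult_left_mono[of 1 "sqrt K" "sqrt K"] K1 by simp
  have N: "sqrt K \<le> real N" "real N < sqrt K + 1" "2 \<le> N"
  proof -
    have "1 < \<lceil>sqrt K\<rceil>" using sK(1) by linarith
    then show "2 \<le> N" "sqrt K \<le> real N" "real N < sqrt K + 1" unfolding N_def by linarith+
  qed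
  have "K \<le> (real N)\<^sup>2" using power_mono[OF N(1), of 2] sK by simp
  have N1: "(real N - 1)\<^sup>2 < K"
    using power_strict_mono[of "real N - 1" "sqrt K" 2] N sK by simp
  \<comment> \<open>A crude bound, sufficient for the measure: it turns the Markov bound
    \<open>C * N^2 / D\<close> into \<open>4 * C * K^2 / D\<close>, which is the first summand of
    the size bound.\<close>
  have N2: "real N \<le> 2 * K" using N sK(1) sKK by linarith
  obtain A' P where P: "finite_subspace_partition M A' P" "block_refines P Q"
    "card P + 1 \<le> (card Q + 1) * card {..2 * N - 2}" "emeasure M (A' - A) \<le> ennreal (C * (real N)\<^sup>2 / D)"
    "(\<integral>x. (F x - block_avg M P F x)\<^sup>2 \<partial>M) \<le>
      D / (real N)\<^sup>2 * (LINT x:space M|M. \<bar>F x\<bar>) + D * (LINT x:space M - space M|M. \<bar>F x\<bar>)"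
    by (rule level_refinement[OF Q _ CD(1), of N "space M" "{..2 * N - 2}"]) (use N(3) signed_level_le in auto)
  have cN: "real (card {..2 * N - 2}) = 2 * real N - 1" using N(3) by (simp add: of_nat_diff)
  have "real (card P + 1) \<le> real ((card Q + 1) * card {..2 * N - 2})" using P(3) by (rule of_nat_mono)
  then have cP: "real (card P) + 1 \<le> (real (card Q) + 1) * (2 * real N - 1)"
    unfolding of_nat_mult of_nat_add of_nat_1 cN .
  have "C * (real N)\<^sup>2 / D \<le> C * (2 * K)\<^sup>2 / D"
    using CD N2 by (intro divide_right_mono mult_left_mono power_mono) auto
  also have "\<dots> = 4 * C ^ 3 * D / e ^ 4"
    using CD e by (simp add: K_def field_simps power2_eq_square power3_eq_cube power4_eq_xxxx)
  finally have m: "emeasure M (A' - A) \<le> ennreal (4 * C ^ 3 * D / e ^ 4)"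
    using P(4) by (meson ennreal_leI order_trans)
  have mass: "(LINT x:space M|M. \<bar>F x\<bar>) \<le> C"
    using FC set_integral_space[OF integrable_abs[OF F]] by simp
  have "(\<integral>x. (F x - block_avg M P F x)\<^sup>2 \<partial>M) \<le> D / (real N)\<^sup>2 * C"
  proof -
    have "D / (real N)\<^sup>2 * (LINT x:space M|M. \<bar>F x\<bar>) \<le> D / (real N)\<^sup>2 * C"
      using mass CD by (intro mult_left_mono) auto
    moreover have "(LINT x:space M - space M|M. \<bar>F x\<bar>) = 0" by (simp add: set_lebesgue_integral_def)
    ultimately show ?thesis using P(5) by simp
  qed
  also have "\<dots> \<le> D / K * C"
    using \<open>K \<le> (real N)\<^sup>2\<close> K1 CD N(3) by (intro mult_right_mono divide_left_mono) auto
  also have "\<dots> = e\<^sup>2" using CD e by (simp add: K_def)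
  finally show thesis using that[OF P(1,2) N(3) N1[unfolded K_def] cP m] by simp
qed

lemma l2_refinement:
  assumes Q: "finite_subspace_partition M A Q" and e: "0 < e"
  obtains A' P where "finite_subspace_partition M A' P" "block_refines P Q"
    "real (card P) + 1 \<le> (real (card Q) + 1) * 2 powr (C * D / e\<^sup>2)"
    "emeasure M (A' - A) \<le> ennreal (4 * C ^ 3 * D / e ^ 4)"
    "(\<integral>x. (F x - block_avg M P F x)\<^sup>2 \<partial>M) \<le> e\<^sup>2"
proof -
  define K where "K = C * D / e\<^sup>2"
  have eK: "C * D = K * e\<^sup>2" using e by (simp add: K_def)
  consider "K \<le> 1" | "1 < K" "K \<le> 8/5" | "8/5 < K" by linarith
  then show thesis
  proof cases
    case 1
    have "0 \<le> K" using C0 D0 by (simp add: K_def)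
    then have "1 \<le> 2 powr K" by (simp add: ge_one_powr_ge_zero)
    then have "real (card Q) + 1 \<le> (real (card Q) + 1) * 2 powr K" by (simp add: mult_le_cancel_left1)
    moreover have "C * D \<le> e\<^sup>2" unfolding eK using mult_right_mono[OF 1, of "e\<^sup>2"] by simp
    ultimately show thesis
      using that[OF Q block_refines_refl] block_avg_l2_le[OF Q] by (simp add: K_def)
  next
    case 2
    have CD: "0 < D" "0 < C" using 2 e C0 D0 unfolding K_def by (auto simp: less_le)
    define Z where "Z = {x\<in>space M. 0 < F x}"
    have Z: "Z \<in> sets M" "space M - Z \<in> sets M" by (auto simp: Z_def)
    have lev: "x \<in> Z \<Longrightarrow> signed_level 2 (F x / D) \<in> {0, 1}"
      "x \<in> space M - Z \<Longrightarrow> signed_level 2 (F x / D) \<in> {0, 2}" for x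
      by (rule signed_level_2; use CD in \<open>simp add: Z_def zero_less_divide_iff\<close>)+
    define z where "z = (LINT x:Z|M. \<bar>F x\<bar>)"
    define z' where "z' = (LINT x:space M - Z|M. \<bar>F x\<bar>)"
    have i: "set_integrable M Z (\<lambda>x. \<bar>F x\<bar>)" "set_integrable M (space M - Z) (\<lambda>x. \<bar>F x\<bar>)"
      using Z F unfolding set_integrable_def by (auto intro!: integrable_mult_indicator simp del: real_scaleR_def)
    have "z + z' = (LINT x:Z \<union> (space M - Z)|M. \<bar>F x\<bar>)"
      unfolding z_def z'_def by (rule set_integral_Un[symmetric, OF _ i]) auto
    also have "Z \<union> (space M - Z) = space M" by (auto simp: Z_def)
    also have "(LINT x:space M|M. \<bar>F x\<bar>) \<le> C"
      using FC F by (simp add: set_integral_space)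
    finally have zz: "z + z' \<le> C" .
    \<comment> \<open>Two cells on the sign of larger mass: at least half of the mass gets the
      factor \<open>1/4\<close> and the rest 1, hence at most \<open>5/8\<close> together. This is
      enough exactly up to \<open>K = 8/5\<close>, where the three labels for both signs become
      affordable.\<close>
    have split: "\<exists>A' P. finite_subspace_partition M A' P \<and> block_refines P Q \<and>
        card P + 1 \<le> (card Q + 1) * 2 \<and> emeasure M (A' - A) \<le> ennreal (C * 4 / D) \<and>
        (\<integral>x. (F x - block_avg M P F x)\<^sup>2 \<partial>M) \<le> 5/8 * (C * D)"
    proof (cases "z' \<le> z")
      case True
      obtain A' P where P: "finite_subspace_partition M A' P" "block_refines P Q"
        "card P + 1 \<le> (card Q + 1) * card {0::nat, 1}" "emeasure M (A' - A) \<le> ennreal (C * (real 2)\<^sup>2 / D)"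
        "(\<integral>x. (F x - block_avg M P F x)\<^sup>2 \<partial>M) \<le> D / (real 2)\<^sup>2 * z + D * z'"
        unfolding z_def z'_def
        by (rule level_refinement[OF Q _ CD(1) Z(1) _ _ lev(1)]) auto
      have "z / 4 + z' \<le> 5/8 * C" using True zz by linarith
      then have "D * (z / 4 + z') \<le> D * (5/8 * C)" using CD by (intro mult_left_mono) auto
      then show ?thesis using P by (intro exI[of _ A'] exI[of _ P]) (auto simp: algebra_simps)
    next
      case False
      have Z2: "space M - (space M - Z) = Z" by (auto simp: Z_def)
      obtain A' P where P: "finite_subspace_partition M A' P" "block_refines P Q"
        "card P + 1 \<le> (card Q + 1) * card {0::nat, 2}" "emeasure M (A' - A) \<le> ennreal (C * (real 2)\<^sup>2 / D)"
        "(\<integral>x. (F x - block_avg M P F x)\<^sup>2 \<partial>M) \<le> D / (real 2)\<^sup>2 * z' + D * z"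
        unfolding z_def z'_def
        by (rule level_refinement[OF Q _ CD(1) Z(2) _ _ lev(2), unfolded Z2]) auto
      have "z' / 4 + z \<le> 5/8 * C" using False zz by linarith
      then have "D * (z' / 4 + z) \<le> D * (5/8 * C)" using CD by (intro mult_left_mono) auto
      then show ?thesis using P by (intro exI[of _ A'] exI[of _ P]) (auto simp: algebra_simps)
    qed
    then obtain A' P where P: "finite_subspace_partition M A' P" "block_refines P Q"
        "card P + 1 \<le> (card Q + 1) * 2" "emeasure M (A' - A) \<le> ennreal (C * 4 / D)"
        "(\<integral>x. (F x - block_avg M P F x)\<^sup>2 \<partial>M) \<le> 5/8 * (C * D)" by blast
    have "2 powr 1 \<le> 2 powr K" using 2 by (intro powr_mono) auto
    then have "(real (card Q) + 1) * 2 \<le> (real (card Q) + 1) * 2 powr K" by (intro mult_left_mono) auto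
    moreover have "real (card P + 1) \<le> real ((card Q + 1) * 2)" using P(3) by (rule of_nat_mono)
    ultimately have c: "real (card P) + 1 \<le> (real (card Q) + 1) * 2 powr K" by simp
    have "C * 4 / D * 1 \<le> C * 4 / D * K\<^sup>2" using CD 2 by (intro mult_left_mono) auto
    also have "\<dots> = 4 * C ^ 3 * D / e ^ 4"
      using CD e by (simp add: K_def field_simps power2_eq_square power3_eq_cube power4_eq_xxxx)
    finally have m: "emeasure M (A' - A) \<le> ennreal (4 * C ^ 3 * D / e ^ 4)"
      using P(4) by (simp add: order_trans[OF P(4)] ennreal_leI)
    have "5/8 * (C * D) \<le> 1 * e\<^sup>2" unfolding eK mult.assoc[symmetric] using 2 by (intro mult_right_mono) auto
    then show thesis using that[OF P(1,2)] c m P(5) by (simp add: K_def)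
  next
    case 3
    then obtain A' P N where P: "finite_subspace_partition M A' P" "block_refines P Q"
      "2 \<le> N" "(real N - 1)\<^sup>2 < K" "real (card P) + 1 \<le> (real (card Q) + 1) * (2 * real N - 1)"
      "emeasure M (A' - A) \<le> ennreal (4 * C ^ 3 * D / e ^ 4)"
      "(\<integral>x. (F x - block_avg M P F x)\<^sup>2 \<partial>M) \<le> e\<^sup>2"
      unfolding K_def by (rule uniform_level_refinement[OF Q e])
    note P(5)
    also have "(real (card Q) + 1) * (2 * real N - 1) \<le> (real (card Q) + 1) * 2 powr K"
      using label_count_le_powr(1)[OF P(3,4) 3] by (intro mult_left_mono) auto
    finally show thesis using that[OF P(1,2)] P(6,7) by (simp add: K_def)
  qed
qed

end

lemma one_class_error:
  fixes f D h i :: real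
  assumes D: "0 < D" and f: "0 \<le> f" "f \<le> D" and i: "0 \<le> i" "i \<le> 1"
    and h: "h = (if c \<and> 13/50 * D \<le> f then f - 981/2000 * D else f)"
  shows "(max 0 h)\<^sup>2 + i * (max 0 (- h))\<^sup>2 / 2 \<le> D * ((if c then 13/50 else 1) * f)"
    and "(max 0 (- h))\<^sup>2 + i * (max 0 h)\<^sup>2 / 2 \<le> D * ((if c then 41/200 else 1/2) * f)"
proof -
  define v where "v = f / D"
  define d where "d = h / D"
  have v: "0 \<le> v" "v \<le> 1" "f = D * v" using D f by (auto simp: v_def)
  have hd: "h = D * d" using D by (simp add: d_def)
  have d: "d = (if c \<and> 13/50 \<le> v then v - 981/2000 else v)"
    using h D unfolding d_def v(3) by (auto simp: field_simps)
  have m: "(max 0 h)\<^sup>2 = D\<^sup>2 * (max 0 d)\<^sup>2" "(max 0 (- h))\<^sup>2 = D\<^sup>2 * (max 0 (- d))\<^sup>2"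
    unfolding hd using D by (auto simp: max_def power_mult_distrib zero_le_mult_iff mult_le_0_iff)
  have le: "x + i * y / 2 \<le> x + y / 2" if "0 \<le> y" for x y :: real
    using that i by (simp add: mult_left_le_one_le)
  have "(max 0 h)\<^sup>2 + i * (max 0 (- h))\<^sup>2 / 2 \<le> (max 0 h)\<^sup>2 + (max 0 (- h))\<^sup>2 / 2" by (rule le) simp
  also have "\<dots> = D\<^sup>2 * ((max 0 d)\<^sup>2 + (max 0 (- d))\<^sup>2 / 2)" unfolding m by (simp add: algebra_simps)
  also have "\<dots> \<le> D\<^sup>2 * ((if c then 13/50 else 1) * v)"
    by (rule mult_left_mono[OF one_level_error(1)[OF v(1,2) d]]) simp
  finally show "(max 0 h)\<^sup>2 + i * (max 0 (- h))\<^sup>2 / 2 \<le> D * ((if c then 13/50 else 1) * f)"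
    unfolding v(3) by (simp add: power2_eq_square split: if_splits)
  have "(max 0 (- h))\<^sup>2 + i * (max 0 h)\<^sup>2 / 2 \<le> (max 0 (- h))\<^sup>2 + (max 0 h)\<^sup>2 / 2" by (rule le) simp
  also have "\<dots> = D\<^sup>2 * ((max 0 (- d))\<^sup>2 + (max 0 d)\<^sup>2 / 2)" unfolding m by (simp add: algebra_simps)
  also have "\<dots> \<le> D\<^sup>2 * ((if c then 41/200 else 1/2) * v)"
    by (rule mult_left_mono[OF one_level_error(2)[OF v(1,2) d]]) simp
  finally show "(max 0 (- h))\<^sup>2 + i * (max 0 h)\<^sup>2 / 2 \<le> D * ((if c then 41/200 else 1/2) * f)"
    unfolding v(3) by (simp add: power2_eq_square split: if_splits)
qed

context bounded_integrable
begin

text \<open>The two cost assumptions are integrated forms of the one-sided conditions in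
  \<open>set_integral_block_deviation\<close>, for \<open>F\<close> and for
  \<open>-F\<close>.\<close>

lemma one_class_refinement:
  fixes c\<^sub>a c\<^sub>b c\<^sub>p c\<^sub>n :: bool
  assumes Q: "finite_subspace_partition M A Q" and D: "0 < D" and e: "0 < e"
  defines "w\<^sub>a \<equiv> LINT x:{x\<in>A. 0 < F x}|M. \<bar>F x\<bar>" and "w\<^sub>b \<equiv> LINT x:{x\<in>A. \<not> 0 < F x}|M. \<bar>F x\<bar>"
    and "w\<^sub>p \<equiv> LINT x:{x\<in>space M - A. 0 < F x}|M. \<bar>F x\<bar>"
    and "w\<^sub>n \<equiv> LINT x:{x\<in>space M - A. \<not> 0 < F x}|M. \<bar>F x\<bar>"
  assumes cost: "D * region_cost c\<^sub>a c\<^sub>b c\<^sub>p c\<^sub>n w\<^sub>a w\<^sub>b w\<^sub>p w\<^sub>n \<le> e\<^sup>2"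
    "D * region_cost c\<^sub>b c\<^sub>a c\<^sub>n c\<^sub>p w\<^sub>b w\<^sub>a w\<^sub>n w\<^sub>p \<le> e\<^sup>2"
  obtains A' P where "finite_subspace_partition M A' P" "block_refines P Q"
    "card P \<le> card Q * (1 + of_bool c\<^sub>a + of_bool c\<^sub>b) + (of_bool c\<^sub>p + of_bool c\<^sub>n)"
    "emeasure M (A' - A) \<le> ennreal (4 * C / D)"
    "\<And>S. S \<in> sets M \<Longrightarrow> emeasure M S < \<infinity> \<Longrightarrow> 0 < measure M S \<Longrightarrow>
      \<bar>LINT x:S|M. F x - block_avg M P F x\<bar> \<le> e * sqrt (measure M S)"
proof -
  have A[measurable]: "A \<in> sets M" using Q by (simp add: finite_subspace_partition_def)
  have AM: "A \<subseteq> space M" by (rule sets.sets_into_space[OF A])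
  define R where "R = {x\<in>space M. 13/50 * D \<le> \<bar>F x\<bar> \<and>
    (if x \<in> A then (if 0 < F x then c\<^sub>a else c\<^sub>b) else (if 0 < F x then c\<^sub>p else c\<^sub>n))}"
  have R[measurable]: "R \<in> sets M" unfolding R_def by measurable
  define l :: "'a \<Rightarrow> nat" where "l x = (if x \<in> R then (if 0 < F x then 1 else 2) else 0)" for x
  have lm: "l \<in> measurable M (count_space UNIV)" unfolding l_def[abs_def] by measurable
  define val :: "nat \<Rightarrow> real" where "val i = (if i = 0 then 0 else if i = 1 then 981/2000 * D else - (981/2000 * D))" for i
  define I :: "nat set" where "I = {0} \<union> (if c\<^sub>a then {1} else {}) \<union> (if c\<^sub>b then {2} else {})"
  define J :: "nat set" where "J = (if c\<^sub>p then {1} else {}) \<union> (if c\<^sub>n then {2} else {})"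
  have cI: "finite I" "card I = 1 + of_bool c\<^sub>a + of_bool c\<^sub>b" by (auto simp: I_def)
  have cJ: "finite J" "card J = of_bool c\<^sub>p + of_bool c\<^sub>n" by (auto simp: J_def)
  have "emeasure M {x\<in>space M. l x \<noteq> 0} \<le> ennreal (C / (13/50 * D))"
    by (rule markov) (use D in \<open>auto simp: l_def R_def\<close>)
  \<comment> \<open>Uses \<open>50/13 <= 4\<close>.\<close>
  also have "\<dots> \<le> ennreal (4 * C / D)"
    using C0 D by (intro ennreal_leI) (simp add: field_simps)
  finally have em: "emeasure M {x\<in>space M. l x \<noteq> 0} \<le> ennreal (4 * C / D)" .
  obtain A' P where P: "finite_subspace_partition M A' P" "block_refines P Q"
    "card P \<le> card Q * card I + card J" "A' = A \<union> {x\<in>space M - A. l x \<noteq> 0}"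
    "emeasure M (A' - A) \<le> ennreal (4 * C / D)" "step_on (space M) P (\<lambda>x. val (l x))"
  proof (rule quantized_refinement[OF Q lm cI(1) _ cJ(1) _ em, of val])
    show "l ` A \<subseteq> I" by (auto simp: l_def R_def I_def)
    show "l ` (space M - A) \<subseteq> insert 0 J" by (auto simp: l_def R_def J_def)
    show "val 0 = 0" by (simp add: val_def)
  qed
  have UP: "\<Union>P = A'" using P(1) by (simp add: finite_subspace_partition_def partition_on_def)
  have A'[measurable]: "A' \<in> sets M" using P(1) by (simp add: finite_subspace_partition_def)
  have bf: "block_family M P" by (rule finite_subspace_partition_block_family[OF P(1)])
  define h where "h x = F x - val (l x)" for x
  have hm[measurable]: "h \<in> borel_measurable M"
    unfolding h_def using step_on_integrable(1)[OF bf P(6)] F by auto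
  have h2: "integrable M (\<lambda>x. (h x)\<^sup>2)"
    unfolding h_def by (rule block_avg_best_approx(1)[OF bf F F_square(1) P(6)])
  let ?Ra = "{x\<in>A. 0 < F x}" and ?Rb = "{x\<in>A. \<not> 0 < F x}"
  let ?Rp = "{x\<in>space M - A. 0 < F x}" and ?Rn = "{x\<in>space M - A. \<not> 0 < F x}"
  have eqs: "?Ra = A \<inter> {x\<in>space M. 0 < F x}" "?Rb = A - {x\<in>space M. 0 < F x}"
    "?Rp = {x\<in>space M. 0 < F x} - A" "?Rn = (space M - {x\<in>space M. 0 < F x}) - A"
    using AM by auto
  have Rs: "?Ra \<in> sets M" "?Rb \<in> sets M" "?Rp \<in> sets M" "?Rn \<in> sets M"
    unfolding eqs by measurable
  define u where "u Z x = indicator Z x *\<^sub>R \<bar>F x\<bar>" for Z x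
  have ui: "integrable M (u Z)" if "Z \<in> sets M" for Z
    unfolding u_def using that F by (intro integrable_mult_indicator) auto
  have uI: "integral\<^sup>L M (u ?Ra) = w\<^sub>a" "integral\<^sup>L M (u ?Rb) = w\<^sub>b" "integral\<^sup>L M (u ?Rp) = w\<^sub>p" "integral\<^sup>L M (u ?Rn) = w\<^sub>n"
    unfolding u_def w\<^sub>a_def w\<^sub>b_def w\<^sub>p_def w\<^sub>n_def set_lebesgue_integral_def by auto
  have cost_int: "integrable M (\<lambda>x. D * region_cost b1 b2 b3 b4 (u Z1 x) (u Z2 x) (u Z3 x) (u Z4 x))"
    "(\<integral>x. D * region_cost b1 b2 b3 b4 (u Z1 x) (u Z2 x) (u Z3 x) (u Z4 x) \<partial>M) =
      D * region_cost b1 b2 b3 b4 (integral\<^sup>L M (u Z1)) (integral\<^sup>L M (u Z2)) (integral\<^sup>L M (u Z3)) (integral\<^sup>L M (u Z4))"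
    if "Z1 \<in> sets M" "Z2 \<in> sets M" "Z3 \<in> sets M" "Z4 \<in> sets M" for b1 b2 b3 b4 Z1 Z2 Z3 Z4
    unfolding region_cost_def using that by (simp_all add: ui)
  have E_int: "integrable M (\<lambda>x. (max 0 (s * h x))\<^sup>2 + indicator A' x * (max 0 (- (s * h x)))\<^sup>2 / 2)" if "s\<^sup>2 = 1" for s
  proof (rule Bochner_Integration.integrable_bound[OF h2])
    show "(\<lambda>x. (max 0 (s * h x))\<^sup>2 + indicator A' x * (max 0 (- (s * h x)))\<^sup>2 / 2) \<in> borel_measurable M"
      by measurable
    have "(max 0 (s * h x))\<^sup>2 + indicator A' x * (max 0 (- (s * h x)))\<^sup>2 / 2 \<le> (s * h x)\<^sup>2" for x
      by (auto simp: indicator_def max_def)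
    moreover have "(s * h x)\<^sup>2 = (h x)\<^sup>2" for x using that by (simp add: power_mult_distrib)
    ultimately show "AE x in M. norm ((max 0 (s * h x))\<^sup>2 + indicator A' x * (max 0 (- (s * h x)))\<^sup>2 / 2) \<le> norm ((h x)\<^sup>2)"
      by simp
  qed
  have pw: "AE x in M.
     (max 0 (h x))\<^sup>2 + indicator A' x * (max 0 (- h x))\<^sup>2 / 2 \<le>
       D * region_cost c\<^sub>a c\<^sub>b c\<^sub>p c\<^sub>n (u ?Ra x) (u ?Rb x) (u ?Rp x) (u ?Rn x) \<and>
     (max 0 (- h x))\<^sup>2 + indicator A' x * (max 0 (h x))\<^sup>2 / 2 \<le>
       D * region_cost c\<^sub>b c\<^sub>a c\<^sub>n c\<^sub>p (u ?Rb x) (u ?Ra x) (u ?Rn x) (u ?Rp x)"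
    using FD AE_space
  proof eventually_elim
    case (elim x)
    define c where "c = (if x \<in> A then (if 0 < F x then c\<^sub>a else c\<^sub>b) else (if 0 < F x then c\<^sub>p else c\<^sub>n))"
    have xR: "x \<in> R \<longleftrightarrow> c \<and> 13/50 * D \<le> \<bar>F x\<bar>" using elim by (auto simp: R_def c_def)
    define k where "k = (if 0 < F x then h x else - h x)"
    have k: "k = (if c \<and> 13/50 * D \<le> \<bar>F x\<bar> then \<bar>F x\<bar> - 981/2000 * D else \<bar>F x\<bar>)"
      unfolding k_def h_def l_def val_def xR by auto
    have i: "0 \<le> (indicator A' x :: real)" "(indicator A' x :: real) \<le> 1" by (auto simp: indicator_def)
    note err = one_class_error[OF D abs_ge_zero elim(1) i k]
    \<comment> \<open>A point outside \<open>A\<close> in a region without a class stays outside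
      \<open>A'\<close>, where the block average is 0 and the wrong sign is free. This is the
      coefficient 0 in \<open>region_cost\<close>.\<close>
    have out: "(max 0 (- k))\<^sup>2 + indicator A' x * (max 0 k)\<^sup>2 / 2 = 0" if "x \<notin> A" "\<not> c"
    proof -
      have "x \<notin> A'" using that xR by (simp add: P(4) l_def)
      moreover have "k = \<bar>F x\<bar>" using k that by simp
      ultimately show ?thesis by simp
    qed
    show ?case
      using elim err out unfolding k_def c_def u_def region_cost_def
      by (cases "x \<in> A"; cases "0 < F x") (auto split: if_splits)
  qed
  have E1: "(\<integral>x. (max 0 (h x))\<^sup>2 + indicator A' x * (max 0 (- h x))\<^sup>2 / 2 \<partial>M) \<le> e\<^sup>2"
  proof -
    have "(\<integral>x. (max 0 (h x))\<^sup>2 + indicator A' x * (max 0 (- h x))\<^sup>2 / 2 \<partial>M) \<le>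
        (\<integral>x. D * region_cost c\<^sub>a c\<^sub>b c\<^sub>p c\<^sub>n (u ?Ra x) (u ?Rb x) (u ?Rp x) (u ?Rn x) \<partial>M)"
      by (rule integral_mono_AE[OF _ cost_int(1)[OF Rs]]) (use E_int[of 1] pw in auto)
    also have "\<dots> \<le> e\<^sup>2" unfolding cost_int(2)[OF Rs] uI by (rule cost(1))
    finally show ?thesis .
  qed
  have E2: "(\<integral>x. (max 0 (- h x))\<^sup>2 + indicator A' x * (max 0 (h x))\<^sup>2 / 2 \<partial>M) \<le> e\<^sup>2"
  proof -
    note Rs' = Rs(2) Rs(1) Rs(4) Rs(3)
    have "(\<integral>x. (max 0 (- h x))\<^sup>2 + indicator A' x * (max 0 (h x))\<^sup>2 / 2 \<partial>M) \<le>
        (\<integral>x. D * region_cost c\<^sub>b c\<^sub>a c\<^sub>n c\<^sub>p (u ?Rb x) (u ?Ra x) (u ?Rn x) (u ?Rp x) \<partial>M)"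
      by (rule integral_mono_AE[OF _ cost_int(1)[OF Rs']]) (use E_int[of "-1"] pw in auto)
    also have "\<dots> \<le> e\<^sup>2" unfolding cost_int(2)[OF Rs'] uI by (rule cost(2))
    finally show ?thesis .
  qed
  have dev: "\<bar>LINT x:S|M. F x - block_avg M P F x\<bar> \<le> e * sqrt (measure M S)"
    if S: "S \<in> sets M" "emeasure M S < \<infinity>" "0 < measure M S" for S
    by (rule set_integral_block_deviation[OF bf F P(6) _ _ _ S e])
       (use h2 E1 E2 in \<open>simp_all add: h_def UP\<close>)
  show thesis
    by (rule that[OF P(1,2) _ P(5) dev]) (use P(3) cI cJ in simp)
qed

text \<open>The count here is \<open>card Q\<close> itself, without the extra one; in return the
  degree is only controlled against test sets, which need not survive further refinement.\<close>

lemma jumble_refinement: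
  assumes Q: "finite_subspace_partition M A Q" "Q \<noteq> {}" and e: "0 < e"
  obtains A' P where "finite_subspace_partition M A' P" "block_refines P Q"
    "real (card P) \<le> real (card Q) * 2 powr (C * D / e\<^sup>2)"
    "emeasure M (A' - A) \<le> ennreal (4 * C ^ 3 * D / e ^ 4)"
    "\<And>S. S \<in> sets M \<Longrightarrow> emeasure M S < \<infinity> \<Longrightarrow> 0 < measure M S \<Longrightarrow>
      \<bar>LINT x:S|M. F x - block_avg M P F x\<bar> \<le> e * sqrt (measure M S)"
proof -
  define K where "K = C * D / e\<^sup>2"
  have eK: "C * D = K * e\<^sup>2" using e by (simp add: K_def)
  have q1: "1 \<le> real (card Q)"
    using Q by (auto simp: finite_subspace_partition_def Suc_le_eq card_gt_0_iff)
  consider "K \<le> 1" | "1 < K" "K \<le> 7/3" | "7/3 < K" by linarith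
  then show thesis
  proof cases
    case 1
    have "0 \<le> K" using C0 D0 by (simp add: K_def)
    then have "1 \<le> 2 powr K" by (simp add: ge_one_powr_ge_zero)
    then have c: "real (card Q) \<le> real (card Q) * 2 powr K" by (simp add: mult_le_cancel_left1)
    have "C * D \<le> e\<^sup>2" unfolding eK using mult_right_mono[OF 1, of "e\<^sup>2"] by simp
    then have "(\<integral>x. (F x - block_avg M Q F x)\<^sup>2 \<partial>M) \<le> e\<^sup>2" using block_avg_l2_le[OF Q(1)] by simp
    note dev = l2_deviation[OF Q(1) e this]
    show thesis by (rule that[OF Q(1) block_refines_refl c[unfolded K_def] _ dev]) auto
  next
    case 2
    have CD: "0 < D" "0 < C" using 2 e C0 D0 unfolding K_def by (auto simp: less_le)
    have A: "A \<in> sets M" using Q by (simp add: finite_subspace_partition_def)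
    have AM: "A \<subseteq> space M" by (rule sets.sets_into_space[OF A])
    define w where "w Z = (LINT x:Z|M. \<bar>F x\<bar>)" for Z
    let ?a = "{x\<in>A. 0 < F x}" and ?b = "{x\<in>A. \<not> 0 < F x}"
    let ?p = "{x\<in>space M - A. 0 < F x}" and ?n = "{x\<in>space M - A. \<not> 0 < F x}"
    have w0: "0 \<le> w Z" for Z unfolding w_def set_lebesgue_integral_def by simp
    have si: "set_integrable M Z (\<lambda>x. \<bar>F x\<bar>)" if "Z \<in> sets M" for Z
      unfolding set_integrable_def using that F by (intro integrable_mult_indicator) auto
    have eqs: "?a = A \<inter> {x\<in>space M. 0 < F x}" "?b = A - {x\<in>space M. 0 < F x}"
      "?p = {x\<in>space M. 0 < F x} - A" "?n = (space M - {x\<in>space M. 0 < F x}) - A"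
      using AM by auto
    have Rs: "?a \<in> sets M" "?b \<in> sets M" "?p \<in> sets M" "?n \<in> sets M"
      unfolding eqs using A by measurable
    have wU: "w (X \<union> Y) = w X + w Y" if "X \<inter> Y = {}" "X \<in> sets M" "Y \<in> sets M" for X Y
      unfolding w_def using that by (intro set_integral_Un si) auto
    have "w ?a + w ?b + (w ?p + w ?n) = w (?a \<union> ?b) + w (?p \<union> ?n)"
      using Rs by (subst (1 2) wU) auto
    also have "\<dots> = w ((?a \<union> ?b) \<union> (?p \<union> ?n))" by (rule wU[symmetric]) (use Rs in auto)
    also have "(?a \<union> ?b) \<union> (?p \<union> ?n) = space M" using AM by auto
    also have "w (space M) \<le> C" unfolding w_def using FC set_integral_space[OF integrable_abs[OF F]] by simp
    finally have W: "w ?a + w ?b + w ?p + w ?n \<le> C" by simp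
    obtain c\<^sub>a c\<^sub>b c\<^sub>p c\<^sub>n where c:
      "1 + (of_bool c\<^sub>a + of_bool c\<^sub>b + of_bool c\<^sub>p + of_bool c\<^sub>n) \<le> 2 powr K"
      "K * region_cost c\<^sub>a c\<^sub>b c\<^sub>p c\<^sub>n (w ?a) (w ?b) (w ?p) (w ?n) \<le> w ?a + w ?b + w ?p + w ?n"
      "K * region_cost c\<^sub>b c\<^sub>a c\<^sub>n c\<^sub>p (w ?b) (w ?a) (w ?n) (w ?p) \<le> w ?a + w ?b + w ?p + w ?n"
      by (rule choose_regions[OF w0 w0 w0 w0 2])
    have cost: "D * y \<le> e\<^sup>2" if "K * y \<le> w ?a + w ?b + w ?p + w ?n" for y
    proof -
      have "K * y \<le> C" using that W by simp
      then have "D * (K * y) \<le> D * C" using CD by (intro mult_left_mono) auto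
      then have "K * (D * y) \<le> K * e\<^sup>2" using eK by (simp add: algebra_simps)
      then show ?thesis using 2 by simp
    qed
    obtain A' P where P: "finite_subspace_partition M A' P" "block_refines P Q"
      "card P \<le> card Q * (1 + of_bool c\<^sub>a + of_bool c\<^sub>b) + (of_bool c\<^sub>p + of_bool c\<^sub>n)"
      "emeasure M (A' - A) \<le> ennreal (4 * C / D)"
      "\<And>S. S \<in> sets M \<Longrightarrow> emeasure M S < \<infinity> \<Longrightarrow> 0 < measure M S \<Longrightarrow>
        \<bar>LINT x:S|M. F x - block_avg M P F x\<bar> \<le> e * sqrt (measure M S)"
      by (rule one_class_refinement[OF Q(1) CD(1) e cost[OF c(2), unfolded w_def] cost[OF c(3), unfolded w_def]])
         (rule that)
    have "real (card P) \<le> real (card Q * (1 + of_bool c\<^sub>a + of_bool c\<^sub>b) + (of_bool c\<^sub>p + of_bool c\<^sub>n))"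
      using P(3) by (rule of_nat_mono)
    also have "\<dots> = real (card Q) * (1 + of_bool c\<^sub>a + of_bool c\<^sub>b) + (of_bool c\<^sub>p + of_bool c\<^sub>n)" by simp
    \<comment> \<open>Since \<open>Q\<close> is nonempty, an outside class, which is a single part,
      may be charged like a class that splits all parts of \<open>Q\<close>.\<close>
    also have "\<dots> \<le> real (card Q) * (1 + of_bool c\<^sub>a + of_bool c\<^sub>b) + real (card Q) * (of_bool c\<^sub>p + of_bool c\<^sub>n)"
      using mult_right_mono[OF q1, of "of_bool c\<^sub>p + of_bool c\<^sub>n"] by simp
    also have "\<dots> = real (card Q) * (1 + (of_bool c\<^sub>a + of_bool c\<^sub>b + of_bool c\<^sub>p + of_bool c\<^sub>n))"
      by (simp add: algebra_simps)
    also have "\<dots> \<le> real (card Q) * 2 powr K" using c(1) by (intro mult_left_mono) auto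
    finally have cP: "real (card P) \<le> real (card Q) * 2 powr K" .
    have "4 * C / D * 1 \<le> 4 * C / D * K\<^sup>2" using CD 2 by (intro mult_left_mono) auto
    also have "\<dots> = 4 * C ^ 3 * D / e ^ 4"
      using CD e by (simp add: K_def field_simps power2_eq_square power3_eq_cube power4_eq_xxxx)
    finally have "emeasure M (A' - A) \<le> ennreal (4 * C ^ 3 * D / e ^ 4)"
      by (intro order_trans[OF P(4)] ennreal_leI) simp
    then show thesis using that[OF P(1,2) cP[unfolded K_def] _ P(5)] by blast
  next
    case 3
    then have "8/5 < C * D / e\<^sup>2" by (simp add: K_def)
    then obtain A' P N where P: "finite_subspace_partition M A' P" "block_refines P Q"
      "2 \<le> N" "(real N - 1)\<^sup>2 < K" "real (card P) + 1 \<le> (real (card Q) + 1) * (2 * real N - 1)"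
      "emeasure M (A' - A) \<le> ennreal (4 * C ^ 3 * D / e ^ 4)"
      "(\<integral>x. (F x - block_avg M P F x)\<^sup>2 \<partial>M) \<le> e\<^sup>2"
      unfolding K_def by (rule uniform_level_refinement[OF Q(1) e])
    have "real (card P) \<le> real (card Q) * (2 * real N - 1) + 1 * (2 * real N - 2)"
      using P(5) by (simp add: algebra_simps)
    also have "\<dots> \<le> real (card Q) * (2 * real N - 1) + real (card Q) * (2 * real N - 2)"
      using q1 P(3) by (intro add_left_mono mult_right_mono) auto
    also have "\<dots> = real (card Q) * (4 * real N - 3)" by (simp add: algebra_simps)
    also have "\<dots> \<le> real (card Q) * 2 powr K"
      using label_count_le_powr(2)[OF P(3,4) 3] by (intro mult_left_mono) auto
    finally have cP: "real (card P) \<le> real (card Q) * 2 powr K" .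
    note dev = l2_deviation[OF P(1) e P(7)]
    show thesis by (rule that[OF P(1,2) cP[unfolded K_def] P(6) dev])
  qed
qed

end

section \<open>Averaging a graphex\<close>

lemma integral_block_avg:
  fixes f :: "'a \<Rightarrow> real"
  assumes P: "block_family M P" and f: "integrable M f"
  shows "(\<integral>x. block_avg M P f x \<partial>M) = (LINT x:\<Union>P|M. f x)"
proof -
  have X: "X \<in> sets M" "emeasure M X < \<infinity>" if "X \<in> P" for X using P that by (auto simp: block_family_def)
  have disj: "AE x in M. x \<in> X \<and> x \<in> Y \<longrightarrow> X = Y" if "X \<in> P" "Y \<in> P" for X Y
    using P that unfolding block_family_def disjoint_def by (intro AE_I2) blast
  have "(\<integral>x. block_avg M P f x \<partial>M) = (\<Sum>X\<in>P. \<integral>x. indicator X x * ((LINT x:X|M. f x) / measure M X) \<partial>M)"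
    unfolding block_avg_def
    by (rule Bochner_Integration.integral_sum) (use X in \<open>auto intro!: integrable_mult_left integrable_real_indicator\<close>)
  also have "\<dots> = (\<Sum>X\<in>P. LINT x:X|M. f x)"
  proof (intro sum.cong refl)
    fix X assume "X \<in> P"
    note X = X[OF this]
    have "(\<integral>x. indicator X x * ((LINT x:X|M. f x) / measure M X) \<partial>M) = measure M X * ((LINT x:X|M. f x) / measure M X)"
      using X by (simp add: Int_absorb2 sets.sets_into_space)
    then show "(\<integral>x. indicator X x * ((LINT x:X|M. f x) / measure M X) \<partial>M) = (LINT x:X|M. f x)"
      using set_lebesgue_integral_null[OF X, of f] by (cases "measure M X = 0") auto
  qed
  also have "\<dots> = (LINT x:(\<Union>X\<in>P. X)|M. f x)"
    by (rule set_integral_finite_UN_AE[symmetric, OF _ disj])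
       (use P f set_integrable_block[OF P _ f] in \<open>auto simp: block_family_def\<close>)
  finally show ?thesis by simp
qed

lemma block_avg_add:
  assumes P: "block_family M P" and f: "integrable M f" and g: "integrable M g"
  shows "block_avg M P f x + block_avg M P g x = block_avg M P (\<lambda>x. f x + g x) x"
  unfolding block_avg_def sum.distrib[symmetric]
  using set_integrable_block[OF P _ f] set_integrable_block[OF P _ g]
  by (intro sum.cong) (auto simp: set_integral_add algebra_simps add_divide_distrib)

section \<open>Rectangles as blocks of the product space\<close>

definition prod_blocks :: "'a set set \<Rightarrow> ('a \<times> 'a) set set" where
  "prod_blocks P = (\<lambda>(X, Y). X \<times> Y) ` (P \<times> P)"

lemma Union_prod_blocks: "\<Union>(prod_blocks P) = \<Union>P \<times> \<Union>P"
  by (auto simp: prod_blocks_def)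

lemma prod_blocks_refines:
  assumes "block_refines P' P"
  shows "block_refines (prod_blocks P') (prod_blocks P)"
  unfolding block_refines_def Union_prod_blocks
proof (intro conjI ballI)
  show "\<Union>P \<times> \<Union>P \<subseteq> \<Union>P' \<times> \<Union>P'" using assms by (auto simp: block_refines_def)
  fix Z assume "Z \<in> prod_blocks P'"
  then obtain X' Y' where Z: "X' \<in> P'" "Y' \<in> P'" "Z = X' \<times> Y'" by (auto simp: prod_blocks_def)
  then consider "X' \<inter> \<Union>P = {}" | "Y' \<inter> \<Union>P = {}" | X Y where "X \<in> P" "Y \<in> P" "X' \<subseteq> X" "Y' \<subseteq> Y"
    using assms unfolding block_refines_def by meson
  then show "(\<exists>X\<in>prod_blocks P. Z \<subseteq> X) \<or> Z \<inter> \<Union>P \<times> \<Union>P = {}"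
  proof cases
    case 3
    then have "X \<times> Y \<in> prod_blocks P" "Z \<subseteq> X \<times> Y" using Z by (auto simp: prod_blocks_def)
    then show ?thesis by blast
  qed (use Z in auto)
qed

lemma step_on_prod_blocks:
  assumes l: "\<And>X. X \<in> P \<Longrightarrow> \<exists>i. \<forall>x\<in>X. l x = i" "\<And>x. x \<in> \<Omega> - \<Union>P \<Longrightarrow> l x = 0"
    and z: "\<And>i. \<Phi> 0 i = 0" "\<And>i. \<Phi> i 0 = 0"
  shows "step_on (\<Omega> \<times> \<Omega>) (prod_blocks P) (\<lambda>p. \<Phi> (l (fst p)) (l (snd p)))"
  unfolding step_on_def
proof (intro conjI ballI)
  fix Z assume "Z \<in> prod_blocks P"
  then obtain X Y where Z: "X \<in> P" "Y \<in> P" "Z = X \<times> Y" by (auto simp: prod_blocks_def)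
  obtain i j where "\<forall>x\<in>X. l x = i" "\<forall>y\<in>Y. l y = j" using l(1) Z by metis
  then have "\<forall>p\<in>Z. \<Phi> (l (fst p)) (l (snd p)) = \<Phi> i j" using Z by auto
  then show "\<exists>c. \<forall>p\<in>Z. \<Phi> (l (fst p)) (l (snd p)) = c" by blast
next
  fix p assume "p \<in> \<Omega> \<times> \<Omega> - \<Union>(prod_blocks P)"
  then have "fst p \<in> \<Omega> - \<Union>P \<or> snd p \<in> \<Omega> - \<Union>P" unfolding Union_prod_blocks by (cases p) auto
  then show "\<Phi> (l (fst p)) (l (snd p)) = 0" using l(2) z by auto
qed

context sigma_finite_measure
begin

lemma emeasure_Times_finite:
  "X \<in> sets M \<Longrightarrow> Y \<in> sets M \<Longrightarrow> emeasure M X < \<infinity> \<Longrightarrow> emeasure M Y < \<infinity> \<Longrightarrow> emeasure (M \<Otimes>\<^sub>M M) (X \<times> Y) < \<infinity>"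
  by (simp add: emeasure_pair_measure_Times ennreal_mult_less_top)

lemma measure_Times:
  "X \<in> sets M \<Longrightarrow> Y \<in> sets M \<Longrightarrow> measure (M \<Otimes>\<^sub>M M) (X \<times> Y) = measure M X * measure M Y"
  by (simp add: measure_def emeasure_pair_measure_Times enn2real_mult)

lemma prod_blocks_family:
  assumes P: "block_family M P"
  shows "block_family (M \<Otimes>\<^sub>M M) (prod_blocks P)"
proof -
  have "disjoint (prod_blocks P)"
    unfolding disjoint_def
  proof (intro ballI impI)
    fix Z Z' assume "Z \<in> prod_blocks P" "Z' \<in> prod_blocks P" "Z \<noteq> Z'"
    then obtain X Y X' Y' where *: "X \<in> P" "Y \<in> P" "Z = X \<times> Y" "X' \<in> P" "Y' \<in> P" "Z' = X' \<times> Y'"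
      by (auto simp: prod_blocks_def)
    then have "X \<noteq> X' \<or> Y \<noteq> Y'" using \<open>Z \<noteq> Z'\<close> by auto
    then have "X \<inter> X' = {} \<or> Y \<inter> Y' = {}" using P * unfolding block_family_def disjoint_def by metis
    then show "Z \<inter> Z' = {}" using * by auto
  qed
  moreover have "finite (prod_blocks P)" using P by (simp add: prod_blocks_def block_family_def)
  moreover have "Z \<in> sets (M \<Otimes>\<^sub>M M) \<and> emeasure (M \<Otimes>\<^sub>M M) Z < \<infinity>" if "Z \<in> prod_blocks P" for Z
    using that P emeasure_Times_finite by (auto simp: prod_blocks_def block_family_def)
  ultimately show ?thesis by (simp add: block_family_def)
qed

lemma block_avg_prod_blocks:
  assumes P: "finite_subspace_partition M A P"
  shows "block_avg (M \<Otimes>\<^sub>M M) (prod_blocks P) f (x, y) =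
    (\<Sum>X\<in>P. \<Sum>Y\<in>P. indicator X x * indicator Y y *
      ((LINT p:X \<times> Y|(M \<Otimes>\<^sub>M M). f p) / (measure M X * measure M Y)))"
proof -
  have ne: "X \<noteq> {}" "X \<in> sets M" if "X \<in> P" for X
    using P that by (auto simp: finite_subspace_partition_def partition_on_def)
  \<comment> \<open>Rests on parts being nonempty; otherwise different pairs could give the same
    empty rectangle and the double sum would not match the sum over rectangles.\<close>
  have inj: "inj_on (\<lambda>(X, Y). X \<times> Y) (P \<times> P)"
    by (rule inj_onI) (use ne in \<open>auto simp: times_eq_iff\<close>)
  have "block_avg (M \<Otimes>\<^sub>M M) (prod_blocks P) f (x, y) =
      (\<Sum>(X, Y)\<in>P \<times> P. indicator (X \<times> Y) (x, y) * ((LINT p:X \<times> Y|(M \<Otimes>\<^sub>M M). f p) / measure (M \<Otimes>\<^sub>M M) (X \<times> Y)))"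
    unfolding block_avg_def prod_blocks_def by (subst sum.reindex[OF inj]) (simp add: case_prod_unfold comp_def)
  also have "\<dots> = (\<Sum>X\<in>P. \<Sum>Y\<in>P. indicator (X \<times> Y) (x, y) * ((LINT p:X \<times> Y|(M \<Otimes>\<^sub>M M). f p) / measure (M \<Otimes>\<^sub>M M) (X \<times> Y)))"
    by (rule sum.cartesian_product[symmetric])
  also have "\<dots> = (\<Sum>X\<in>P. \<Sum>Y\<in>P. indicator X x * indicator Y y *
      ((LINT p:X \<times> Y|(M \<Otimes>\<^sub>M M). f p) / (measure M X * measure M Y)))"
    using ne by (intro sum.cong refl) (simp add: indicator_times measure_Times)
  finally show ?thesis .
qed

end

section \<open>Integrability and bounds for a bounded signed graphex\<close>

locale bounded_graphex =
  fixes M :: "'a measure" and G :: "'a graphex" and B C D :: real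
  assumes signed: "signed_graphex M G" and bounded: "graphex_bounded M B C D G"
begin

sublocale sigma_finite_measure M
  using signed by (simp add: signed_graphex_def)

sublocale MM: pair_sigma_finite M M ..

abbreviation NN :: "('a \<times> 'a) measure" where "NN \<equiv> M \<Otimes>\<^sub>M M"

definition W :: "'a \<times> 'a \<Rightarrow> real" where "W p = kernel G (fst p) (snd p)"

abbreviation F :: "'a \<Rightarrow> real" where "F \<equiv> graphex_degree M G"

lemma BCD_nonneg: "0 \<le> B" "0 \<le> C" "0 \<le> D"
  using bounded by (auto simp: graphex_bounded_def)

lemma W_measurable [measurable]: "W \<in> borel_measurable NN"
proof -
  have "W = (\<lambda>(x, y). kernel G x y)" by (auto simp: W_def)
  then show ?thesis using signed by (simp add: signed_graphex_def)
qed

lemma S_measurable [measurable]: "star G \<in> borel_measurable M"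
  using signed by (simp add: signed_graphex_def)

lemma W_sym: "x \<in> space M \<Longrightarrow> y \<in> space M \<Longrightarrow> W (x, y) = W (y, x)"
  using signed by (simp add: signed_graphex_def W_def)

lemma W_bound: "AE p in NN. \<bar>W p\<bar> \<le> B"
proof -
  have le: "esssup NN (\<lambda>p. ennreal \<bar>W p\<bar>) \<le> ennreal B"
    using bounded by (simp add: graphex_bounded_def linf_norm_def W_def)
  have "AE p in NN. ennreal \<bar>W p\<bar> \<le> ennreal B"
    using esssup_AE[of "\<lambda>p. ennreal \<bar>W p\<bar>" NN] by eventually_elim (use le order_trans in blast)
  then show ?thesis by eventually_elim (simp add: BCD_nonneg)
qed

lemma norm1:
  shows W_integrable: "integrable NN W" and S_integrable: "integrable M (star G)"
    and norm1_le: "(\<integral>p. \<bar>W p\<bar> \<partial>NN) + 2 * (\<integral>x. \<bar>star G x\<bar> \<partial>M) \<le> C"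
proof -
  have le: "(\<integral>\<^sup>+p. ennreal \<bar>W p\<bar> \<partial>NN) + 2 * (\<integral>\<^sup>+x. ennreal \<bar>star G x\<bar> \<partial>M) \<le> ennreal C"
  proof -
    have "(\<integral>\<^sup>+p. ennreal \<bar>W p\<bar> \<partial>NN) + 2 * (\<integral>\<^sup>+x. ennreal \<bar>star G x\<bar> \<partial>M) \<le> graphex_norm1 M G"
      unfolding graphex_norm1_def W_def by (simp add: add_increasing2)
    also have "\<dots> \<le> ennreal C" using bounded by (simp add: graphex_bounded_def)
    finally show ?thesis .
  qed
  then have "(\<integral>\<^sup>+p. ennreal \<bar>W p\<bar> \<partial>NN) < \<infinity>" "2 * (\<integral>\<^sup>+x. ennreal \<bar>star G x\<bar> \<partial>M) < \<infinity>"
    by (auto intro: le_less_trans[OF order_trans[OF _ le]] simp: add_increasing add_increasing2)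
  then have fin: "(\<integral>\<^sup>+p. ennreal \<bar>W p\<bar> \<partial>NN) < \<infinity>" "(\<integral>\<^sup>+x. ennreal \<bar>star G x\<bar> \<partial>M) < \<infinity>"
    by (auto simp: ennreal_mult_less_top)
  show iW: "integrable NN W" and iS: "integrable M (star G)"
    using fin by (auto intro!: integrableI_bounded)
  have "ennreal ((\<integral>p. \<bar>W p\<bar> \<partial>NN) + 2 * (\<integral>x. \<bar>star G x\<bar> \<partial>M)) \<le> ennreal C"
    using le iW iS by (simp add: nn_integral_eq_integral ennreal_plus ennreal_mult)
  then show "(\<integral>p. \<bar>W p\<bar> \<partial>NN) + 2 * (\<integral>x. \<bar>star G x\<bar> \<partial>M) \<le> C"
    using ennreal_le_iff[OF BCD_nonneg(2)] by blast
qed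

lemma W_norm_le: "(\<integral>p. \<bar>W p\<bar> \<partial>NN) \<le> C"
proof -
  have "0 \<le> (\<integral>x. \<bar>star G x\<bar> \<partial>M)" by simp
  then show ?thesis using norm1_le by linarith
qed

text \<open>Source of the energy bound: it makes the squared \<open>L^2\<close> norm of the kernel
  at most \<open>C * B\<close>.\<close>

sublocale Wb: bounded_integrable NN W C B
  by unfold_locales (use W_integrable W_bound W_norm_le BCD_nonneg in auto)

lemma abs_degree_bound: "AE x in M. (\<integral>y. \<bar>W (x, y)\<bar> \<partial>M) + \<bar>star G x\<bar> \<le> D"
proof -
  let ?d = "graphex_degree M (graphex_abs G)"
  have eq: "?d x = (\<integral>y. \<bar>W (x, y)\<bar> \<partial>M) + \<bar>star G x\<bar>" for x
    by (simp add: graphex_degree_def graphex_abs_def W_def)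
  have le: "esssup M (\<lambda>x. ennreal \<bar>?d x\<bar>) \<le> ennreal D"
    using bounded by (simp add: graphex_bounded_def linf_norm_def)
  have "AE x in M. ennreal \<bar>?d x\<bar> \<le> ennreal D"
    using esssup_AE[of "\<lambda>x. ennreal \<bar>?d x\<bar>" M] by eventually_elim (use le order_trans in blast)
  then show ?thesis
  proof eventually_elim
    case (elim x)
    then have "\<bar>?d x\<bar> \<le> D" by (simp only: ennreal_le_iff[OF BCD_nonneg(3)])
    then show ?case unfolding eq by linarith
  qed
qed

lemma row_integrable: "AE x in M. integrable M (\<lambda>y. W (x, y))"
  by (rule MM.AE_integrable_fst'[OF W_integrable])

lemma degree_eq: "F x = (\<integral>y. W (x, y) \<partial>M) + star G x"
  by (simp add: graphex_degree_def W_def)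

lemma row_integral_integrable: "integrable M (\<lambda>x. \<integral>y. W (x, y) \<partial>M)"
  by (rule MM.integrable_fst'[OF W_integrable])

sublocale Fb: bounded_integrable M F C D
proof
  show F: "integrable M F"
    unfolding degree_eq[abs_def] using row_integral_integrable S_integrable by auto
  have le: "\<bar>F x\<bar> \<le> (\<integral>y. \<bar>W (x, y)\<bar> \<partial>M) + \<bar>star G x\<bar>" for x
    unfolding degree_eq by (rule order_trans[OF abs_triangle_ineq]) (simp add: integral_abs_bound)
  show "AE x in M. \<bar>F x\<bar> \<le> D"
    using abs_degree_bound by eventually_elim (use le order_trans in blast)
  have i: "integrable M (\<lambda>x. \<integral>y. \<bar>W (x, y)\<bar> \<partial>M)"
    using MM.integrable_fst'[of "\<lambda>p. \<bar>W p\<bar>"] W_integrable by auto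
  have "(\<integral>x. \<bar>F x\<bar> \<partial>M) \<le> (\<integral>x. (\<integral>y. \<bar>W (x, y)\<bar> \<partial>M) + \<bar>star G x\<bar> \<partial>M)"
    by (intro integral_mono) (use F i S_integrable le in auto)
  also have "\<dots> = (\<integral>p. \<bar>W p\<bar> \<partial>NN) + (\<integral>x. \<bar>star G x\<bar> \<partial>M)"
    using i S_integrable MM.integral_fst'[of "\<lambda>p. \<bar>W p\<bar>"] W_integrable by simp
  also have "\<dots> \<le> C"
  proof -
    have "0 \<le> (\<integral>x. \<bar>star G x\<bar> \<partial>M)" by simp
    then show ?thesis using norm1_le by linarith
  qed
  finally show "(\<integral>x. \<bar>F x\<bar> \<partial>M) \<le> C" .
qed (use BCD_nonneg in auto)

text \<open>The kernel part of the degree of \<open>x\<close>, counted into \<open>Y\<close>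
  only.\<close>

definition K :: "'a set \<Rightarrow> 'a \<Rightarrow> real" where "K Y x = (LINT y:Y|M. W (x, y))"

lemma set_integrable_NN: "Z \<in> sets NN \<Longrightarrow> set_integrable NN Z W"
  unfolding set_integrable_def by (rule integrable_mult_indicator[OF _ W_integrable])

lemma K_Fubini:
  assumes X: "X \<in> sets M" and Y: "Y \<in> sets M"
  shows "(LINT x:X|M. K Y x) = (LINT p:X \<times> Y|NN. W p)"
proof -
  let ?f = "\<lambda>p. indicator (X \<times> Y) p *\<^sub>R W p"
  have "integrable NN ?f" using set_integrable_NN[of "X \<times> Y"] X Y by (simp add: set_integrable_def)
  then have "(LINT p:X \<times> Y|NN. W p) = (\<integral>x. (\<integral>y. ?f (x, y) \<partial>M) \<partial>M)"
    unfolding set_lebesgue_integral_def by (rule MM.integral_fst'[symmetric])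
  also have "\<dots> = (LINT x:X|M. K Y x)"
    unfolding K_def set_lebesgue_integral_def by (simp add: indicator_times mult.assoc)
  finally show ?thesis by simp
qed

lemma K_integrable:
  assumes Y: "Y \<in> sets M"
  shows "integrable M (K Y)"
proof -
  let ?f = "\<lambda>p. indicator (space M \<times> Y) p *\<^sub>R W p"
  have "integrable NN ?f" using set_integrable_NN[of "space M \<times> Y"] Y by (simp add: set_integrable_def)
  then have "integrable M (\<lambda>x. \<integral>y. ?f (x, y) \<partial>M)" by (rule MM.integrable_fst')
  also have "integrable M (\<lambda>x. \<integral>y. ?f (x, y) \<partial>M) \<longleftrightarrow> integrable M (K Y)"
    by (intro Bochner_Integration.integrable_cong) (auto simp: K_def set_lebesgue_integral_def indicator_times)
  finally show ?thesis .
qed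

lemma sym_set_integral:
  fixes f :: "'a \<times> 'a \<Rightarrow> real"
  assumes f: "f \<in> borel_measurable NN" and sym: "\<And>x y. x \<in> space M \<Longrightarrow> y \<in> space M \<Longrightarrow> f (x, y) = f (y, x)"
    and XY: "X \<in> sets M" "Y \<in> sets M"
  shows "(LINT p:X \<times> Y|NN. f p) = (LINT p:Y \<times> X|NN. f p)"
proof -
  note f[measurable] XY[measurable]
  have "(LINT p:X \<times> Y|NN. f p) = (\<integral>(x, y). indicator (X \<times> Y) (y, x) *\<^sub>R f (y, x) \<partial>NN)"
    unfolding set_lebesgue_integral_def by (rule MM.integral_product_swap[symmetric]) measurable
  also have "\<dots> = (LINT p:Y \<times> X|NN. f p)"
    unfolding set_lebesgue_integral_def
    by (intro Bochner_Integration.integral_cong) (auto simp: sym indicator_times space_pair_measure)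
  finally show ?thesis .
qed

section \<open>The averaged graphex: kernel, degree and total mass\<close>

context
  fixes A P
  assumes P: "finite_subspace_partition M A P"
begin

lemma part_facts:
  shows parts_block_family: "block_family M P" and prod_parts_block_family: "block_family NN (prod_blocks P)" and carrier_sets: "A \<in> sets M"
    and Union_parts: "\<Union>P = A" and part_sets: "X \<in> P \<Longrightarrow> X \<in> sets M"
  using P finite_subspace_partition_block_family[OF P] prod_blocks_family
  by (auto simp: finite_subspace_partition_def partition_on_def)

lemma avg_kernel: "kernel (graphex_average M A P G) x y = block_avg NN (prod_blocks P) W (x, y)"
  unfolding block_avg_prod_blocks[OF P] by (simp add: graphex_average_def W_def[abs_def])

lemma avg_star: "star (graphex_average M A P G) x = block_avg M P (\<lambda>x. star G x + K (space M - A) x) x"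
  unfolding block_avg_def by (simp add: graphex_average_def W_def K_def)

lemma avg_kernel_sym: "block_avg NN (prod_blocks P) W (x, y) = block_avg NN (prod_blocks P) W (y, x)"
proof -
  have "(LINT p:X \<times> Y|NN. W p) = (LINT p:Y \<times> X|NN. W p)" if "X \<in> P" "Y \<in> P" for X Y
    by (rule sym_set_integral[OF W_measurable W_sym]) (use that part_sets in auto)
  then show ?thesis
    unfolding block_avg_prod_blocks[OF P]
    by (subst sum.swap) (intro sum.cong refl, simp add: mult.commute)
qed

text \<open>A row of the averaged kernel integrates to the average of the degree into
  \<open>A\<close>. The degree into the complement was moved into the star part by the averaging, so
  the two together are the average of the full degree.\<close>

lemma avg_degree: "graphex_degree M (graphex_average M A P G) x = block_avg M P F x"
proof -
  have Ac: "space M - A \<in> sets M" using carrier_sets by auto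
  \<comment> \<open>For parts of positive measure the factor \<open>measure M Y\<close> cancels; for
    null parts both sides vanish.\<close>
  have null: "(LINT p:X \<times> Y|NN. W p) = 0" if "X \<in> P" "Y \<in> P" "measure M Y = 0" for X Y
  proof (rule set_lebesgue_integral_null)
    show "X \<times> Y \<in> sets NN" "emeasure NN (X \<times> Y) < \<infinity>"
      using that parts_block_family emeasure_Times_finite by (auto simp: block_family_def)
    show "measure NN (X \<times> Y) = 0" using that part_sets by (simp add: measure_Times)
  qed
  have Y: "Y \<in> sets M" "emeasure M Y < \<infinity>" if "Y \<in> P" for Y using that parts_block_family by (auto simp: block_family_def)
  have sumY: "(\<Sum>Y\<in>P. LINT p:X \<times> Y|NN. W p) = (LINT p:X \<times> A|NN. W p)" if X: "X \<in> P" for X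
  proof -
    have disj: "AE p in NN. p \<in> X \<times> Y \<and> p \<in> X \<times> Y' \<longrightarrow> Y = Y'" if "Y \<in> P" "Y' \<in> P" for Y Y'
      using parts_block_family that unfolding block_family_def disjoint_def by (intro AE_I2) blast
    have "(LINT p:(\<Union>Y\<in>P. X \<times> Y)|NN. W p) = (\<Sum>Y\<in>P. LINT p:X \<times> Y|NN. W p)"
      by (rule set_integral_finite_UN_AE[OF _ disj])
         (use parts_block_family X part_sets set_integrable_NN in \<open>auto simp: block_family_def\<close>)
    moreover have "(\<Union>Y\<in>P. X \<times> Y) = X \<times> A" using Union_parts by auto
    ultimately show ?thesis by simp
  qed
  have "(\<integral>y. block_avg NN (prod_blocks P) W (x, y) \<partial>M) =
      (\<Sum>X\<in>P. \<Sum>Y\<in>P. indicator X x * measure M Y * ((LINT p:X \<times> Y|NN. W p) / (measure M X * measure M Y)))"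
  proof -
    have i: "integrable M (\<lambda>y. indicator X x * indicator Y y * ((LINT p:X \<times> Y|NN. W p) / (measure M X * measure M Y)))"
      if "Y \<in> P" for X Y
      using Y[OF that] by (intro integrable_mult_left integrable_mult_right integrable_real_indicator) auto
    show ?thesis
      unfolding block_avg_prod_blocks[OF P]
      using Y by (simp add: Bochner_Integration.integral_sum i Int_absorb2 sets.sets_into_space)
  qed
  also have "\<dots> = (\<Sum>X\<in>P. indicator X x * ((LINT p:X \<times> A|NN. W p) / measure M X))"
  proof (intro sum.cong refl)
    fix X assume X: "X \<in> P"
    have "(\<Sum>Y\<in>P. indicator X x * measure M Y * ((LINT p:X \<times> Y|NN. W p) / (measure M X * measure M Y))) =
        (\<Sum>Y\<in>P. indicator X x * ((LINT p:X \<times> Y|NN. W p) / measure M X))"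
    proof (intro sum.cong refl)
      fix Y assume "Y \<in> P"
      then show "indicator X x * measure M Y * ((LINT p:X \<times> Y|NN. W p) / (measure M X * measure M Y)) =
          indicator X x * ((LINT p:X \<times> Y|NN. W p) / measure M X)"
        using null[OF X] by (cases "measure M Y = 0") auto
    qed
    also have "\<dots> = indicator X x * ((LINT p:X \<times> A|NN. W p) / measure M X)"
      by (simp add: sumY[OF X, symmetric] sum_distrib_left sum_divide_distrib)
    finally show "(\<Sum>Y\<in>P. indicator X x * measure M Y * ((LINT p:X \<times> Y|NN. W p) / (measure M X * measure M Y))) =
        indicator X x * ((LINT p:X \<times> A|NN. W p) / measure M X)" .
  qed
  also have "\<dots> = block_avg M P (K A) x"
    unfolding block_avg_def using part_sets carrier_sets by (intro sum.cong) (auto simp: K_Fubini)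
  finally have 1: "(\<integral>y. block_avg NN (prod_blocks P) W (x, y) \<partial>M) = block_avg M P (K A) x" .
  have "graphex_degree M (graphex_average M A P G) x =
      block_avg M P (K A) x + block_avg M P (\<lambda>x. star G x + K (space M - A) x) x"
    unfolding graphex_degree_def avg_kernel avg_star 1 ..
  also have "\<dots> = block_avg M P (\<lambda>x. K A x + (star G x + K (space M - A) x)) x"
    by (rule block_avg_add[OF parts_block_family]) (use K_integrable carrier_sets Ac S_integrable in auto)
  also have "\<dots> = block_avg M P F x"
    unfolding block_avg_def
  proof (intro sum.cong refl)
    fix X assume X: "X \<in> P"
    have "(LINT x:X|M. K A x + (star G x + K (space M - A) x)) = (LINT x:X|M. F x)"
    proof (rule set_lebesgue_integral_cong_AE)
      show "X \<in> sets M" by (rule part_sets[OF X])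
      \<comment> \<open>Only almost every row is integrable, so the split into \<open>A\<close> and
        its complement holds almost everywhere.\<close>
      show "AE x in M. x \<in> X \<longrightarrow> K A x + (star G x + K (space M - A) x) = F x"
        using row_integrable
      proof eventually_elim
        case (elim x)
        have si: "set_integrable M Z (\<lambda>y. W (x, y))" if "Z \<in> sets M" for Z
          unfolding set_integrable_def by (rule integrable_mult_indicator[OF that elim])
        have "K A x + K (space M - A) x = (LINT y:A \<union> (space M - A)|M. W (x, y))"
          unfolding K_def by (rule set_integral_Un[symmetric, OF _ si si]) (use carrier_sets in auto)
        also have "A \<union> (space M - A) = space M" using sets.sets_into_space[OF carrier_sets] by auto
        also have "(LINT y:space M|M. W (x, y)) = (\<integral>y. W (x, y) \<partial>M)" by (rule set_integral_space[OF elim])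
        finally show ?case by (simp add: degree_eq)
      qed
    qed (use K_integrable carrier_sets Ac in auto)
    then show "indicator X x * ((LINT x:X|M. K A x + (star G x + K (space M - A) x)) / measure M X) =
        indicator X x * ((LINT x:X|M. F x) / measure M X)" by simp
  qed
  finally show ?thesis .
qed

text \<open>The kernel of the average keeps the mass of \<open>A x A\<close>. The two mixed
  rectangles have equal mass by symmetry and go into the star part, which is counted twice; the
  square of the complement goes into the isolated part, where \<open>1/2\<close> offsets the double
  count.\<close>

lemma avg_rho: "graphex_rho M (graphex_average M A P G) = graphex_rho M G"
proof -
  let ?A = "space M - A"
  note As = carrier_sets
  have Ac: "?A \<in> sets M" using As by auto
  have AU: "A \<union> ?A = space M" using sets.sets_into_space[OF As] by auto
  let ?w = "\<lambda>X Y. LINT p:X \<times> Y|NN. W p"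
  have split2: "?w X (space M) = ?w X A + ?w X ?A" if "X \<in> sets M" for X
  proof -
    have "?w X A + ?w X ?A = (LINT p:X \<times> A \<union> X \<times> ?A|NN. W p)"
      by (rule set_integral_Un[symmetric, OF _ set_integrable_NN set_integrable_NN]) (use that As Ac in auto)
    also have "X \<times> A \<union> X \<times> ?A = X \<times> space M" using AU by auto
    finally show ?thesis by simp
  qed
  have split1: "?w (space M) Y = ?w A Y + ?w ?A Y" if "Y \<in> sets M" for Y
  proof -
    have "?w A Y + ?w ?A Y = (LINT p:A \<times> Y \<union> ?A \<times> Y|NN. W p)"
      by (rule set_integral_Un[symmetric, OF _ set_integrable_NN set_integrable_NN]) (use that As Ac in auto)
    also have "A \<times> Y \<union> ?A \<times> Y = space M \<times> Y" using AU by auto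
    finally show ?thesis by simp
  qed
  have "(\<integral>p. W p \<partial>NN) = ?w (space M) (space M)"
    using set_integral_space[OF W_integrable] by (simp add: space_pair_measure)
  also have "\<dots> = ?w A A + ?w A ?A + (?w ?A A + ?w ?A ?A)"
    using split1[of "space M"] split2[OF As] split2[OF Ac] by simp
  also have "?w ?A A = ?w A ?A" by (rule sym_set_integral[OF W_measurable W_sym Ac As])
  finally have W_split: "(\<integral>p. W p \<partial>NN) = ?w A A + 2 * ?w A ?A + ?w ?A ?A" by simp
  have S: "set_integrable M Z (star G)" if "Z \<in> sets M" for Z
    unfolding set_integrable_def by (rule integrable_mult_indicator[OF that S_integrable])
  have S_split: "(\<integral>x. star G x \<partial>M) = (LINT x:A|M. star G x) + (LINT x:?A|M. star G x)"
    using set_integral_Un[OF _ S[OF As] S[OF Ac]] AU set_integral_space[OF S_integrable] by simp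
  have kern: "(\<integral>p. kernel (graphex_average M A P G) (fst p) (snd p) \<partial>NN) = ?w A A"
    using integral_block_avg[OF prod_parts_block_family W_integrable] unfolding Union_prod_blocks Union_parts avg_kernel by simp
  have Kset: "set_integrable M A (K ?A)"
    unfolding set_integrable_def by (rule integrable_mult_indicator[OF As K_integrable[OF Ac]])
  have "(\<integral>x. star (graphex_average M A P G) x \<partial>M) = (LINT x:A|M. star G x + K ?A x)"
    using integral_block_avg[OF parts_block_family, of "\<lambda>x. star G x + K ?A x"] S_integrable K_integrable[OF Ac]
    unfolding avg_star Union_parts by simp
  also have "\<dots> = (LINT x:A|M. star G x) + ?w A ?A"
    using set_integral_add[OF S[OF As] Kset] K_Fubini[OF As Ac] by simp
  finally have star: "(\<integral>x. star (graphex_average M A P G) x \<partial>M) = (LINT x:A|M. star G x) + ?w A ?A" .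
  have iso: "isolated (graphex_average M A P G) = 1 / 2 * ?w ?A ?A + (LINT x:?A|M. star G x) + isolated G"
    by (simp add: graphex_average_def W_def)
  show ?thesis
    unfolding graphex_rho_def kern star iso S_split W_def[symmetric] W_split by simp
qed

end

end

section \<open>Cutting the kernel\<close>

text \<open>With \<open>\<alpha> = u/\<surd>(st)\<close>, \<open>\<beta> = v/s\<close>, \<open>c = m/\<surd>(st)\<close> this maximizes the gain over symmetric step functions
  \<open>k x x\<^sup>T + l (x y\<^sup>T + y x\<^sup>T)\<close> for unit vectors with \<open>\<langle>x, y\<rangle> = c\<close>; the optimum is
  \<open>\<beta>\<^sup>2 + 2 (\<alpha> - c \<beta>)\<^sup>2 / (1 - c\<^sup>2)\<close>, which is smallest at \<open>c = \<beta>/\<alpha>\<close>.\<close>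

lemma symmetric_gain:
  fixes s t m u v :: real
  assumes s: "0 < s" and t: "0 < t" and m: "0 \<le> m" "m\<^sup>2 \<le> s * t"
    and uv: "(v / s)\<^sup>2 < u\<^sup>2 / (s * t)"
  obtains \<kappa> \<nu> where "2 * (u\<^sup>2 / (s * t)) - (v / s)\<^sup>2 \<le>
    2 * (\<kappa> * v + 2 * (\<nu> * u)) -
    (\<kappa>\<^sup>2 * s\<^sup>2 + 2 * (\<nu>\<^sup>2 * (s * t)) + 2 * (\<nu>\<^sup>2 * m\<^sup>2) + 4 * (\<kappa> * \<nu> * (s * m)))"
proof -
  define r where "r = sqrt (s * t)"
  define \<alpha> where "\<alpha> = u / r"
  define \<beta> where "\<beta> = v / s"
  define c where "c = m / r"
  have r: "0 < r" "r\<^sup>2 = s * t" using s t by (auto simp: r_def)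
  have \<alpha>2: "\<alpha>\<^sup>2 = u\<^sup>2 / (s * t)" by (simp add: \<alpha>_def power_divide r(2))
  have lt: "\<beta>\<^sup>2 < \<alpha>\<^sup>2" using uv by (simp add: \<alpha>2 \<beta>_def)
  have "m \<le> r" using m(2) real_le_rsqrt r_def by blast
  then have c: "0 \<le> c" "c \<le> 1" using m r by (auto simp: c_def)
  have "\<exists>l. 2 * \<alpha>\<^sup>2 - \<beta>\<^sup>2 \<le> 4 * l * (\<alpha> - c * \<beta>) + \<beta>\<^sup>2 - 2 * l\<^sup>2 * (1 - c\<^sup>2)"
  proof (cases "c = 1")
    \<comment> \<open>The quadratic term in \<open>l\<close> disappears while the slope
      \<open>\<alpha> - \<beta>\<close> does not, so any gain is attainable; this \<open>l\<close>
      makes the linear term \<open>2 * \<alpha>\<^sup>2\<close>.\<close>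
    case True
    have "\<alpha> \<noteq> \<beta>" using lt by auto
    then have "4 * (\<alpha>\<^sup>2 / (2 * (\<alpha> - \<beta>))) * (\<alpha> - \<beta>) = 2 * \<alpha>\<^sup>2" by (simp add: field_simps)
    then show ?thesis using True by (intro exI[of _ "\<alpha>\<^sup>2 / (2 * (\<alpha> - \<beta>))"]) simp
  next
    case False
    then have "c < 1" using c by simp
    then have c2: "0 < 1 - c\<^sup>2" using c by (simp add: power_less_one_iff abs_square_less_1)
    define l where "l = (\<alpha> - c * \<beta>) / (1 - c\<^sup>2)"
    \<comment> \<open>The perfect square shows that the optimal gain is smallest at
      \<open>c = \<beta> / \<alpha>\<close>; here \<open>l\<close> is the maximizer.\<close>
    have le: "(\<alpha> - c * \<beta>)\<^sup>2 - (1 - c\<^sup>2) * (\<alpha>\<^sup>2 - \<beta>\<^sup>2) = (c * \<alpha> - \<beta>)\<^sup>2"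
      by (simp add: power2_eq_square algebra_simps)
    have "0 \<le> (c * \<alpha> - \<beta>)\<^sup>2" by simp
    then have "(1 - c\<^sup>2) * (\<alpha>\<^sup>2 - \<beta>\<^sup>2) \<le> (\<alpha> - c * \<beta>)\<^sup>2" using le by linarith
    then have "\<alpha>\<^sup>2 - \<beta>\<^sup>2 \<le> (\<alpha> - c * \<beta>)\<^sup>2 / (1 - c\<^sup>2)" using c2 by (simp add: pos_le_divide_eq mult.commute)
    moreover have "l * (\<alpha> - c * \<beta>) = (\<alpha> - c * \<beta>)\<^sup>2 / (1 - c\<^sup>2)"
      "l\<^sup>2 * (1 - c\<^sup>2) = (\<alpha> - c * \<beta>)\<^sup>2 / (1 - c\<^sup>2)"
      using c2 by (simp_all add: l_def power2_eq_square)
    ultimately show ?thesis by (intro exI[of _ l]) simp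
  qed
  then obtain l where l: "2 * \<alpha>\<^sup>2 - \<beta>\<^sup>2 \<le> 4 * l * (\<alpha> - c * \<beta>) + \<beta>\<^sup>2 - 2 * l\<^sup>2 * (1 - c\<^sup>2)" ..
  \<comment> \<open>The maximizer in the coefficient of the \<open>S x S\<close> term once
    \<open>l\<close> is fixed.\<close>
  define k where "k = \<beta> - 2 * l * c"
  have k: "4 * l * (\<alpha> - c * \<beta>) + \<beta>\<^sup>2 - 2 * l\<^sup>2 * (1 - c\<^sup>2) =
      2 * (k * \<beta> + 2 * (l * \<alpha>)) - (k\<^sup>2 + 2 * l\<^sup>2 + 2 * (l\<^sup>2 * c\<^sup>2) + 4 * (k * l * c))"
    unfolding k_def by (simp add: power2_eq_square algebra_simps)
  have eqs: "(k / s) * v = k * \<beta>" "(l / r) * u = l * \<alpha>" "(k / s)\<^sup>2 * s\<^sup>2 = k\<^sup>2"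
    "(l / r)\<^sup>2 * (s * t) = l\<^sup>2" "(l / r)\<^sup>2 * m\<^sup>2 = l\<^sup>2 * c\<^sup>2" "(k / s) * (l / r) * (s * m) = k * l * c"
    using s r(1) unfolding r(2)[symmetric]
    by (simp_all add: \<beta>_def \<alpha>_def c_def power_divide)
  have "2 * (u\<^sup>2 / (s * t)) - (v / s)\<^sup>2 \<le>
    2 * ((k / s) * v + 2 * ((l / r) * u)) -
    ((k / s)\<^sup>2 * s\<^sup>2 + 2 * ((l / r)\<^sup>2 * (s * t)) + 2 * ((l / r)\<^sup>2 * m\<^sup>2) + 4 * ((k / s) * (l / r) * (s * m)))"
    unfolding \<alpha>2[symmetric] \<beta>_def[symmetric] eqs using l k by linarith
  then show thesis by (rule that)
qed

section \<open>The kernel defect and its decrease under cuts\<close>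

context bounded_graphex
begin

abbreviation WP :: "'a set set \<Rightarrow> 'a \<times> 'a \<Rightarrow> real" where "WP P \<equiv> block_avg NN (prod_blocks P) W"

definition defect :: "'a set set \<Rightarrow> real" where "defect P = (\<integral>p. (W p - WP P p)\<^sup>2 \<partial>NN)"

lemma step_on_refined_WP:
  assumes P: "finite_subspace_partition M A P" and P': "finite_subspace_partition M A' P'"
    and r: "block_refines P' P"
  shows "step_on (space NN) (prod_blocks P') (WP P)"
proof (rule step_on_refine[OF step_on_block_avg[OF prod_parts_block_family[OF P]] prod_blocks_refines[OF r]])
  fix Z assume "Z \<in> prod_blocks P'"
  then show "Z \<subseteq> space NN"
    using part_sets[OF P'] sets.sets_into_space by (fastforce simp: prod_blocks_def space_pair_measure)
qed

lemma deviation_integrable: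
  assumes P: "finite_subspace_partition M A P"
  shows "integrable NN (\<lambda>p. W p - WP P p)" "integrable NN (\<lambda>p. (W p - WP P p)\<^sup>2)"
  using W_integrable block_avg_integrable[OF prod_parts_block_family[OF P]]
    square_integrable_diff[OF W_measurable block_avg_measurable[OF prod_parts_block_family[OF P]] Wb.F_square(1) block_avg_square_integrable[OF prod_parts_block_family[OF P]]]
  by auto

lemma defect_le: "finite_subspace_partition M A P \<Longrightarrow> defect P \<le> B * C"
  using block_avg_l2_contraction[OF prod_parts_block_family W_integrable Wb.F_square(1), of A P] Wb.F_square(2)
  by (simp add: defect_def mult.commute)

lemma defect_nonneg: "0 \<le> defect P"
  by (simp add: defect_def)

text \<open>The old average plus \<open>g\<close> competes with the new average in the best
  approximation property, so the new average never has to be computed. Any step function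
  \<open>g\<close> gives a lower bound for the gain.\<close>

lemma defect_refine:
  assumes P: "finite_subspace_partition M A P" and P': "finite_subspace_partition M A' P'"
    and r: "block_refines P' P" and g: "step_on (space NN) (prod_blocks P') g"
  shows "defect P' \<le> defect P - (2 * (\<integral>p. (W p - WP P p) * g p \<partial>NN) - (\<integral>p. (g p)\<^sup>2 \<partial>NN))"
proof -
  note U = deviation_integrable[OF P]
  have i: "integrable NN (\<lambda>p. (W p - WP P p) * g p)"
    by (rule step_on_orthogonal(1)[OF prod_parts_block_family[OF P'] U(1) g])
  have g2: "integrable NN (\<lambda>p. (g p)\<^sup>2)" by (rule step_on_integrable(2)[OF prod_parts_block_family[OF P'] g])
  have "step_on (space NN) (prod_blocks P') (\<lambda>p. WP P p + g p)"
    by (rule step_on_add[OF step_on_refined_WP[OF P P' r] g])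
  then have "defect P' \<le> (\<integral>p. (W p - (WP P p + g p))\<^sup>2 \<partial>NN)"
    unfolding defect_def
    by (rule block_avg_best_approx(2)[OF prod_parts_block_family[OF P'] W_integrable Wb.F_square(1)])
  also have "\<dots> = (\<integral>p. (W p - WP P p)\<^sup>2 - (2 * ((W p - WP P p) * g p) - (g p)\<^sup>2) \<partial>NN)"
    by (intro Bochner_Integration.integral_cong) (auto simp: power2_eq_square algebra_simps)
  also have "\<dots> = defect P - (2 * (\<integral>p. (W p - WP P p) * g p \<partial>NN) - (\<integral>p. (g p)\<^sup>2 \<partial>NN))"
    unfolding defect_def using U i g2 by simp
  finally show ?thesis .
qed

lemma row_weight_bound:
  assumes \<phi>: "integrable M \<phi>" "\<And>x. 0 \<le> \<phi> x" "\<And>x. \<phi> x \<le> 1"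
  shows "integrable NN (\<lambda>p. \<bar>W p\<bar> * \<phi> (fst p))" "(\<integral>p. \<bar>W p\<bar> * \<phi> (fst p) \<partial>NN) \<le> D * (\<integral>x. \<phi> x \<partial>M)"
proof -
  have \<phi>m[measurable]: "\<phi> \<in> borel_measurable M" using \<phi> by auto
  have aW: "integrable NN (\<lambda>p. \<bar>W p\<bar>)" using W_integrable by auto
  show i: "integrable NN (\<lambda>p. \<bar>W p\<bar> * \<phi> (fst p))"
    by (rule Bochner_Integration.integrable_bound[OF aW])
       (use \<phi> in \<open>auto simp: abs_mult mult_left_le\<close>)
  have "(\<integral>p. \<bar>W p\<bar> * \<phi> (fst p) \<partial>NN) = (\<integral>x. (\<integral>y. \<bar>W (x, y)\<bar> \<partial>M) * \<phi> x \<partial>M)"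
    using MM.integral_fst'[OF i] by simp
  also have "\<dots> \<le> (\<integral>x. D * \<phi> x \<partial>M)"
  proof (rule integral_mono_AE)
    show "integrable M (\<lambda>x. (\<integral>y. \<bar>W (x, y)\<bar> \<partial>M) * \<phi> x)"
      using MM.integrable_fst'[OF i] by simp
    show "AE x in M. (\<integral>y. \<bar>W (x, y)\<bar> \<partial>M) * \<phi> x \<le> D * \<phi> x"
      using abs_degree_bound
    proof eventually_elim
      case (elim x)
      then have "(\<integral>y. \<bar>W (x, y)\<bar> \<partial>M) \<le> D" using abs_ge_zero[of "star G x"] by linarith
      then show ?case using \<phi>(2) by (rule mult_right_mono)
    qed
  qed (use \<phi> in auto)
  finally show "(\<integral>p. \<bar>W p\<bar> * \<phi> (fst p) \<partial>NN) \<le> D * (\<integral>x. \<phi> x \<partial>M)" by simp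
qed

text \<open>Covers with one statement the indicator of \<open>S x T\<close> and its block average,
  both dominated by a weight in the first coordinate.\<close>

lemma weighted_bound:
  assumes a: "a \<in> borel_measurable NN" "\<And>p. 0 \<le> a p" "\<And>p. a p \<le> \<phi> (fst p)"
    and \<phi>: "integrable M \<phi>" "\<And>x. 0 \<le> \<phi> x" "\<And>x. \<phi> x \<le> 1"
  shows "\<bar>\<integral>p. W p * a p \<partial>NN\<bar> \<le> C" "\<bar>\<integral>p. W p * a p \<partial>NN\<bar> \<le> D * (\<integral>x. \<phi> x \<partial>M)"
proof -
  note a(1)[measurable]
  have aW: "integrable NN (\<lambda>p. \<bar>W p\<bar>)" using W_integrable by auto
  have le1: "a p \<le> 1" for p using a(3) \<phi>(3) order_trans by blast
  have i: "integrable NN (\<lambda>p. \<bar>W p\<bar> * a p)"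
    by (rule Bochner_Integration.integrable_bound[OF aW])
       (use a le1 in \<open>auto simp: abs_mult mult_left_le\<close>)
  have "\<bar>\<integral>p. W p * a p \<partial>NN\<bar> \<le> (\<integral>p. \<bar>W p * a p\<bar> \<partial>NN)" by (rule integral_abs_bound)
  also have "\<dots> = (\<integral>p. \<bar>W p\<bar> * a p \<partial>NN)" using a(2) by (simp add: abs_mult)
  finally have le: "\<bar>\<integral>p. W p * a p \<partial>NN\<bar> \<le> (\<integral>p. \<bar>W p\<bar> * a p \<partial>NN)" .
  have "(\<integral>p. \<bar>W p\<bar> * a p \<partial>NN) \<le> (\<integral>p. \<bar>W p\<bar> \<partial>NN)"
    by (rule integral_mono[OF i aW]) (use le1 in \<open>auto simp: mult_left_le\<close>)
  then show "\<bar>\<integral>p. W p * a p \<partial>NN\<bar> \<le> C" using le W_norm_le by linarith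
  have "(\<integral>p. \<bar>W p\<bar> * a p \<partial>NN) \<le> (\<integral>p. \<bar>W p\<bar> * \<phi> (fst p) \<partial>NN)"
    by (rule integral_mono[OF i row_weight_bound(1)[OF \<phi>]]) (use a(3) in \<open>auto intro: mult_left_mono\<close>)
  then show "\<bar>\<integral>p. W p * a p \<partial>NN\<bar> \<le> D * (\<integral>x. \<phi> x \<partial>M)" using le row_weight_bound(2)[OF \<phi>] by linarith
qed

text \<open>By self-adjointness the averaged kernel on \<open>S x T\<close> is \<open>W\<close>
  integrated against the averaged indicator. That average is a product of two ratios of measures,
  hence at most the average of the indicator of \<open>S\<close>, whose integral is at most the
  measure of \<open>S\<close>. So \<open>W\<close> and its average obey the same bounds, whence the
  factor 2.\<close>

lemma cut_bounds:
  assumes P: "finite_subspace_partition M A P"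
    and S: "S \<in> sets M" "emeasure M S < \<infinity>" and T: "T \<in> sets M" "emeasure M T < \<infinity>"
  shows "\<bar>LINT p:S \<times> T|NN. W p - WP P p\<bar> \<le> 2 * C"
    and "\<bar>LINT p:S \<times> T|NN. W p - WP P p\<bar> \<le> 2 * (D * measure M S)"
proof -
  have ST: "S \<times> T \<in> sets NN" "emeasure NN (S \<times> T) < \<infinity>" using S T emeasure_Times_finite by auto
  let ?s = "indicator S :: 'a \<Rightarrow> real"
  let ?a = "block_avg NN (prod_blocks P) (indicator (S \<times> T))"
  let ?\<phi> = "block_avg M P (indicator S)"
  have iS: "integrable M ?s" using S by simp
  have iST: "integrable NN (indicator (S \<times> T) :: _ \<Rightarrow> real)" using ST by simp
  have si: "set_integrable NN (S \<times> T) W" "set_integrable NN (S \<times> T) (WP P)"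
    unfolding set_integrable_def
    by (intro integrable_mult_indicator ST W_integrable block_avg_integrable[OF prod_parts_block_family[OF P]])+
  have 1: "(LINT p:S \<times> T|NN. W p) = (\<integral>p. W p * indicator (S \<times> T) p \<partial>NN)"
    by (simp add: set_lebesgue_integral_def mult.commute)
  have "(LINT p:S \<times> T|NN. WP P p) = (\<integral>p. indicator (S \<times> T) p * WP P p \<partial>NN)"
    by (simp add: set_lebesgue_integral_def)
  also have "\<dots> = (\<integral>p. W p * ?a p \<partial>NN)"
    by (rule block_avg_self_adjoint[OF prod_parts_block_family[OF P] iST W_integrable])
  finally have 2: "(LINT p:S \<times> T|NN. WP P p) = (\<integral>p. W p * ?a p \<partial>NN)" .
  have a0: "0 \<le> ?a p" for p by (rule block_avg_indicator_bounds(1)[OF prod_parts_block_family[OF P] ST(1)])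
  have am: "?a \<in> borel_measurable NN" by (rule block_avg_measurable[OF prod_parts_block_family[OF P]])
  have \<phi>: "0 \<le> ?\<phi> x" "?\<phi> x \<le> 1" for x using block_avg_indicator_bounds[OF parts_block_family[OF P] S(1)] by auto
  have i\<phi>: "integrable M ?\<phi>" by (rule block_avg_integrable[OF parts_block_family[OF P]])
  have le: "?a p \<le> ?\<phi> (fst p)" for p
  proof (cases "p \<in> \<Union>(prod_blocks P)")
    case False
    then show ?thesis using \<phi>(1) by (simp add: block_avg_outside)
  next
    case True
    then obtain X Y where XY: "X \<in> P" "Y \<in> P" "p \<in> X \<times> Y" by (auto simp: prod_blocks_def)
    then have Z: "X \<times> Y \<in> prod_blocks P" by (auto simp: prod_blocks_def)
    have X: "X \<in> sets M" "emeasure M X < \<infinity>" and Y: "Y \<in> sets M" "emeasure M Y < \<infinity>"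
      using XY P by (auto simp: finite_subspace_partition_def)
    have int: "(LINT x:U|N. indicator V x) = measure N (U \<inter> V)" if "U \<in> sets N" "V \<in> sets N"
      for U V and N :: "'b measure"
      using that
      by (simp add: set_lebesgue_integral_def indicator_inter_arith[symmetric] Int_absorb2 sets.sets_into_space)
    have "?a p = measure NN ((X \<times> Y) \<inter> (S \<times> T)) / (measure M X * measure M Y)"
      unfolding block_avg_eq[OF prod_parts_block_family[OF P] Z XY(3)] using X Y ST by (simp add: int measure_Times)
    also have "(X \<times> Y) \<inter> (S \<times> T) = (X \<inter> S) \<times> (Y \<inter> T)" by auto
    also have "measure NN ((X \<inter> S) \<times> (Y \<inter> T)) = measure M (X \<inter> S) * measure M (Y \<inter> T)"
      using X Y S T by (simp add: measure_Times)
    also have "measure M (X \<inter> S) * measure M (Y \<inter> T) / (measure M X * measure M Y) =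
        (measure M (X \<inter> S) / measure M X) * (measure M (Y \<inter> T) / measure M Y)" by simp
    also have "\<dots> \<le> (measure M (X \<inter> S) / measure M X) * 1"
    proof (rule mult_left_mono)
      have "measure M (Y \<inter> T) \<le> measure M Y"
        by (rule measure_mono_fmeasurable) (use Y T in \<open>auto simp: fmeasurable_def\<close>)
      then show "measure M (Y \<inter> T) / measure M Y \<le> 1" by (simp add: divide_le_eq_1 less_le)
    qed simp
    also have "\<dots> = ?\<phi> (fst p)"
      using block_avg_eq[OF parts_block_family[OF P] XY(1), of "fst p" "indicator S"] XY(3) X S by (auto simp: int)
    finally show ?thesis .
  qed
  have "(\<integral>x. ?\<phi> x \<partial>M) = (LINT x:A|M. indicator S x)"
    using integral_block_avg[OF parts_block_family[OF P], of "indicator S"] S Union_parts[OF P] by simp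
  also have "\<dots> \<le> (\<integral>x. ?s x \<partial>M)"
    unfolding set_lebesgue_integral_def
    by (rule integral_mono[OF integrable_mult_indicator[OF carrier_sets[OF P] iS] iS]) (simp add: indicator_def)
  also have "\<dots> = measure M S" using S by (simp add: Int_absorb2 sets.sets_into_space)
  finally have "D * (\<integral>x. ?\<phi> x \<partial>M) \<le> D * measure M S" using BCD_nonneg by (intro mult_left_mono)
  note b2 = weighted_bound(1)[OF am a0 le i\<phi> \<phi>] order_trans[OF weighted_bound(2)[OF am a0 le i\<phi> \<phi>] this]
  have "(\<integral>x. ?s x \<partial>M) = measure M S" using S by (simp add: Int_absorb2 sets.sets_into_space)
  moreover have "\<bar>\<integral>p. W p * indicator (S \<times> T) p \<partial>NN\<bar> \<le> C"
    "\<bar>\<integral>p. W p * indicator (S \<times> T) p \<partial>NN\<bar> \<le> D * (\<integral>x. ?s x \<partial>M)"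
    using weighted_bound[of "indicator (S \<times> T)" ?s] S T by (auto simp: indicator_def)
  ultimately have b1: "\<bar>\<integral>p. W p * indicator (S \<times> T) p \<partial>NN\<bar> \<le> C"
    "\<bar>\<integral>p. W p * indicator (S \<times> T) p \<partial>NN\<bar> \<le> D * measure M S" by auto
  have "(LINT p:S \<times> T|NN. W p - WP P p) = (\<integral>p. W p * indicator (S \<times> T) p \<partial>NN) - (\<integral>p. W p * ?a p \<partial>NN)"
    using set_integral_diff(2)[OF si] 1 2 by simp
  then show "\<bar>LINT p:S \<times> T|NN. W p - WP P p\<bar> \<le> 2 * C"
    "\<bar>LINT p:S \<times> T|NN. W p - WP P p\<bar> \<le> 2 * (D * measure M S)"
    using b1 b2 by linarith+
qed

lemma deviation_swap:
  assumes P: "finite_subspace_partition M A P" and "S \<in> sets M" "T \<in> sets M"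
  shows "(LINT p:S \<times> T|NN. W p - WP P p) = (LINT p:T \<times> S|NN. W p - WP P p)"
  by (rule sym_set_integral)
     (use assms deviation_integrable(1)[OF P] W_sym avg_kernel_sym[OF P] in auto)

lemma cut_defect:
  assumes P: "finite_subspace_partition M A P" and e: "0 < e"
    and S: "S \<in> sets M" "emeasure M S < \<infinity>" "0 < measure M S"
    and T: "T \<in> sets M" "emeasure M T < \<infinity>" "0 < measure M T"
    and le: "defect P \<le> e\<^sup>2"
  shows "\<bar>LINT p:S \<times> T|NN. W p - WP P p\<bar> \<le> e * sqrt (measure M S * measure M T)"
  using set_integral_le_sqrt[OF deviation_integrable[OF P] le[unfolded defect_def], of "S \<times> T"]
    S T e emeasure_Times_finite by (simp add: measure_Times)

lemma integral_deviation_indicator: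
  "(\<integral>p. (W p - WP P p) * indicator Z p \<partial>NN) = (LINT p:Z|NN. W p - WP P p)"
  by (simp add: set_lebesgue_integral_def mult.commute)

lemma labelled_refinement:
  fixes l :: "'a \<Rightarrow> nat" and \<Phi> :: "nat \<Rightarrow> nat \<Rightarrow> real"
  assumes P: "finite_subspace_partition M A P"
    and l: "l \<in> measurable M (count_space UNIV)" "\<And>x. l x \<le> n"
    and em: "emeasure M {x\<in>space M. l x \<noteq> 0} \<le> ennreal c"
    and z: "\<And>i. \<Phi> 0 i = 0" "\<And>i. \<Phi> i 0 = 0"
    and g: "\<And>p. g p = \<Phi> (l (fst p)) (l (snd p))"
  obtains A' P' where "finite_subspace_partition M A' P'" "block_refines P' P"
    "real (card P') + 1 \<le> real (n + 1) * (real (card P) + 1)"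
    "emeasure M (A' - A) \<le> ennreal c"
    "defect P' \<le> defect P - (2 * (\<integral>p. (W p - WP P p) * g p \<partial>NN) - (\<integral>p. (g p)\<^sup>2 \<partial>NN))"
proof -
  obtain A' P' where P': "finite_subspace_partition M A' P'" "block_refines P' P"
    "card P' \<le> card P * card {..n} + card {1..n}" "A' = A \<union> {x\<in>space M - A. l x \<noteq> 0}"
    "emeasure M (A' - A) \<le> ennreal c" "step_on (space M) P' (\<lambda>x. real (l x))"
  proof (rule quantized_refinement[OF P l(1) _ _ _ _ em, of "{..n}" "{1..n}" real])
    show "l ` A \<subseteq> {..n}" using l(2) by auto
    have "l x = 0 \<or> l x \<in> {1..n}" for x using l(2)[of x] by auto
    then show "l ` (space M - A) \<subseteq> insert 0 {1..n}" by (intro image_subsetI) auto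
  qed simp_all
  have "real (card P') \<le> real (card P * card {..n} + card {1..n})" using P'(3) by (rule of_nat_mono)
  then have "real (card P') + 1 \<le> real (n + 1) * (real (card P) + 1)" by (simp add: algebra_simps)
  moreover have "step_on (space NN) (prod_blocks P') g"
    unfolding g space_pair_measure
  proof (rule step_on_prod_blocks)
    show "\<exists>i. \<forall>x\<in>X. l x = i" if "X \<in> P'" for X
      using P'(6) that unfolding step_on_def by (metis of_nat_eq_iff)
    show "l x = 0" if "x \<in> space M - \<Union>P'" for x
      using P'(6) that unfolding step_on_def by simp
  qed (use z in auto)
  then have "defect P' \<le> defect P - (2 * (\<integral>p. (W p - WP P p) * g p \<partial>NN) - (\<integral>p. (g p)\<^sup>2 \<partial>NN))"
    by (rule defect_refine[OF P P'(1,2)])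
  ultimately show thesis using that P'(1,2,5) by blast
qed

text \<open>If the square \<open>S \<times> S\<close> already carries half of the gain, splitting along \<open>S\<close> alone breaks even;
  otherwise splitting along both \<open>S\<close> and \<open>T\<close> gains half as much again as the usual energy increment.\<close>

lemma cut_step:
  assumes P: "finite_subspace_partition M A P" and e: "0 < e"
    and S: "S \<in> sets M" "emeasure M S < \<infinity>" "0 < measure M S"
    and T: "T \<in> sets M" "emeasure M T < \<infinity>" "0 < measure M T"
    and bad: "e * sqrt (measure M S * measure M T) < \<bar>LINT p:S \<times> T|NN. W p - WP P p\<bar>"
  obtains A' P' \<delta> where "finite_subspace_partition M A' P'" "block_refines P' P"
    "(\<delta> = 1 \<or> \<delta> = 2)" "real (card P') + 1 \<le> 2 ^ \<delta> * (real (card P) + 1)"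
    "defect P' \<le> defect P - (real \<delta> - 1 / 2) * e\<^sup>2"
    "emeasure M (A' - A) \<le> ennreal (real \<delta> * (4 * C * D / e\<^sup>2))"
proof -
  define U where "U p = W p - WP P p" for p
  define s where "s = measure M S"
  define t where "t = measure M T"
  define m where "m = measure M (S \<inter> T)"
  define u where "u = (LINT p:S \<times> T|NN. U p)"
  define v where "v = (LINT p:S \<times> S|NN. U p)"
  have st: "0 < s" "0 < t" using S T by (auto simp: s_def t_def)
  have u': "(LINT p:T \<times> S|NN. U p) = u" unfolding u_def U_def by (rule deviation_swap[OF P T(1) S(1)])
  have "e\<^sup>2 * (s * t) < u\<^sup>2"
  proof -
    have "(e * sqrt (s * t))\<^sup>2 < \<bar>u\<bar>\<^sup>2"
      using bad st e unfolding u_def U_def s_def t_def by (intro power_strict_mono) auto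
    then show ?thesis using st by (simp add: power_mult_distrib)
  qed
  then have u2: "e\<^sup>2 < u\<^sup>2 / (s * t)" using st by (simp add: pos_less_divide_eq)
  \<comment> \<open>The product of the two cut bounds is \<open>4 * C * D * x\<close>; comparing it
    with \<open>e^2 * x * y\<close> cancels one measure and bounds the other.\<close>
  have bound: "e\<^sup>2 * (x * y) < \<bar>w\<bar>\<^sup>2 \<Longrightarrow> \<bar>w\<bar> \<le> 2 * C \<Longrightarrow> \<bar>w\<bar> \<le> 2 * (D * x) \<Longrightarrow> 0 < x \<Longrightarrow> y \<le> 4 * C * D / e\<^sup>2"
    for x y w :: real
  proof -
    assume w: "e\<^sup>2 * (x * y) < \<bar>w\<bar>\<^sup>2" "\<bar>w\<bar> \<le> 2 * C" "\<bar>w\<bar> \<le> 2 * (D * x)" "0 < x"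
    have "\<bar>w\<bar>\<^sup>2 \<le> (2 * C) * (2 * (D * x))"
      unfolding power2_eq_square using w BCD_nonneg by (intro mult_mono) auto
    then have "x * (e\<^sup>2 * y) \<le> x * (4 * C * D)" using w(1) by (simp add: algebra_simps)
    then show ?thesis using w(4) e by (simp add: pos_le_divide_eq mult.commute)
  qed
  have "t \<le> 4 * C * D / e\<^sup>2"
    using bound[of s t u] \<open>e\<^sup>2 * (s * t) < u\<^sup>2\<close> cut_bounds[OF P S(1,2) T(1,2)] st
    by (simp add: u_def U_def s_def)
  then have emT: "emeasure M T \<le> ennreal (4 * C * D / e\<^sup>2)"
    unfolding t_def using T(2) by (simp add: emeasure_eq_ennreal_measure ennreal_leI)
  have "s \<le> 4 * C * D / e\<^sup>2"
    using bound[of t s u] \<open>e\<^sup>2 * (s * t) < u\<^sup>2\<close> cut_bounds[OF P T(1,2) S(1,2)] st u'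
    by (simp add: U_def t_def mult.commute)
  then have emS: "emeasure M S \<le> ennreal (4 * C * D / e\<^sup>2)"
    unfolding s_def using S(2) by (simp add: emeasure_eq_ennreal_measure ennreal_leI)
  have SM: "S \<subseteq> space M" "T \<subseteq> space M" by (rule sets.sets_into_space[OF S(1)], rule sets.sets_into_space[OF T(1)])
  show thesis
  proof (cases "e\<^sup>2 / 2 \<le> (v / s)\<^sup>2")
    case True
    define l where "l x = (if x \<in> S then 1 else 0 :: nat)" for x
    \<comment> \<open>The mean deviation over \<open>S x S\<close>, which is the best coefficient
      when only that square is used.\<close>
    define \<kappa> where "\<kappa> = v / s / s"
    define g where "g p = \<kappa> * indicator (S \<times> S) p" for p :: "'a \<times> 'a"
    have lm: "l \<in> measurable M (count_space UNIV)" unfolding l_def[abs_def] using S(1) by measurable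
    have "{x\<in>space M. l x \<noteq> 0} = S" using SM by (auto simp: l_def)
    then have em: "emeasure M {x\<in>space M. l x \<noteq> 0} \<le> ennreal (4 * C * D / e\<^sup>2)" using emS by simp
    have l1: "l x \<le> 1" for x by (simp add: l_def)
    obtain A' P' where P': "finite_subspace_partition M A' P'" "block_refines P' P"
      "real (card P') + 1 \<le> real (1 + 1) * (real (card P) + 1)"
      "emeasure M (A' - A) \<le> ennreal (4 * C * D / e\<^sup>2)"
      "defect P' \<le> defect P - (2 * (\<integral>p. U p * g p \<partial>NN) - (\<integral>p. (g p)\<^sup>2 \<partial>NN))"
      unfolding U_def
    proof (rule labelled_refinement[OF P lm l1 em])
      let ?\<Phi> = "\<lambda>(i :: nat) (j :: nat). \<kappa> * (of_bool (i = 1) * of_bool (j = 1))"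
      show "g p = ?\<Phi> (l (fst p)) (l (snd p))" for p
        by (cases p) (simp add: g_def l_def indicator_times)
      show "?\<Phi> 0 i = 0" "?\<Phi> i 0 = 0" for i by simp_all
    qed
    have "(\<integral>p. U p * g p \<partial>NN) = \<kappa> * v"
    proof -
      have "(\<integral>p. U p * g p \<partial>NN) = (\<integral>p. \<kappa> * (U p * indicator (S \<times> S) p) \<partial>NN)"
        by (intro Bochner_Integration.integral_cong) (auto simp: g_def)
      then show ?thesis using integral_deviation_indicator[of P "S \<times> S"] by (simp add: v_def U_def)
    qed
    moreover have "(\<integral>p. (g p)\<^sup>2 \<partial>NN) = \<kappa>\<^sup>2 * s\<^sup>2"
    proof -
      have "(\<integral>p. (g p)\<^sup>2 \<partial>NN) = (\<integral>p. \<kappa>\<^sup>2 * indicator (S \<times> S) p \<partial>NN)"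
        by (intro Bochner_Integration.integral_cong) (auto simp: g_def indicator_def power2_eq_square)
      also have "\<dots> = \<kappa>\<^sup>2 * measure NN (S \<times> S)"
        using S by (simp add: Int_absorb2 sets.sets_into_space)
      finally show ?thesis using S by (simp add: measure_Times s_def power2_eq_square)
    qed
    moreover have "2 * (\<kappa> * v) - \<kappa>\<^sup>2 * s\<^sup>2 = (v / s)\<^sup>2"
      using st by (simp add: \<kappa>_def power2_eq_square field_simps)
    ultimately have "defect P' \<le> defect P - (real 1 - 1 / 2) * e\<^sup>2" using P'(5) True by simp
    then show thesis using that[OF P'(1,2), of 1] P'(3,4) by simp
  next
    case False
    have ml: "m \<le> s" "m \<le> t" "0 \<le> m"
      unfolding m_def s_def t_def
      using S T by (auto intro!: measure_mono_fmeasurable simp: fmeasurable_def)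
    have m2: "m\<^sup>2 \<le> s * t" unfolding power2_eq_square using ml st by (intro mult_mono) auto
    have "0 < e\<^sup>2" using e by simp
    then have "e\<^sup>2 / 2 < e\<^sup>2" by simp
    then have "(v / s)\<^sup>2 < u\<^sup>2 / (s * t)" using False u2 by (meson not_le order.strict_trans)
    then obtain \<kappa> \<nu> where gain: "2 * (u\<^sup>2 / (s * t)) - (v / s)\<^sup>2 \<le>
        2 * (\<kappa> * v + 2 * (\<nu> * u)) -
        (\<kappa>\<^sup>2 * s\<^sup>2 + 2 * (\<nu>\<^sup>2 * (s * t)) + 2 * (\<nu>\<^sup>2 * m\<^sup>2) + 4 * (\<kappa> * \<nu> * (s * m)))"
      by (rule symmetric_gain[OF st ml(3) m2])
    \<comment> \<open>The two binary digits record membership in \<open>S\<close> and in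
      \<open>T\<close>, so 0 means in neither.\<close>
    define l where "l x = (if x \<in> S then 1 else 0) + (if x \<in> T then 2 else 0 :: nat)" for x
    define i\<^sub>S :: "nat \<Rightarrow> real" where "i\<^sub>S i = of_bool (i = 1 \<or> i = 3)" for i
    define i\<^sub>T :: "nat \<Rightarrow> real" where "i\<^sub>T i = of_bool (i = 2 \<or> i = 3)" for i
    define g where "g p = \<kappa> * indicator (S \<times> S) p + \<nu> * (indicator (S \<times> T) p + indicator (T \<times> S) p)" for p :: "'a \<times> 'a"
    have lm: "l \<in> measurable M (count_space UNIV)" unfolding l_def[abs_def] using S(1) T(1) by measurable
    have "{x\<in>space M. l x \<noteq> 0} = S \<union> T" using SM by (auto simp: l_def)
    then have "emeasure M {x\<in>space M. l x \<noteq> 0} \<le> emeasure M S + emeasure M T"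
      using emeasure_subadditive[OF S(1) T(1)] by simp
    also have "\<dots> \<le> ennreal (4 * C * D / e\<^sup>2) + ennreal (4 * C * D / e\<^sup>2)" by (rule add_mono[OF emS emT])
    also have "\<dots> = ennreal (2 * (4 * C * D / e\<^sup>2))"
      using BCD_nonneg by (simp add: ennreal_plus[symmetric] del: ennreal_plus)
    finally have em: "emeasure M {x\<in>space M. l x \<noteq> 0} \<le> ennreal (2 * (4 * C * D / e\<^sup>2))" .
    have l3: "l x \<le> 3" for x by (simp add: l_def)
    have iST: "i\<^sub>S (l x) = indicator S x" "i\<^sub>T (l x) = indicator T x" for x
      by (auto simp: i\<^sub>S_def i\<^sub>T_def l_def)
    obtain A' P' where P': "finite_subspace_partition M A' P'" "block_refines P' P"
      "real (card P') + 1 \<le> real (3 + 1) * (real (card P) + 1)"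
      "emeasure M (A' - A) \<le> ennreal (2 * (4 * C * D / e\<^sup>2))"
      "defect P' \<le> defect P - (2 * (\<integral>p. U p * g p \<partial>NN) - (\<integral>p. (g p)\<^sup>2 \<partial>NN))"
      unfolding U_def
    proof (rule labelled_refinement[OF P lm l3 em])
      let ?\<Phi> = "\<lambda>i j. \<kappa> * (i\<^sub>S i * i\<^sub>S j) + \<nu> * (i\<^sub>S i * i\<^sub>T j + i\<^sub>T i * i\<^sub>S j)"
      show "g p = ?\<Phi> (l (fst p)) (l (snd p))" for p
        unfolding iST g_def by (cases p) (simp add: indicator_times)
      show "?\<Phi> 0 i = 0" "?\<Phi> i 0 = 0" for i by (simp_all add: i\<^sub>S_def i\<^sub>T_def)
    qed
    have iU: "integrable NN (\<lambda>p. U p * indicator Z p)" if "Z \<in> sets NN" for Z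
      unfolding U_def using integrable_real_mult_indicator[OF that deviation_integrable(1)[OF P]] .
    have Ug: "(\<integral>p. U p * g p \<partial>NN) = \<kappa> * v + 2 * (\<nu> * u)"
    proof -
      have "(\<integral>p. U p * g p \<partial>NN) = (\<integral>p. \<kappa> * (U p * indicator (S \<times> S) p) +
          (\<nu> * (U p * indicator (S \<times> T) p) + \<nu> * (U p * indicator (T \<times> S) p)) \<partial>NN)"
        by (intro Bochner_Integration.integral_cong) (auto simp: g_def algebra_simps)
      also have "\<dots> = \<kappa> * v + (\<nu> * u + \<nu> * u)"
        using iU[of "S \<times> S"] iU[of "S \<times> T"] iU[of "T \<times> S"] S(1) T(1) u'
          integral_deviation_indicator[of P, folded U_def]
        by (simp add: v_def u_def)
      finally show ?thesis by simp
    qed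
    have iI: "integrable NN (indicator (X \<times> Y) :: _ \<Rightarrow> real)"
      "(\<integral>p. indicator (X \<times> Y) p \<partial>NN) = measure M X * measure M Y"
      if "X \<in> {S, T, S \<inter> T}" "Y \<in> {S, T, S \<inter> T}" for X Y
    proof -
      have XY: "Z \<in> sets M" "emeasure M Z < \<infinity>" if "Z \<in> {S, T, S \<inter> T}" for Z
        using that S T emeasure_mono[of "S \<inter> T" S M] by (auto intro: le_less_trans)
      show "integrable NN (indicator (X \<times> Y) :: _ \<Rightarrow> real)"
        using XY[OF that(1)] XY[OF that(2)] emeasure_Times_finite by simp
      show "(\<integral>p. indicator (X \<times> Y) p \<partial>NN) = measure M X * measure M Y"
        using XY[OF that(1)] XY[OF that(2)]
        by (simp add: measure_Times[symmetric] Int_absorb2 sets.sets_into_space del: measure_Times)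
    qed
    have g2: "(\<integral>p. (g p)\<^sup>2 \<partial>NN) = \<kappa>\<^sup>2 * s\<^sup>2 + 2 * (\<nu>\<^sup>2 * (s * t)) + 2 * (\<nu>\<^sup>2 * m\<^sup>2) + 4 * (\<kappa> * \<nu> * (s * m))"
    proof -
      \<comment> \<open>The cross terms produce rectangles with \<open>S \<inter> T\<close>:
        \<open>S x T\<close> and \<open>T x S\<close> meet in its square, and each meets
        \<open>S x S\<close> in a rectangle with side \<open>S\<close>.\<close>
      have "(\<integral>p. (g p)\<^sup>2 \<partial>NN) = (\<integral>p. \<kappa>\<^sup>2 * indicator (S \<times> S) p +
          (\<nu>\<^sup>2 * indicator (S \<times> T) p + (\<nu>\<^sup>2 * indicator (T \<times> S) p +
          (2 * \<nu>\<^sup>2 * indicator ((S \<inter> T) \<times> (S \<inter> T)) p +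
          (2 * (\<kappa> * \<nu>) * indicator (S \<times> (S \<inter> T)) p + 2 * (\<kappa> * \<nu>) * indicator ((S \<inter> T) \<times> S) p)))) \<partial>NN)"
        by (intro Bochner_Integration.integral_cong)
           (auto simp: g_def indicator_def power2_eq_square algebra_simps)
      also have "\<dots> = \<kappa>\<^sup>2 * (s * s) + (\<nu>\<^sup>2 * (s * t) + (\<nu>\<^sup>2 * (t * s) + (2 * \<nu>\<^sup>2 * (m * m) +
          (2 * (\<kappa> * \<nu>) * (s * m) + 2 * (\<kappa> * \<nu>) * (m * s)))))"
        using iI by (simp add: s_def t_def m_def)
      finally show ?thesis by (simp add: power2_eq_square algebra_simps)
    qed
    \<comment> \<open>Twice an amount above \<open>e^2\<close>, minus an amount below
      \<open>e^2/2\<close>.\<close>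
    have "(real 2 - 1 / 2) * e\<^sup>2 \<le> 2 * (u\<^sup>2 / (s * t)) - (v / s)\<^sup>2" using False u2 by simp
    then have "defect P' \<le> defect P - (real 2 - 1 / 2) * e\<^sup>2" using P'(5) gain unfolding Ug g2 by linarith
    then show thesis using that[OF P'(1,2), of 2] P'(3,4) by simp
  qed
qed

end

section \<open>Iterating the cuts and combining the two phases\<close>

context bounded_graphex
begin

definition kernel_close :: "real \<Rightarrow> 'a set set \<Rightarrow> bool" where
  "kernel_close e P \<longleftrightarrow> (\<forall>S\<in>test_sets M. \<forall>T\<in>test_sets M.
     \<bar>LINT p:S \<times> T|NN. W p - WP P p\<bar> \<le> e * sqrt (measure M S * measure M T))"

definition degree_close :: "real \<Rightarrow> 'a set set \<Rightarrow> bool" where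
  "degree_close e P \<longleftrightarrow> (\<forall>S\<in>test_sets M.
     \<bar>LINT x:S|M. F x - block_avg M P F x\<bar> \<le> e * sqrt (measure M S))"

lemma test_setsD:
  assumes "S \<in> test_sets M"
  shows "S \<in> sets M" "emeasure M S < \<infinity>" "0 < measure M S"
  using assms by (auto simp: test_sets_def measure_def enn2real_positive_iff less_top)

lemma kernel_closeI:
  assumes "finite_subspace_partition M A P" "0 < e" "defect P \<le> e\<^sup>2"
  shows "kernel_close e P"
  unfolding kernel_close_def by (intro ballI cut_defect[OF assms(1,2) _ _ _ _ _ _ assms(3)] test_setsD)

lemma degree_closeI:
  assumes "\<And>S. S \<in> sets M \<Longrightarrow> emeasure M S < \<infinity> \<Longrightarrow> 0 < measure M S \<Longrightarrow>
    \<bar>LINT x:S|M. F x - block_avg M P F x\<bar> \<le> e * sqrt (measure M S)"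
  shows "degree_close e P"
  unfolding degree_close_def by (intro ballI assms test_setsD)

lemma jumble_dist_le:
  assumes P: "finite_subspace_partition M A P" and e: "0 < e"
    and k: "kernel_close e P" and d: "degree_close e P"
  shows "jumble_dist M G (graphex_average M A P G) \<le> ennreal e"
proof -
  let ?H = "graphex_average M A P G"
  have div: "ennreal (1 / r * \<bar>x\<bar>) \<le> ennreal e" if "\<bar>x\<bar> \<le> e * r" "0 < r" for r x
    using that by (intro ennreal_leI) (simp add: pos_divide_le_eq)
  have "jumble_norm2 M (\<lambda>x y. kernel G x y - kernel ?H x y) \<le> ennreal e"
    unfolding jumble_norm2_def
  proof (intro SUP_least, clarify)
    fix S T assume ST: "S \<in> test_sets M" "T \<in> test_sets M"
    have "(LINT p:S \<times> T|NN. kernel G (fst p) (snd p) - kernel ?H (fst p) (snd p)) =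
        (LINT p:S \<times> T|NN. W p - WP P p)"
      by (simp add: avg_kernel[OF P] W_def)
    moreover have "\<bar>LINT p:S \<times> T|NN. W p - WP P p\<bar> \<le> e * sqrt (measure M S * measure M T)"
      using k ST by (simp add: kernel_close_def)
    ultimately show "ennreal (1 / sqrt (measure M S * measure M T) *
        \<bar>LINT p:S \<times> T|NN. kernel G (fst p) (snd p) - kernel ?H (fst p) (snd p)\<bar>) \<le> ennreal e"
      using test_setsD(3)[OF ST(1)] test_setsD(3)[OF ST(2)] by (intro div) auto
  qed
  moreover have "jumble_norm1 M (\<lambda>x. F x - graphex_degree M ?H x) \<le> ennreal e"
    unfolding jumble_norm1_def
  proof (intro SUP_least)
    fix S assume S: "S \<in> test_sets M"
    show "ennreal (1 / sqrt (measure M S) * \<bar>LINT x:S|M. F x - graphex_degree M ?H x\<bar>) \<le> ennreal e"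
      using d S test_setsD(3)[OF S] by (intro div) (auto simp: avg_degree[OF P] degree_close_def)
  qed
  moreover have "ennreal \<bar>graphex_rho M G - graphex_rho M ?H\<bar> \<le> ennreal e"
    using e by (simp add: avg_rho[OF P])
  ultimately show ?thesis by (simp add: jumble_dist_def)
qed

lemma emeasure_extend:
  assumes A: "A \<in> sets M" and A': "A' \<in> sets M" and A'': "A'' \<in> sets M"
    and a: "emeasure M (A' - A) \<le> ennreal a" and b: "emeasure M (A'' - A') \<le> ennreal b"
    and nn: "0 \<le> a" "0 \<le> b"
  shows "emeasure M (A'' - A) \<le> ennreal (a + b)"
proof -
  have "emeasure M (A'' - A) \<le> emeasure M ((A' - A) \<union> (A'' - A'))"
    using A A' A'' by (intro emeasure_mono) auto
  also have "\<dots> \<le> emeasure M (A' - A) + emeasure M (A'' - A')"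
    using A A' A'' by (intro emeasure_subadditive) auto
  also have "\<dots> \<le> ennreal a + ennreal b" by (rule add_mono[OF a b])
  finally show ?thesis using nn by (simp add: ennreal_plus)
qed

text \<open>The factor \<open>2\<^sup>-\<^sup>1\<close> in the second alternative is gained at the last cut: the defect before it
  still exceeds what the cut is charged for by \<open>\<epsilon>\<^sup>2/2\<close>.\<close>

lemma kernel_refinement_aux:
  assumes e: "0 < e"
  shows "finite_subspace_partition M A P \<Longrightarrow> defect P \<le> real n * (e\<^sup>2 / 2) \<Longrightarrow>
    \<exists>A' P'. finite_subspace_partition M A' P' \<and> block_refines P' P \<and> kernel_close e P' \<and>
      (real (card P') + 1 \<le> real (card P) + 1 \<or>
       real (card P') + 1 \<le> (real (card P) + 1) * 2 powr (2 * defect P / e\<^sup>2 - 1)) \<and>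
      emeasure M (A' - A) \<le> ennreal (8 * C * D * defect P / e ^ 4)"
proof (induction n arbitrary: A P)
  case (0 A P)
  have "defect P \<le> e\<^sup>2" using 0(2) by (simp add: order_trans)
  then have "kernel_close e P" by (rule kernel_closeI[OF 0(1) e])
  then show ?case using 0 block_refines_refl by (intro exI[of _ A] exI[of _ P]) auto
next
  case (Suc n A P)
  show ?case
  proof (cases "kernel_close e P")
    case True
    then show ?thesis using Suc.prems block_refines_refl by (intro exI[of _ A] exI[of _ P]) auto
  next
    case False
    then obtain S T where ST: "S \<in> test_sets M" "T \<in> test_sets M"
      and bad: "e * sqrt (measure M S * measure M T) < \<bar>LINT p:S \<times> T|NN. W p - WP P p\<bar>"
      unfolding kernel_close_def by (auto simp: not_le)
    note P = Suc.prems(1)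
    have big: "e\<^sup>2 < defect P"
      using cut_defect[OF P e test_setsD[OF ST(1)] test_setsD[OF ST(2)]] bad by linarith
    obtain A\<^sub>1 P\<^sub>1 \<delta> where 1: "finite_subspace_partition M A\<^sub>1 P\<^sub>1" "block_refines P\<^sub>1 P"
      "\<delta> = 1 \<or> \<delta> = 2" "real (card P\<^sub>1) + 1 \<le> 2 ^ \<delta> * (real (card P) + 1)"
      "defect P\<^sub>1 \<le> defect P - (real \<delta> - 1 / 2) * e\<^sup>2"
      "emeasure M (A\<^sub>1 - A) \<le> ennreal (real \<delta> * (4 * C * D / e\<^sup>2))"
      using cut_step[OF P e test_setsD[OF ST(1)] test_setsD[OF ST(2)] bad] by metis
    have e2: "0 < e\<^sup>2" using e by simp
    \<comment> \<open>As \<open>\<delta> >= 1\<close>, the true decrease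
      \<open>\<delta> - 1/2\<close> is at least \<open>\<delta>/2\<close>. Charging half a unit of
      \<open>e^2\<close> per doubling is what the induction counts, and the surplus remains for the
      last cut.\<close>
    have half: "defect P\<^sub>1 \<le> defect P - real \<delta> * (e\<^sup>2 / 2)" 
    proof -
      have "1 * e\<^sup>2 \<le> real \<delta> * e\<^sup>2" using 1(3) e2 by (intro mult_right_mono) auto
      then show ?thesis using 1(5) by (simp add: algebra_simps)
    qed
    moreover have "1 * (e\<^sup>2 / 2) \<le> real \<delta> * (e\<^sup>2 / 2)" using 1(3) e2 by (intro mult_right_mono) auto
    moreover have "real (Suc n) * (e\<^sup>2 / 2) = real n * (e\<^sup>2 / 2) + 1 * (e\<^sup>2 / 2)" by (simp add: algebra_simps)
    ultimately have "defect P\<^sub>1 \<le> real n * (e\<^sup>2 / 2)" using Suc.prems(2) by linarith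
    from Suc.IH[OF 1(1) this] obtain A' P' where P': "finite_subspace_partition M A' P'"
      "block_refines P' P\<^sub>1" "kernel_close e P'"
      "real (card P') + 1 \<le> real (card P\<^sub>1) + 1 \<or>
       real (card P') + 1 \<le> (real (card P\<^sub>1) + 1) * 2 powr (2 * defect P\<^sub>1 / e\<^sup>2 - 1)"
      "emeasure M (A' - A\<^sub>1) \<le> ennreal (8 * C * D * defect P\<^sub>1 / e ^ 4)" by blast
    have "real (card P') + 1 \<le> (real (card P) + 1) * 2 powr (2 * defect P / e\<^sup>2 - 1)"
      using P'(4)
    proof
      assume "real (card P') + 1 \<le> real (card P\<^sub>1) + 1"
      also note 1(4)
      also have "2 ^ \<delta> * (real (card P) + 1) \<le> 2 powr (2 * defect P / e\<^sup>2 - 1) * (real (card P) + 1)"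
      proof (rule mult_right_mono)
        \<comment> \<open>For \<open>\<delta> = 1\<close> this is \<open>big\<close>. For
          \<open>\<delta> = 2\<close> it says that the defect was at least \<open>3/2 * e^2\<close>,
          which holds because the defect after the cut is nonnegative.\<close>
        have "real \<delta> * e\<^sup>2 \<le> 2 * defect P - e\<^sup>2"
          using 1(3,5) big defect_nonneg[of P\<^sub>1] by (auto simp: algebra_simps)
        then have "real \<delta> \<le> 2 * defect P / e\<^sup>2 - 1" using e2 by (simp add: field_simps)
        then have "2 powr real \<delta> \<le> 2 powr (2 * defect P / e\<^sup>2 - 1)" by (intro powr_mono) auto
        then show "2 ^ \<delta> \<le> 2 powr (2 * defect P / e\<^sup>2 - 1)" by (simp add: powr_realpow)
      qed simp
      finally show ?thesis by (simp add: mult.commute)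
    next
      assume "real (card P') + 1 \<le> (real (card P\<^sub>1) + 1) * 2 powr (2 * defect P\<^sub>1 / e\<^sup>2 - 1)"
      also have "\<dots> \<le> (2 ^ \<delta> * (real (card P) + 1)) * 2 powr (2 * defect P\<^sub>1 / e\<^sup>2 - 1)"
        using 1(4) by (intro mult_right_mono) auto
      also have "\<dots> = (real (card P) + 1) * 2 powr (real \<delta> + (2 * defect P\<^sub>1 / e\<^sup>2 - 1))"
        by (simp add: powr_add powr_realpow)
      also have "\<dots> \<le> (real (card P) + 1) * 2 powr (2 * defect P / e\<^sup>2 - 1)"
      proof (intro mult_left_mono powr_mono)
        show "real \<delta> + (2 * defect P\<^sub>1 / e\<^sup>2 - 1) \<le> 2 * defect P / e\<^sup>2 - 1"
        proof -
          have "(real \<delta> * e\<^sup>2 + 2 * defect P\<^sub>1) / e\<^sup>2 \<le> 2 * defect P / e\<^sup>2"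
            using half e2 by (intro divide_right_mono) auto
          then show ?thesis using e2 by (simp add: add_divide_distrib)
        qed
      qed auto
      finally show ?thesis .
    qed
    moreover have "emeasure M (A' - A) \<le> ennreal (8 * C * D * defect P / e ^ 4)"
    proof -
      have "emeasure M (A' - A) \<le> ennreal (real \<delta> * (4 * C * D / e\<^sup>2) + 8 * C * D * defect P\<^sub>1 / e ^ 4)"
        by (rule emeasure_extend[OF _ _ _ 1(6) P'(5)])
           (use P 1(1) P'(1) BCD_nonneg defect_nonneg e in \<open>auto simp: finite_subspace_partition_def\<close>)
      also have "\<dots> \<le> ennreal (8 * C * D * defect P / e ^ 4)"
      proof (rule ennreal_leI)
        have "8 * C * D / e ^ 4 * (real \<delta> * (e\<^sup>2 / 2) + defect P\<^sub>1) \<le> 8 * C * D / e ^ 4 * defect P"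
          using half BCD_nonneg by (intro mult_left_mono) auto
        \<comment> \<open>Measure is spent in proportion to defect: \<open>4 * C * D / e^2\<close>
          per half unit \<open>e^2/2\<close>.\<close>
        moreover have "8 * C * D / e ^ 4 * (real \<delta> * (e\<^sup>2 / 2) + defect P\<^sub>1) =
            real \<delta> * (4 * C * D / e\<^sup>2) + 8 * C * D * defect P\<^sub>1 / e ^ 4"
          using e by (simp add: field_simps power2_eq_square power4_eq_xxxx)
        ultimately show "real \<delta> * (4 * C * D / e\<^sup>2) + 8 * C * D * defect P\<^sub>1 / e ^ 4 \<le> 8 * C * D * defect P / e ^ 4"
          by simp
      qed
      finally show ?thesis .
    qed
    ultimately show ?thesis using P'(1,3) block_refines_trans[OF 1(2) P'(2)] by blast
  qed
qed

text \<open>The value 1 in the maximum stands for the run without any cut, where there is no last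
  cut to save on.\<close>

lemma kernel_refinement:
  assumes P: "finite_subspace_partition M A P" and e: "0 < e"
  obtains A' P' where "finite_subspace_partition M A' P'" "block_refines P' P" "kernel_close e P'"
    "real (card P') + 1 \<le> (real (card P) + 1) * max 1 (2 powr (2 * (B * C) / e\<^sup>2 - 1))"
    "emeasure M (A' - A) \<le> ennreal (8 * B * C\<^sup>2 * D / e ^ 4)"
proof -
  have e2: "0 < e\<^sup>2" using e by simp
  define n where "n = nat \<lceil>defect P / (e\<^sup>2 / 2)\<rceil>"
  have "defect P / (e\<^sup>2 / 2) \<le> real n" unfolding n_def by (rule real_nat_ceiling_ge)
  then have "defect P \<le> real n * (e\<^sup>2 / 2)" using e2 by (simp add: pos_divide_le_eq)
  from kernel_refinement_aux[OF e P this] obtain A' P' where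
    P': "finite_subspace_partition M A' P'" "block_refines P' P" "kernel_close e P'"
      "real (card P') + 1 \<le> real (card P) + 1 \<or>
       real (card P') + 1 \<le> (real (card P) + 1) * 2 powr (2 * defect P / e\<^sup>2 - 1)"
      "emeasure M (A' - A) \<le> ennreal (8 * C * D * defect P / e ^ 4)" by blast
  have le: "defect P \<le> B * C" by (rule defect_le[OF P])
  have "2 * defect P / e\<^sup>2 \<le> 2 * (B * C) / e\<^sup>2" using le e2 by (intro divide_right_mono) auto
  then have "2 powr (2 * defect P / e\<^sup>2 - 1) \<le> max 1 (2 powr (2 * (B * C) / e\<^sup>2 - 1))"
    by (intro max.coboundedI2 powr_mono) auto
  then have "(real (card P) + 1) * 2 powr (2 * defect P / e\<^sup>2 - 1) \<le>
      (real (card P) + 1) * max 1 (2 powr (2 * (B * C) / e\<^sup>2 - 1))"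
    by (intro mult_left_mono) auto
  moreover have "(real (card P) + 1) * 1 \<le> (real (card P) + 1) * max 1 (2 powr (2 * (B * C) / e\<^sup>2 - 1))"
    by (intro mult_left_mono) auto
  then have "real (card P) + 1 \<le> (real (card P) + 1) * max 1 (2 powr (2 * (B * C) / e\<^sup>2 - 1))"
    by (simp only: mult_1_right)
  ultimately have card: "real (card P') + 1 \<le> (real (card P) + 1) * max 1 (2 powr (2 * (B * C) / e\<^sup>2 - 1))"
    using P'(4) order_trans by blast
  have "8 * C * D * defect P / e ^ 4 \<le> 8 * C * D * (B * C) / e ^ 4"
    using le BCD_nonneg e by (intro divide_right_mono mult_left_mono) auto
  also have "\<dots> = 8 * B * C\<^sup>2 * D / e ^ 4" by (simp add: power2_eq_square)
  finally have "emeasure M (A' - A) \<le> ennreal (8 * B * C\<^sup>2 * D / e ^ 4)"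
    by (intro order_trans[OF P'(5)] ennreal_leI)
  then show thesis using that P'(1-3) card by blast
qed

lemma size_bound_split:
  "(4 * C ^ 3 * D + 8 * B * C\<^sup>2 * D) / e ^ 4 = 4 * C ^ 3 * D / e ^ 4 + 8 * B * C\<^sup>2 * D / e ^ 4"
  by (rule add_divide_distrib)

lemma two_phase_refinement:
  assumes Q: "finite_subspace_partition M A Q" and e: "0 < e"
  obtains A' P where "finite_subspace_partition M A' P" "block_refines P Q"
    "real (card P) + 1 \<le> (real (card Q) + 1) * (2 powr (C * D / e\<^sup>2) * max 1 (2 powr (2 * (B * C) / e\<^sup>2 - 1)))"
    "emeasure M (A' - A) \<le> ennreal ((4 * C ^ 3 * D + 8 * B * C\<^sup>2 * D) / e ^ 4)"
    "jumble_dist M G (graphex_average M A' P G) \<le> ennreal e"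
proof -
  obtain A\<^sub>1 P\<^sub>1 where 1: "finite_subspace_partition M A\<^sub>1 P\<^sub>1" "block_refines P\<^sub>1 Q"
    "real (card P\<^sub>1) + 1 \<le> (real (card Q) + 1) * 2 powr (C * D / e\<^sup>2)"
    "emeasure M (A\<^sub>1 - A) \<le> ennreal (4 * C ^ 3 * D / e ^ 4)"
    "(\<integral>x. (F x - block_avg M P\<^sub>1 F x)\<^sup>2 \<partial>M) \<le> e\<^sup>2"
    by (rule Fb.l2_refinement[OF Q e])
  obtain A' P where P: "finite_subspace_partition M A' P" "block_refines P P\<^sub>1" "kernel_close e P"
    "real (card P) + 1 \<le> (real (card P\<^sub>1) + 1) * max 1 (2 powr (2 * (B * C) / e\<^sup>2 - 1))"
    "emeasure M (A' - A\<^sub>1) \<le> ennreal (8 * B * C\<^sup>2 * D / e ^ 4)"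
    by (rule kernel_refinement[OF 1(1) e])
  \<comment> \<open>The earlier degree average is still a step function for the finer partition, so
    the new average is at least as good an \<open>L^2\<close> approximation.\<close>
  have "step_on (space M) P (block_avg M P\<^sub>1 F)"
    by (rule step_on_refine[OF step_on_block_avg[OF parts_block_family[OF 1(1)]] P(2)])
       (use part_sets[OF P(1)] sets.sets_into_space in blast)
  then have "(\<integral>x. (F x - block_avg M P F x)\<^sup>2 \<partial>M) \<le> (\<integral>x. (F x - block_avg M P\<^sub>1 F x)\<^sup>2 \<partial>M)"
    by (rule block_avg_best_approx(2)[OF parts_block_family[OF P(1)] Fb.F Fb.F_square(1)])
  then have "(\<integral>x. (F x - block_avg M P F x)\<^sup>2 \<partial>M) \<le> e\<^sup>2" using 1(5) by simp
  then have "degree_close e P" by (intro degree_closeI Fb.l2_deviation[OF P(1) e])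
  note dist = jumble_dist_le[OF P(1) e P(3) this]
  have "real (card P) + 1 \<le> ((real (card Q) + 1) * 2 powr (C * D / e\<^sup>2)) * max 1 (2 powr (2 * (B * C) / e\<^sup>2 - 1))"
    by (rule order_trans[OF P(4) mult_right_mono[OF 1(3)]]) simp
  then have card: "real (card P) + 1 \<le> (real (card Q) + 1) * (2 powr (C * D / e\<^sup>2) * max 1 (2 powr (2 * (B * C) / e\<^sup>2 - 1)))"
    by (simp only: mult.assoc)
  have "emeasure M (A' - A) \<le> ennreal (4 * C ^ 3 * D / e ^ 4 + 8 * B * C\<^sup>2 * D / e ^ 4)"
    by (rule emeasure_extend[OF _ _ _ 1(4) P(5)])
       (use Q 1(1) P(1) BCD_nonneg e in \<open>auto simp: finite_subspace_partition_def\<close>)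
  then show thesis
    using that[OF P(1) block_refines_trans[OF 1(2) P(2)] card _ dist] by (simp only: size_bound_split)
qed

lemma exponent_eq: "(2 * B * C + C * D) / e\<^sup>2 = C * D / e\<^sup>2 + 2 * (B * C) / e\<^sup>2"
  by (simp add: add_divide_distrib)

text \<open>Starting from the partition with no parts, the count of parts plus one begins at 1, so
  the two exponents fit without any saving.\<close>

lemma regular_partition:
  assumes e: "0 < e"
  shows "\<exists>A P. finite_subspace_partition M A P \<and>
    real (card P) \<le> 2 powr ((2 * B * C + C * D) / e\<^sup>2) \<and>
    emeasure M A \<le> ennreal ((4 * C ^ 3 * D + 8 * B * C\<^sup>2 * D) / e ^ 4) \<and>
    jumble_dist M G (graphex_average M A P G) \<le> ennreal e"
proof -
  have "finite_subspace_partition M {} {}"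
    by (simp add: finite_subspace_partition_def partition_on_def)
  then obtain A P where P: "finite_subspace_partition M A P"
    "real (card P) + 1 \<le> (real (card ({} :: 'a set set)) + 1) *
      (2 powr (C * D / e\<^sup>2) * max 1 (2 powr (2 * (B * C) / e\<^sup>2 - 1)))"
    "emeasure M (A - {}) \<le> ennreal ((4 * C ^ 3 * D + 8 * B * C\<^sup>2 * D) / e ^ 4)"
    "jumble_dist M G (graphex_average M A P G) \<le> ennreal e"
    by (rule two_phase_refinement[OF _ e])
  have "0 \<le> 2 * (B * C) / e\<^sup>2" using BCD_nonneg by simp
  then have "1 \<le> 2 powr (2 * (B * C) / e\<^sup>2)" by (simp add: ge_one_powr_ge_zero)
  moreover have "2 powr (2 * (B * C) / e\<^sup>2 - 1) \<le> 2 powr (2 * (B * C) / e\<^sup>2)" by (intro powr_mono) auto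
  ultimately have "2 powr (C * D / e\<^sup>2) * max 1 (2 powr (2 * (B * C) / e\<^sup>2 - 1)) \<le>
      2 powr (C * D / e\<^sup>2) * 2 powr (2 * (B * C) / e\<^sup>2)"
    by (intro mult_left_mono) auto
  moreover have "real (card P) + 1 \<le> 2 powr (C * D / e\<^sup>2) * max 1 (2 powr (2 * (B * C) / e\<^sup>2 - 1))"
    using P(2) by (simp only: card.empty of_nat_0 add_0_left mult_1_left)
  ultimately have "real (card P) \<le> 2 powr ((2 * B * C + C * D) / e\<^sup>2)"
    unfolding exponent_eq powr_add by linarith
  then show ?thesis using P by auto
qed

text \<open>Nonempty \<open>Q\<close> means \<open>card Q + 1 <= 2 * card Q\<close>, which is
  exactly the factor of two to be recovered. For empty \<open>Q\<close> the bound would leave no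
  part at all.\<close>

lemma regular_refinement:
  assumes e: "0 < e" and Q: "finite_subspace_partition M A\<^sub>Q Q" "Q \<noteq> {}"
  shows "\<exists>A P. finite_subspace_partition M A P \<and> subspace_refines A P A\<^sub>Q Q \<and>
    real (card P) \<le> real (card Q) * 2 powr ((2 * B * C + C * D) / e\<^sup>2) \<and>
    emeasure M A \<le> emeasure M A\<^sub>Q + ennreal ((4 * C ^ 3 * D + 8 * B * C\<^sup>2 * D) / e ^ 4) \<and>
    jumble_dist M G (graphex_average M A P G) \<le> ennreal e"
proof -
  have e2: "0 < e\<^sup>2" using e by simp
  have q1: "1 \<le> real (card Q)"
    using Q by (auto simp: finite_subspace_partition_def Suc_le_eq card_gt_0_iff)
  have "\<exists>A P. finite_subspace_partition M A P \<and> block_refines P Q \<and>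
    real (card P) \<le> real (card Q) * 2 powr ((2 * B * C + C * D) / e\<^sup>2) \<and>
    emeasure M (A - A\<^sub>Q) \<le> ennreal ((4 * C ^ 3 * D + 8 * B * C\<^sup>2 * D) / e ^ 4) \<and>
    jumble_dist M G (graphex_average M A P G) \<le> ennreal e"
  proof (cases "e\<^sup>2 / 2 \<le> B * C")
    case True
    obtain A P where P: "finite_subspace_partition M A P" "block_refines P Q"
      "real (card P) + 1 \<le> (real (card Q) + 1) * (2 powr (C * D / e\<^sup>2) * max 1 (2 powr (2 * (B * C) / e\<^sup>2 - 1)))"
      "emeasure M (A - A\<^sub>Q) \<le> ennreal ((4 * C ^ 3 * D + 8 * B * C\<^sup>2 * D) / e ^ 4)"
      "jumble_dist M G (graphex_average M A P G) \<le> ennreal e"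
      by (rule two_phase_refinement[OF Q(1) e])
    \<comment> \<open>The exponent after saving one unit is nonnegative, so the saving is present
      whether or not a cut was made.\<close>
    have "1 \<le> 2 * (B * C) / e\<^sup>2" using True e2 by (simp add: pos_le_divide_eq)
    then have "max 1 (2 powr (2 * (B * C) / e\<^sup>2 - 1)) = 2 powr (2 * (B * C) / e\<^sup>2 - 1)"
      by (simp add: max_def ge_one_powr_ge_zero)
    then have factor: "2 powr (C * D / e\<^sup>2) * max 1 (2 powr (2 * (B * C) / e\<^sup>2 - 1)) =
        2 powr ((2 * B * C + C * D) / e\<^sup>2) / 2"
      unfolding exponent_eq by (simp add: powr_add powr_diff)
    note P(3)[unfolded factor]
    also have "(real (card Q) + 1) * (2 powr ((2 * B * C + C * D) / e\<^sup>2) / 2) \<le> (2 * real (card Q)) * (2 powr ((2 * B * C + C * D) / e\<^sup>2) / 2)"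
      using q1 by (intro mult_right_mono) auto
    finally have "real (card P) \<le> real (card Q) * 2 powr ((2 * B * C + C * D) / e\<^sup>2)" by simp
    then show ?thesis using P(1,2,4,5) by (intro exI[of _ A] exI[of _ P] conjI)
  next
    case False
    obtain A P where P: "finite_subspace_partition M A P" "block_refines P Q"
      "real (card P) \<le> real (card Q) * 2 powr (C * D / e\<^sup>2)"
      "emeasure M (A - A\<^sub>Q) \<le> ennreal (4 * C ^ 3 * D / e ^ 4)"
      "\<And>S. S \<in> sets M \<Longrightarrow> emeasure M S < \<infinity> \<Longrightarrow> 0 < measure M S \<Longrightarrow>
        \<bar>LINT x:S|M. F x - block_avg M P F x\<bar> \<le> e * sqrt (measure M S)"
      by (rule Fb.jumble_refinement[OF Q e]) (rule that)
    have "degree_close e P" by (rule degree_closeI[OF P(5)])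
    \<comment> \<open>With \<open>B * C < e^2/2\<close> every partition is close for the kernel, by
      Cauchy-Schwarz.\<close>
    moreover have "defect P \<le> e\<^sup>2" using defect_le[OF P(1)] False e2 by linarith
    then have "kernel_close e P" by (rule kernel_closeI[OF P(1) e])
    ultimately have dist: "jumble_dist M G (graphex_average M A P G) \<le> ennreal e"
      by (intro jumble_dist_le[OF P(1) e])
    have "C * D / e\<^sup>2 \<le> (2 * B * C + C * D) / e\<^sup>2" using BCD_nonneg by (intro divide_right_mono) auto
    then have "real (card Q) * 2 powr (C * D / e\<^sup>2) \<le> real (card Q) * 2 powr ((2 * B * C + C * D) / e\<^sup>2)"
      by (intro mult_left_mono powr_mono) auto
    moreover have "ennreal (4 * C ^ 3 * D / e ^ 4) \<le> ennreal ((4 * C ^ 3 * D + 8 * B * C\<^sup>2 * D) / e ^ 4)"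
      unfolding size_bound_split using BCD_nonneg by (intro ennreal_leI) simp
    ultimately show ?thesis using P(1-4) dist by (meson order_trans)
  qed
  then obtain A P where P: "finite_subspace_partition M A P" "block_refines P Q"
    "real (card P) \<le> real (card Q) * 2 powr ((2 * B * C + C * D) / e\<^sup>2)"
    "emeasure M (A - A\<^sub>Q) \<le> ennreal ((4 * C ^ 3 * D + 8 * B * C\<^sup>2 * D) / e ^ 4)"
    "jumble_dist M G (graphex_average M A P G) \<le> ennreal e" by blast
  have sets: "A \<in> sets M" "A\<^sub>Q \<in> sets M" using P(1) Q(1) by (auto simp: finite_subspace_partition_def)
  have "emeasure M A \<le> emeasure M (A\<^sub>Q \<union> (A - A\<^sub>Q))" using sets by (intro emeasure_mono) auto
  also have "\<dots> \<le> emeasure M A\<^sub>Q + emeasure M (A - A\<^sub>Q)" using sets by (intro emeasure_subadditive) auto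
  also have "\<dots> \<le> emeasure M A\<^sub>Q + ennreal ((4 * C ^ 3 * D + 8 * B * C\<^sup>2 * D) / e ^ 4)"
    by (rule add_left_mono[OF P(4)])
  finally show ?thesis using P subspace_refinesI[OF P(1) Q(1) P(2)] by blast
qed

end

theorem theorem5p3:
  fixes M :: "'a measure" and G :: "'a graphex" and B C D \<epsilon> :: real
  assumes "\<epsilon> > 0"
    and "signed_graphex M G"
    and "graphex_bounded M B C D G"
  shows "(\<exists>A P. finite_subspace_partition M A P \<and>
            real (card P) \<le> 2 powr ((2 * B * C + C * D) / \<epsilon>^2) \<and>
            emeasure M A \<le> ennreal ((4 * C^3 * D + 8 * B * C^2 * D) / \<epsilon>^4) \<and>
            jumble_dist M G (graphex_average M A P G) \<le> ennreal \<epsilon>) \<and>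
         (\<forall>A\<^sub>Q Q. finite_subspace_partition M A\<^sub>Q Q \<and> Q \<noteq> {} \<longrightarrow>
            (\<exists>A P. finite_subspace_partition M A P \<and> subspace_refines A P A\<^sub>Q Q \<and>
               real (card P) \<le> real (card Q) * 2 powr ((2 * B * C + C * D) / \<epsilon>^2) \<and>
               emeasure M A \<le> emeasure M A\<^sub>Q + ennreal ((4 * C^3 * D + 8 * B * C^2 * D) / \<epsilon>^4) \<and>
               jumble_dist M G (graphex_average M A P G) \<le> ennreal \<epsilon>))"
proof -
  interpret bounded_graphex M G B C D
    using assms(2,3) by unfold_locales
  show ?thesis
    using regular_partition[OF assms(1)] regular_refinement[OF assms(1)] by blast
qed

end
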